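(* Let $M,\bar M$ be smooth manifolds of the same dimension, $N\subset M\times\bar M$ open, and $c\in C^4(N)$ a bi-twisted, non-degenerate cost; let $h$ be the pseudo-Riemannian metric on $N$ induced by $c$. The following are equivalent. 1. $(N,h)$ is non-negatively cross-curved. 2. For each $h$-geodesic $\sigma:t\in[0,1]\mapsto(x,\bar x(t))\in N$ and each sufficiently small neighbourhood $U\subset V_\sigma$ of $x$, where $V_\sigma:=\bigcap_{0\le t\le1}V(x,\bar x(t))$, the function $f_t(y):=-c(y,\bar x(t))+c(x,\bar x(t))$ is a convex function of $t\in[0,1]$ for each $y\in U$, i.e. $\frac{\partial^2}{\partial t^2}f_t(y)\ge0$ for $0\le t\le1$.
   Context: $D$, $\bar D$ denote differentials along $M$ and $\bar M$. Visible sets: $N(\bar x)=\{x\in M:(x,\bar x)\in N\}$, $\bar N(x)=\{\bar x\in\bar M:(x,\bar x)\in N\}$. The cost is bi-twisted (A1) if for all $(x,\bar x)\in N$ the maps $Dc(x,\cdot):\bar N(x)\to T_x^*M$ and $\bar Dc(\cdot,\bar x):N(\bar x)\to T^*_{\bar x}\bar M$ are injective; it is non-degenerate (A2) if $D\bar Dc$, i.e. the matrix $(c_{i\bar j})$ of mixed second derivatives in local coordinates $x^i$ on $M$ and $x^{\bar j}$ on $\bar M$, is invertible at every point of $N$. The induced pseudo-Riemannian metric on $TN=TM\oplus T\bar M$ is $$h=\begin{pmatrix}0&-\frac12\bar DDc\\-\frac12 D\bar Dc&0\end{pmatrix},\qquad\text{i.e. } h(p\oplus\bar p,p\oplus\bar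 p)=-c_{i\bar j}\,p^i\bar p^{\bar j}.$$ The cross-curvature is $\operatorname{cross}_{(x,\bar x)}(p,\bar p)=R_h((p\oplus0)\wedge(0\oplus\bar p),(p\oplus0)\wedge(0\oplus\bar p))$, with $R_h$ the Riemann curvature operator of $h$, with sign and normalization such that $$\operatorname{cross}_{(x,\bar x)}(p,\bar p)=2\left(-c_{ij\bar k\bar l}+c_{ij\bar a}\,c^{\bar a b}\,c_{b\bar k\bar l}\right)p^ip^j\bar p^{\bar k}\bar p^{\bar l},$$ $(c^{\bar a b})$ being the inverse of $(c_{b\bar a})$. $(N,h)$ is non-negatively cross-curved if $\operatorname{cross}_{(x,\bar x)}(p,\bar p)\ge0$ for all $(x,\bar x)\in N$ and all $p\oplus\bar p\in T_{(x,\bar x)}N$. Geodesics are affinely parameterized geodesics of $h$; the submanifolds $\{x\}\times\bar N(x)$ and $N(\bar x)\times\{\bar x\}$ are totally geodesic. Illuminated set: for $(x,\bar x)\in N$, $V(x,\bar x)\subset M$ is the set of points $y\in N(\bar x)$ for which there is an $h$-geodesic from $(x,\bar x)$ to $(y,\bar x)$ in $N(\bar x)\times\{\bar x\}$. *)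

theory Defs
  imports "HOL-Analysis.Analysis"
begin

section \<open>Differentiability classes and smooth atlases\<close>

definition dir_deriv ::
  "'a::real_normed_vector \<Rightarrow> ('a \<Rightarrow> 'b::real_normed_vector) \<Rightarrow> 'a \<Rightarrow> 'b" where
  "dir_deriv v f z = frechet_derivative f (at z) v"

text \<open>Only meant for open sets.\<close>

primrec Ck_on :: "nat \<Rightarrow> ('a::real_normed_vector \<Rightarrow> 'b::real_normed_vector) \<Rightarrow> 'a set \<Rightarrow> bool" where
  "Ck_on 0 f S \<longleftrightarrow> continuous_on S f"
| "Ck_on (Suc k) f S \<longleftrightarrow>
     (\<forall>z\<in>S. f differentiable (at z)) \<and> (\<forall>v. Ck_on k (dir_deriv v f) S)"

definition smooth_on :: "('a::real_normed_vector \<Rightarrow> 'b::real_normed_vector) \<Rightarrow> 'a set \<Rightarrow> bool" where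
  "smooth_on f S \<longleftrightarrow> (\<forall>k. Ck_on k f S)"

text \<open>A manifold is a (Hausdorff, second countable) type together with a smooth atlas, which need
  not be maximal. A chart is its domain together with its coordinate map; the coordinate map is
  irrelevant outside the domain.\<close>

type_synonym ('m, 'n) chart = "'m set \<times> ('m \<Rightarrow> real ^ 'n)"

abbreviation cdom :: "('m, 'n::finite) chart \<Rightarrow> 'm set" where
  "cdom \<equiv> fst"

abbreviation cmap :: "('m, 'n::finite) chart \<Rightarrow> 'm \<Rightarrow> real ^ 'n" where
  "cmap \<equiv> snd"

definition cinv :: "('m, 'n::finite) chart \<Rightarrow> real ^ 'n \<Rightarrow> 'm" where
  "cinv \<kappa> = inv_into (cdom \<kappa>) (cmap \<kappa>)"

definition is_chart :: "('m::topological_space, 'n::finite) chart \<Rightarrow> bool" where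
  "is_chart \<kappa> \<longleftrightarrow> open (cdom \<kappa>) \<and> open (cmap \<kappa> ` cdom \<kappa>) \<and>
     homeomorphism (cdom \<kappa>) (cmap \<kappa> ` cdom \<kappa>) (cmap \<kappa>) (cinv \<kappa>)"

definition smooth_atlas :: "('m::topological_space, 'n::finite) chart set \<Rightarrow> bool" where
  "smooth_atlas A \<longleftrightarrow>
     (\<forall>\<kappa>\<in>A. is_chart \<kappa>) \<and>
     (\<Union>\<kappa>\<in>A. cdom \<kappa>) = UNIV \<and>
     (\<forall>\<kappa>\<in>A. \<forall>\<mu>\<in>A. smooth_on (cmap \<mu> \<circ> cinv \<kappa>) (cmap \<kappa> ` (cdom \<kappa> \<inter> cdom \<mu>)))"

section \<open>Pseudo-Riemannian geometry in coordinates\<close>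

text \<open>A metric on an open subset of a Euclidean space is given by \<open>g z u v\<close>, the value at the point
  \<open>z\<close> on the tangent vectors \<open>u\<close> and \<open>v\<close>. The Levi-Civita connection of a non-degenerate metric is
  determined by the Koszul formula for constant (coordinate) vector fields; \<open>christoffel g z u v\<close> is
  the vector with components \<open>\<Gamma>\<^sup>k\<^sub>i\<^sub>j u\<^sup>i v\<^sup>j\<close>.\<close>

definition christoffel ::
  "('e::euclidean_space \<Rightarrow> 'e \<Rightarrow> 'e \<Rightarrow> real) \<Rightarrow> 'e \<Rightarrow> 'e \<Rightarrow> 'e \<Rightarrow> 'e" where
  "christoffel g z u v = (THE a. \<forall>w. g z a w =
     (dir_deriv u (\<lambda>y. g y v w) z + dir_deriv v (\<lambda>y. g y u w) z - dir_deriv w (\<lambda>y. g y u v) z) / 2)"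

text \<open>\<open>R(u,v)w = \<nabla>\<^sub>u\<nabla>\<^sub>v w - \<nabla>\<^sub>v\<nabla>\<^sub>u w\<close> for constant vector fields.\<close>

definition riemann ::
  "('e::euclidean_space \<Rightarrow> 'e \<Rightarrow> 'e \<Rightarrow> real) \<Rightarrow> 'e \<Rightarrow> 'e \<Rightarrow> 'e \<Rightarrow> 'e \<Rightarrow> 'e" where
  "riemann g z u v w =
     dir_deriv u (\<lambda>y. christoffel g y v w) z - dir_deriv v (\<lambda>y. christoffel g y u w) z
     + christoffel g z u (christoffel g z v w) - christoffel g z v (christoffel g z u w)"

text \<open>Bivectors are represented by their components in the standard basis, with
  \<open>u \<and> v = u \<otimes> v - v \<otimes> u\<close>. The curvature operator is the bilinear form
  \<open>R\<^sub>a\<^sub>b\<^sub>c\<^sub>d \<omega>\<^sup>a\<^sup>b \<eta>\<^sup>c\<^sup>d\<close>, where \<open>R\<^sub>a\<^sub>b\<^sub>c\<^sub>d = g(R(a,b)d, c)\<close> (positive on round spheres). Hence its value at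
  \<open>(u \<and> v, u \<and> v)\<close> is \<open>4 g(R(u,v)v, u)\<close>, which is the normalization producing the factor 2 in
  \<open>cross(p,q) = 2 (- c\<^sub>i\<^sub>j\<^sub>k\<^sub>l + c\<^sub>i\<^sub>j\<^sub>a c\<^sup>a\<^sup>b c\<^sub>b\<^sub>k\<^sub>l) p\<^sup>i p\<^sup>j q\<^sup>k q\<^sup>l\<close> (indices \<open>i, j, b\<close> refer to \<open>M\<close>, and
  \<open>k, l, a\<close> to the second manifold).\<close>

definition wedge :: "'e::euclidean_space \<Rightarrow> 'e \<Rightarrow> 'e \<Rightarrow> 'e \<Rightarrow> real" where
  "wedge u v a b = (u \<bullet> a) * (v \<bullet> b) - (v \<bullet> a) * (u \<bullet> b)"

definition curvature_operator ::
  "('e::euclidean_space \<Rightarrow> 'e \<Rightarrow> 'e \<Rightarrow> real) \<Rightarrow> 'e \<Rightarrow> ('e \<Rightarrow> 'e \<Rightarrow> real) \<Rightarrow> ('e \<Rightarrow> 'e \<Rightarrow> real) \<Rightarrow> real"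
  where
  "curvature_operator g z \<omega> \<eta> =
     (\<Sum>a\<in>Basis. \<Sum>b\<in>Basis. \<Sum>c\<in>Basis. \<Sum>d\<in>Basis. g z (riemann g z a b d) c * \<omega> a b * \<eta> c d)"

section \<open>Costs\<close>

text \<open>In the following \<open>A\<close> and \<open>B\<close> are atlases of the two manifolds \<open>M\<close> and \<open>M'\<close>, \<open>N\<close> is an open
  subset of \<open>M \<times> M'\<close>, and only the values of the cost \<open>c\<close> on \<open>N\<close> matter. Geometric notions are
  required in all charts of the given atlases.\<close>

definition visible_left :: "('m \<times> 'k) set \<Rightarrow> 'k \<Rightarrow> 'm set" where
  "visible_left N xb = {x. (x, xb) \<in> N}"

definition visible_right :: "('m \<times> 'k) set \<Rightarrow> 'm \<Rightarrow> 'k set" where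
  "visible_right N x = {xb. (x, xb) \<in> N}"

definition pair_coords ::
  "('m, 'n::finite) chart \<Rightarrow> ('k, 'n) chart \<Rightarrow> 'm \<times> 'k \<Rightarrow> (real ^ 'n) \<times> (real ^ 'n)" where
  "pair_coords \<kappa> \<mu> = map_prod (cmap \<kappa>) (cmap \<mu>)"

definition coord_cost ::
  "('m \<times> 'k \<Rightarrow> real) \<Rightarrow> ('m, 'n::finite) chart \<Rightarrow> ('k, 'n) chart \<Rightarrow> (real ^ 'n) \<times> (real ^ 'n) \<Rightarrow> real"
  where
  "coord_cost c \<kappa> \<mu> = c \<circ> map_prod (cinv \<kappa>) (cinv \<mu>)"

definition Ck_cost ::
  "nat \<Rightarrow> ('m, 'n::finite) chart set \<Rightarrow> ('k, 'n) chart set \<Rightarrow> ('m \<times> 'k) set \<Rightarrow> ('m \<times> 'k \<Rightarrow> real) \<Rightarrow> bool"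
  where
  "Ck_cost r A B N c \<longleftrightarrow> (\<forall>\<kappa>\<in>A. \<forall>\<mu>\<in>B.
     Ck_on r (coord_cost c \<kappa> \<mu>) (pair_coords \<kappa> \<mu> ` (N \<inter> cdom \<kappa> \<times> cdom \<mu>)))"

text \<open>Covectors at \<open>x\<close> are represented in a chart as linear functionals on coordinate vectors.\<close>

definition bi_twisted ::
  "('m, 'n::finite) chart set \<Rightarrow> ('k, 'n) chart set \<Rightarrow> ('m \<times> 'k) set \<Rightarrow> ('m \<times> 'k \<Rightarrow> real) \<Rightarrow> bool"
  where
  "bi_twisted A B N c \<longleftrightarrow> (\<forall>(x, xb)\<in>N.
     (\<forall>\<kappa>\<in>A. x \<in> cdom \<kappa> \<longrightarrow>
        inj_on (\<lambda>yb. frechet_derivative (\<lambda>u. c (cinv \<kappa> u, yb)) (at (cmap \<kappa> x)))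
          (visible_right N x)) \<and>
     (\<forall>\<mu>\<in>B. xb \<in> cdom \<mu> \<longrightarrow>
        inj_on (\<lambda>y. frechet_derivative (\<lambda>u. c (y, cinv \<mu> u)) (at (cmap \<mu> xb)))
          (visible_left N xb)))"

definition mixed_hessian :: "((real ^ 'n) \<times> (real ^ 'n) \<Rightarrow> real) \<Rightarrow>
    (real ^ 'n) \<times> (real ^ 'n) \<Rightarrow> real ^ 'n ^ 'n::finite" where
  "mixed_hessian C z = (\<chi> i j. dir_deriv (axis i 1, 0) (dir_deriv (0, axis j 1) C) z)"

definition nondegenerate_cost ::
  "('m, 'n::finite) chart set \<Rightarrow> ('k, 'n) chart set \<Rightarrow> ('m \<times> 'k) set \<Rightarrow> ('m \<times> 'k \<Rightarrow> real) \<Rightarrow> bool"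
  where
  "nondegenerate_cost A B N c \<longleftrightarrow> (\<forall>\<kappa>\<in>A. \<forall>\<mu>\<in>B. \<forall>q \<in> N \<inter> cdom \<kappa> \<times> cdom \<mu>.
     invertible (mixed_hessian (coord_cost c \<kappa> \<mu>) (pair_coords \<kappa> \<mu> q)))"

text \<open>Polarization of \<open>h(p \<oplus> q, p \<oplus> q) = - c\<^sub>i\<^sub>j p\<^sup>i q\<^sup>j\<close>.\<close>

definition cost_metric :: "((real ^ 'n::finite) \<times> (real ^ 'n) \<Rightarrow> real) \<Rightarrow>
    (real ^ 'n) \<times> (real ^ 'n) \<Rightarrow> (real ^ 'n) \<times> (real ^ 'n) \<Rightarrow> (real ^ 'n) \<times> (real ^ 'n) \<Rightarrow> real"
  where
  "cost_metric C z u v =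
     - (fst u \<bullet> (mixed_hessian C z *v snd v) + fst v \<bullet> (mixed_hessian C z *v snd u)) / 2"

definition cross_curvature :: "((real ^ 'n::finite) \<times> (real ^ 'n) \<Rightarrow> real) \<Rightarrow>
    (real ^ 'n) \<times> (real ^ 'n) \<Rightarrow> real ^ 'n \<Rightarrow> real ^ 'n \<Rightarrow> real"
  where
  "cross_curvature C z p q =
     curvature_operator (cost_metric C) z (wedge (p, 0) (0, q)) (wedge (p, 0) (0, q))"

definition nonneg_cross_curved ::
  "('m, 'n::finite) chart set \<Rightarrow> ('k, 'n) chart set \<Rightarrow> ('m \<times> 'k) set \<Rightarrow> ('m \<times> 'k \<Rightarrow> real) \<Rightarrow> bool"
  where
  "nonneg_cross_curved A B N c \<longleftrightarrow> (\<forall>\<kappa>\<in>A. \<forall>\<mu>\<in>B. \<forall>q \<in> N \<inter> cdom \<kappa> \<times> cdom \<mu>. \<forall>p pb.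
     cross_curvature (coord_cost c \<kappa> \<mu>) (pair_coords \<kappa> \<mu> q) p pb \<ge> 0)"

text \<open>Affinely parameterized \<open>h\<close>-geodesics \<open>[0,1] \<rightarrow> N\<close>, constant ones included; \<open>w\<close> is the
  velocity in coordinates. At \<open>0\<close> and \<open>1\<close> the derivatives are one-sided.\<close>

definition h_geodesic ::
  "('m::topological_space, 'n::finite) chart set \<Rightarrow> ('k::topological_space, 'n) chart set \<Rightarrow>
   ('m \<times> 'k) set \<Rightarrow> ('m \<times> 'k \<Rightarrow> real) \<Rightarrow> (real \<Rightarrow> 'm \<times> 'k) \<Rightarrow> bool"
  where
  "h_geodesic A B N c \<gamma> \<longleftrightarrow>
     continuous_on {0..1} \<gamma> \<and> \<gamma> ` {0..1} \<subseteq> N \<and>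
     (\<forall>\<kappa>\<in>A. \<forall>\<mu>\<in>B. \<exists>w. \<forall>t\<in>{0..1}. \<gamma> t \<in> cdom \<kappa> \<times> cdom \<mu> \<longrightarrow>
        ((\<lambda>s. pair_coords \<kappa> \<mu> (\<gamma> s)) has_vector_derivative w t) (at t within {0..1}) \<and>
        (w has_vector_derivative
           - christoffel (cost_metric (coord_cost c \<kappa> \<mu>)) (pair_coords \<kappa> \<mu> (\<gamma> t)) (w t) (w t))
         (at t within {0..1}))"

definition illuminated ::
  "('m::topological_space, 'n::finite) chart set \<Rightarrow> ('k::topological_space, 'n) chart set \<Rightarrow>
   ('m \<times> 'k) set \<Rightarrow> ('m \<times> 'k \<Rightarrow> real) \<Rightarrow> 'm \<Rightarrow> 'k \<Rightarrow> 'm set"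
  where
  "illuminated A B N c x xb = {y \<in> visible_left N xb. \<exists>\<gamma>. h_geodesic A B N c \<gamma> \<and>
     \<gamma> 0 = (x, xb) \<and> \<gamma> 1 = (y, xb) \<and> \<gamma> ` {0..1} \<subseteq> visible_left N xb \<times> {xb}}"

text \<open>Convexity on \<open>[0,1]\<close> of a twice differentiable function, i.e. including existence and
  non-negativity of the second derivative up to the end points.\<close>

definition twice_diff_convex :: "(real \<Rightarrow> real) \<Rightarrow> bool" where
  "twice_diff_convex f \<longleftrightarrow> convex_on {0..1} f \<and>
     (\<exists>f' f''. \<forall>t\<in>{0..1}. (f has_real_derivative f' t) (at t within {0..1}) \<and>
        (f' has_real_derivative f'' t) (at t within {0..1}) \<and> f'' t \<ge> 0)"

end

theory Submission
  imports Defs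
begin

text \<open>The Christoffel symbols of the cost metric are pure: a geodesic with constant first component
  \<open>x\<close> is a curve along which \<open>D c(x, \<cdot>)\<close> is affine, and symmetrically. Let \<open>(x, \<sigma>(t))\<close> be such a geodesic and
  let \<open>\<phi>(y) = \<partial>\<^sub>t\<^sup>2 c(y, \<sigma>(t))\<close>. The geodesic equation of \<open>\<sigma>\<close> says exactly that \<open>\<phi>\<close> has a critical point at \<open>x\<close>,
  and the second derivative of \<open>\<phi>\<close> along a geodesic \<open>(y(s), \<sigma>(t))\<close> is \<open>- cross(y', \<sigma>') / 2\<close>. Hence nonnegative
  cross-curvature makes \<open>\<phi>\<close> concave along geodesics issuing from \<open>x\<close>, so that \<open>\<phi>(y) \<le> \<phi>(x)\<close> on the
  illuminated set, which is the asserted convexity. Conversely, if \<open>\<phi>\<close> has a local maximum at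
  \<open>x\<close> for the geodesic with a prescribed initial velocity, its Hessian at \<open>x\<close>, and
  therefore \<open>- cross\<close>, is nonpositive. Geodesics are produced from the inverse function theorem applied
  to the differential of the cost; with compactness of \<open>[0, 1]\<close> this also shows that the points
  illuminated at all times contain a neighbourhood of \<open>x\<close>.\<close>

section \<open>Iterated directional derivatives\<close>

text \<open>The inverse function theorem stands in for an existence theorem for differential
  equations. The price is that the preimage of a segment of covectors is at first only a continuous
  curve, whose velocity and acceleration have to be recovered afterwards. For a C^4 cost the
  Christoffel symbols can be differentiated once; the values of their derivatives come from
  differentiating the linear identities that define them rather than an inverse matrix. Geodesics
  need not stay in one chart. The objects carried from chart to chart are the covector, whose
  transition is linear and independent of time, and \<phi>, which refers to a chart of the second
  factor only. Second derivatives in time are therefore stated at one time and in one chart, and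
  glued by uniqueness. A prescribed velocity is reached only up to a small factor, since the
  geodesic must exist on all of [0, 1]; the cross-curvature is quadratic in that velocity, so its
  sign survives. In \<phi> the velocity and acceleration of \<sigma> are frozen while y moves: the
  acceleration is what makes x critical, and it cancels from the second derivative of \<phi> along
  geodesics.\<close>

lemma dir_deriv_eq:
  "(f has_derivative f') (at z) \<Longrightarrow> dir_deriv v f z = f' v"
  unfolding dir_deriv_def by (metis frechet_derivative_at)

lemma has_derivative_dir_deriv:
  "f differentiable (at z) \<Longrightarrow> (f has_derivative (\<lambda>v. dir_deriv v f z)) (at z)"
  unfolding dir_deriv_def by (simp add: frechet_derivative_works)

lemma linear_dir_deriv: "f differentiable (at z) \<Longrightarrow> linear (\<lambda>v. dir_deriv v f z)"
  using has_derivative_dir_deriv has_derivative_linear by blast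

text \<open>No differentiability is assumed: \<open>frechet_derivative\<close> is a choice from the
  predicate \<open>has_derivative\<close>, and both functions satisfy the same instances of
  it.\<close>

lemma dir_deriv_cong:
  assumes "open S" "z \<in> S" "\<And>y. y \<in> S \<Longrightarrow> f y = g y"
  shows "dir_deriv v f z = dir_deriv v g z"
proof -
  have "(f has_derivative D) (at z) \<longleftrightarrow> (g has_derivative D) (at z)" for D
    using has_derivative_transform_within_open[of f D z UNIV S g]
      has_derivative_transform_within_open[of g D z UNIV S f] assms by auto
  then show ?thesis unfolding dir_deriv_def frechet_derivative_def by simp
qed

lemma differentiable_cong:
  assumes "open S" "z \<in> S" "\<And>y. y \<in> S \<Longrightarrow> f y = g y"
  shows "f differentiable (at z) \<longleftrightarrow> g differentiable (at z)"
  using has_derivative_transform_within_open[of f _ z UNIV S g]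
    has_derivative_transform_within_open[of g _ z UNIV S f] assms
  unfolding differentiable_def by auto

lemma Ck_on_SucD: "Ck_on (Suc k) f S \<Longrightarrow> Ck_on k f S"
proof (induction k arbitrary: f)
  case 0
  then show ?case
    by (auto intro!: continuous_at_imp_continuous_on differentiable_imp_continuous_within)
next
  case (Suc k)
  show ?case
    using Suc.prems Suc.IH[of "dir_deriv _ f"] by (metis Ck_on.simps(2))
qed

lemma Ck_on_mono: "Ck_on k f S \<Longrightarrow> j \<le> k \<Longrightarrow> Ck_on j f S"
  by (induction k rule: nat.induct) (auto simp: le_Suc_eq simp del: Ck_on.simps intro: Ck_on_SucD)

lemma Ck_on_cong:
  assumes "open S" "\<And>y. y \<in> S \<Longrightarrow> f y = g y"
  shows "Ck_on k f S \<longleftrightarrow> Ck_on k g S"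
  using assms
proof (induction k arbitrary: f g)
  case 0
  then show ?case using continuous_on_cong[of S S f g] by simp
next
  case (Suc k)
  have "Ck_on k (dir_deriv v f) S \<longleftrightarrow> Ck_on k (dir_deriv v g) S" for v
    by (rule Suc.IH) (use Suc.prems dir_deriv_cong in blast)+
  moreover have "f differentiable (at z) \<longleftrightarrow> g differentiable (at z)" if "z \<in> S" for z
    using differentiable_cong[of S z f g] Suc.prems that by blast
  ultimately show ?case by simp
qed

lemma Ck_on_differentiable: "Ck_on k f S \<Longrightarrow> 0 < k \<Longrightarrow> z \<in> S \<Longrightarrow> f differentiable (at z)"
  by (cases k) auto

lemma Ck_on_dir_deriv: "Ck_on k f S \<Longrightarrow> j < k \<Longrightarrow> Ck_on j (dir_deriv v f) S"
  by (cases k) (auto intro: Ck_on_mono simp: less_Suc_eq_le)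

lemma Ck_on_imp_continuous_on: "Ck_on k f S \<Longrightarrow> continuous_on S f"
  using Ck_on_mono[of k f S 0] by simp

lemma dir_deriv_add:
  assumes "f differentiable (at z)" "g differentiable (at z)"
  shows "dir_deriv v (\<lambda>y. f y + g y) z = dir_deriv v f z + dir_deriv v g z"
  by (rule dir_deriv_eq) (intro has_derivative_add has_derivative_dir_deriv assms)

lemma Ck_on_add:
  assumes "open S" "Ck_on k f S" "Ck_on k g S"
  shows "Ck_on k (\<lambda>z. f z + g z) S"
  using assms(2,3)
proof (induction k arbitrary: f g)
  case 0
  then show ?case by (simp add: continuous_on_add)
next
  case (Suc k)
  have "Ck_on k (\<lambda>z. dir_deriv v f z + dir_deriv v g z) S" for v
    by (rule Suc.IH) (use Suc.prems in auto)
  moreover have "Ck_on k (\<lambda>z. dir_deriv v f z + dir_deriv v g z) S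
      \<longleftrightarrow> Ck_on k (dir_deriv v (\<lambda>z. f z + g z)) S" for v
    by (rule Ck_on_cong[OF assms(1)]) (use Suc.prems dir_deriv_add in fastforce)
  ultimately show ?case using Suc.prems by (auto intro: differentiable_add)
qed

text \<open>The second difference quotient is a value of the second derivative, by the mean value theorem
  used once in each direction.\<close>

lemma second_difference:
  fixes f :: "'a::real_normed_vector \<Rightarrow> real"
  assumes S: "ball z r \<subseteq> S" and C2: "Ck_on 2 f S"
    and h: "0 < h" "h * (norm u + norm v) < r"
  obtains y where "y \<in> ball z r"
    "f (z + h *\<^sub>R u + h *\<^sub>R v) - f (z + h *\<^sub>R u) - f (z + h *\<^sub>R v) + f z
      = h * (h * dir_deriv v (dir_deriv u f) y)"
proof -
  have inb: "z + s *\<^sub>R u + t *\<^sub>R v \<in> ball z r" if "0 \<le> s" "s \<le> h" "0 \<le> t" "t \<le> h" for s t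
  proof -
    have "norm (s *\<^sub>R u + t *\<^sub>R v) \<le> s * norm u + t * norm v"
      using that norm_triangle_ineq[of "s *\<^sub>R u" "t *\<^sub>R v"] by simp
    also have "\<dots> \<le> h * norm u + h * norm v"
      using that by (intro add_mono mult_right_mono) auto
    finally show ?thesis
      using h by (simp add: dist_norm algebra_simps) (metis minus_add norm_minus_cancel le_less_trans add.commute uminus_add_conv_diff)
  qed
  have df: "(f has_derivative (\<lambda>v. dir_deriv v f y)) (at y)" if "y \<in> ball z r" for y
    using that S C2 by (intro has_derivative_dir_deriv Ck_on_differentiable[of 2 f S]) auto
  have d2f: "(dir_deriv u f has_derivative (\<lambda>v. dir_deriv v (dir_deriv u f) y)) (at y)"
    if "y \<in> ball z r" for y
    using that S C2 
    by (intro has_derivative_dir_deriv Ck_on_differentiable[of 1 _ S] Ck_on_dir_deriv[of 2]) auto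
  define g where "g s = f (z + s *\<^sub>R u + h *\<^sub>R v) - f (z + s *\<^sub>R u)" for s
  have dg: "(g has_derivative (\<lambda>k. k * (dir_deriv u f (z + s *\<^sub>R u + h *\<^sub>R v) - dir_deriv u f (z + s *\<^sub>R u))))
      (at s within {0..h})" if "0 \<le> s" "s \<le> h" for s
  proof -
    have 1: "((\<lambda>s. f (z + s *\<^sub>R u + h *\<^sub>R v)) has_derivative
        (\<lambda>k. dir_deriv (k *\<^sub>R u) f (z + s *\<^sub>R u + h *\<^sub>R v))) (at s within {0..h})"
      by (rule has_derivative_compose[where f = "\<lambda>s. z + s *\<^sub>R u + h *\<^sub>R v" and g = f, OF _ df])
         (use inb[of s h] that h in \<open>auto intro!: derivative_eq_intros\<close>)
    have 2: "((\<lambda>s. f (z + s *\<^sub>R u)) has_derivative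
        (\<lambda>k. dir_deriv (k *\<^sub>R u) f (z + s *\<^sub>R u))) (at s within {0..h})"
      by (rule has_derivative_compose[where f = "\<lambda>s. z + s *\<^sub>R u" and g = f, OF _ df])
         (use inb[of s 0] that h in \<open>auto intro!: derivative_eq_intros\<close>)
    have lin: "dir_deriv (k *\<^sub>R u) f y = k * dir_deriv u f y" if "y \<in> ball z r" for k y
      using linear_scale[OF has_derivative_linear[OF df[OF that]]] by simp
    show ?thesis
      unfolding g_def[abs_def] using has_derivative_diff[OF 1 2] inb[of s 0] inb[of s h] that h
      by (simp add: lin algebra_simps)
  qed
  obtain s where s: "s \<in> {0<..<h}" "g h - g 0 =
      (h - 0) * (dir_deriv u f (z + s *\<^sub>R u + h *\<^sub>R v) - dir_deriv u f (z + s *\<^sub>R u))"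
    using mvt_simple[OF h(1) dg] by blast
  define k where "k t = dir_deriv u f (z + s *\<^sub>R u + t *\<^sub>R v)" for t
  have dk: "(k has_derivative (\<lambda>d. d * dir_deriv v (dir_deriv u f) (z + s *\<^sub>R u + t *\<^sub>R v)))
      (at t within {0..h})" if "0 \<le> t" "t \<le> h" for t
  proof -
    have y: "z + s *\<^sub>R u + t *\<^sub>R v \<in> ball z r" using inb[of s t] s that by auto
    have "(k has_derivative (\<lambda>d. dir_deriv (d *\<^sub>R v) (dir_deriv u f) (z + s *\<^sub>R u + t *\<^sub>R v)))
        (at t within {0..h})"
      unfolding k_def[abs_def]
      by (rule has_derivative_compose[where f = "\<lambda>t. z + s *\<^sub>R u + t *\<^sub>R v" and g = "dir_deriv u f",
            OF _ d2f[OF y]])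
         (auto intro!: derivative_eq_intros)
    then show ?thesis
      using linear_scale[OF has_derivative_linear[OF d2f[OF y]]] by simp
  qed
  obtain t where t: "t \<in> {0<..<h}" "k h - k 0 =
      (h - 0) * dir_deriv v (dir_deriv u f) (z + s *\<^sub>R u + t *\<^sub>R v)"
    using mvt_simple[OF h(1) dk] by blast
  show ?thesis
    by (rule that[of "z + s *\<^sub>R u + t *\<^sub>R v"]) (use inb[of s t] s t in \<open>auto simp: g_def k_def\<close>)
qed

text \<open>The same second difference is a second derivative, in either order of the directions, at
  some point of a small ball. By continuity both values lie within \<open>e\<close>, half of the
  supposed gap, of the values at \<open>z\<close>, which is absurd.\<close>

lemma dir_deriv_commute:
  fixes f :: "'a::real_normed_vector \<Rightarrow> real"
  assumes "open S" "Ck_on 2 f S" "z \<in> S"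
  shows "dir_deriv u (dir_deriv v f) z = dir_deriv v (dir_deriv u f) z"
proof (rule ccontr)
  let ?a = "dir_deriv u (dir_deriv v f)" and ?b = "dir_deriv v (dir_deriv u f)"
  assume ne: "?a z \<noteq> ?b z"
  define e where "e = \<bar>?a z - ?b z\<bar> / 2"
  have "e > 0" using ne by (simp add: e_def)
  have cont: "continuous_on S ?a" "continuous_on S ?b"
    using assms(2) by (auto simp: numeral_2_eq_2)
  have "isCont ?a z" "isCont ?b z"
    using cont assms continuous_on_eq_continuous_at by blast+
  then obtain d1 d2 where d: "d1 > 0" "d2 > 0"
    "\<And>y. dist y z < d1 \<Longrightarrow> dist (?a y) (?a z) < e" "\<And>y. dist y z < d2 \<Longrightarrow> dist (?b y) (?b z) < e"
    using \<open>e > 0\<close> unfolding continuous_at_eps_delta by metis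
  obtain d3 where d3: "d3 > 0" "ball z d3 \<subseteq> S" using assms open_contains_ball by blast
  define r where "r = min d3 (min d1 d2)"
  have r: "r > 0" "ball z r \<subseteq> S" "r \<le> d1" "r \<le> d2" using d d3 by (auto simp: r_def)
  \<comment> \<open>The summand 1 makes the bound \<open>h * (norm u + norm v) < r\<close> strict
    and avoids dividing by zero.\<close>
  define h where "h = r / (norm u + norm v + 1)"
  have pos: "norm u + norm v + 1 > 0" by (simp add: add_nonneg_pos)
  have h: "0 < h" "h * (norm u + norm v) < r"
  proof -
    show "0 < h" using r pos by (simp add: h_def)
    have "h * (norm u + norm v) < h * (norm u + norm v + 1)" using \<open>0 < h\<close> by (simp add: algebra_simps)
    also have "\<dots> = r" using pos by (simp add: h_def)
    finally show "h * (norm u + norm v) < r" .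
  qed
  have h': "h * (norm v + norm u) < r" using h by (simp add: add.commute)
  obtain y1 where y1: "y1 \<in> ball z r" "f (z + h *\<^sub>R u + h *\<^sub>R v) - f (z + h *\<^sub>R u) - f (z + h *\<^sub>R v) + f z
      = h * (h * ?b y1)"
    using second_difference[OF r(2) assms(2) h] by blast
  obtain y2 where y2: "y2 \<in> ball z r" "f (z + h *\<^sub>R v + h *\<^sub>R u) - f (z + h *\<^sub>R v) - f (z + h *\<^sub>R u) + f z
      = h * (h * ?a y2)"
    using second_difference[OF r(2) assms(2) h(1) h'] by blast
  have "h * (h * ?b y1) = h * (h * ?a y2)" using y1(2) y2(2) by (simp add: algebra_simps)
  then have "?b y1 = ?a y2" using h by simp
  moreover have "\<bar>?b y1 - ?b z\<bar> < e" using d(4)[of y1] y1 r by (simp add: dist_norm norm_minus_commute)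
  moreover have "\<bar>?a y2 - ?a z\<bar> < e" using d(3)[of y2] y2 r by (simp add: dist_norm norm_minus_commute)
  ultimately show False unfolding e_def by (simp add: abs_if split: if_splits)
qed

lemma linear_eq_sum_Basis:
  fixes v :: "'a::euclidean_space"
  assumes "linear f"
  shows "f v = (\<Sum>b\<in>Basis. (v \<bullet> b) *\<^sub>R f b)"
proof -
  have "f v = f (\<Sum>b\<in>Basis. (v \<bullet> b) *\<^sub>R b)" by (simp add: euclidean_representation)
  then show ?thesis by (simp only: linear_sum[OF assms] linear_scale[OF assms])
qed

text \<open>Symmetry of second derivatives turns the inner direction into the outer one, where
  linearity is that of a Frechet derivative.\<close>

lemma linear_dir_deriv_inner:
  fixes f :: "'a::real_normed_vector \<Rightarrow> real"
  assumes "open S" "Ck_on 2 f S" "z \<in> S"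
  shows "linear (\<lambda>v. dir_deriv u (dir_deriv v f) z)"
proof -
  have "dir_deriv u f differentiable (at z)"
    using Ck_on_differentiable[of 1 "dir_deriv u f" S z] Ck_on_dir_deriv[of 2 f S 1 u] assms by auto
  then show ?thesis
    using linear_dir_deriv dir_deriv_commute[OF assms] by simp
qed

section \<open>Derivatives along curves\<close>

lemma has_vector_derivative_dir_deriv:
  assumes "f differentiable (at (\<zeta> t))" "(\<zeta> has_vector_derivative \<omega>) (at t within T)"
  shows "((\<lambda>s. f (\<zeta> s)) has_vector_derivative dir_deriv \<omega> f (\<zeta> t)) (at t within T)"
  using has_derivative_compose[OF assms(2)[unfolded has_vector_derivative_def]
      has_derivative_dir_deriv[OF assms(1)]]
    linear_scale[OF linear_dir_deriv[OF assms(1)]]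
  by (simp add: has_vector_derivative_def)

lemma has_vector_derivative_imp_eventually_in:
  assumes "(\<zeta> has_vector_derivative \<omega>) (at t within T)" "open S" "\<zeta> t \<in> S"
  shows "\<forall>\<^sub>F s in at t within T. \<zeta> s \<in> S"
  using has_vector_derivative_continuous[OF assms(1)] assms(2,3)
  unfolding continuous_within by (rule topological_tendstoD)

text \<open>Expanding in a basis separates the two sources of variation: the coefficients of
  \<open>\<omega> s\<close> contribute the acceleration, the partial derivatives at
  \<open>\<zeta> s\<close> the second derivative of \<open>f\<close>.\<close>

lemma has_vector_derivative_dir_deriv2:
  fixes f :: "'a::euclidean_space \<Rightarrow> real"
  assumes S: "open S" "Ck_on 2 f S" "\<zeta> t \<in> S" and t: "t \<in> T"
    and \<zeta>: "(\<zeta> has_vector_derivative \<omega> t) (at t within T)"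
    and \<omega>: "(\<omega> has_vector_derivative \<alpha>) (at t within T)"
  shows "((\<lambda>s. dir_deriv (\<omega> s) f (\<zeta> s)) has_vector_derivative
    dir_deriv (\<omega> t) (dir_deriv (\<omega> t) f) (\<zeta> t) + dir_deriv \<alpha> f (\<zeta> t)) (at t within T)"
proof -
  have df: "f differentiable (at z)" if "z \<in> S" for z
    using Ck_on_differentiable[OF S(2) _ that] by simp
  have d2f: "dir_deriv v f differentiable (at z)" if "z \<in> S" for v z
    using Ck_on_differentiable[of 1 "dir_deriv v f" S z] Ck_on_dir_deriv[of 2 f S 1 v] S that by auto
  have expand: "dir_deriv v f z = (\<Sum>b\<in>Basis. (v \<bullet> b) * dir_deriv b f z)" if "z \<in> S" for v z
    using linear_eq_sum_Basis[OF linear_dir_deriv[OF df[OF that]], of v] by simp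
  have "((\<lambda>s. \<Sum>b\<in>Basis. (\<omega> s \<bullet> b) * dir_deriv b f (\<zeta> s)) has_vector_derivative
      (\<Sum>b\<in>Basis. (\<omega> t \<bullet> b) * dir_deriv (\<omega> t) (dir_deriv b f) (\<zeta> t) + (\<alpha> \<bullet> b) * dir_deriv b f (\<zeta> t)))
      (at t within T)"
    by (intro has_vector_derivative_sum has_vector_derivative_mult
        has_vector_derivative_dir_deriv d2f S \<zeta>
        bounded_linear.has_vector_derivative[OF bounded_linear_inner_left \<omega>])
  moreover have "\<forall>\<^sub>F s in at t within T.
      (\<Sum>b\<in>Basis. (\<omega> s \<bullet> b) * dir_deriv b f (\<zeta> s)) = dir_deriv (\<omega> s) f (\<zeta> s)"
    using has_vector_derivative_imp_eventually_in[OF \<zeta> S(1,3)] by eventually_elim (simp add: expand)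
  ultimately have "((\<lambda>s. dir_deriv (\<omega> s) f (\<zeta> s)) has_vector_derivative
      (\<Sum>b\<in>Basis. (\<omega> t \<bullet> b) * dir_deriv (\<omega> t) (dir_deriv b f) (\<zeta> t) + (\<alpha> \<bullet> b) * dir_deriv b f (\<zeta> t)))
      (at t within T)"
    unfolding has_vector_derivative_def
    by (rule has_derivative_transform_eventually) (use S t in \<open>auto simp: expand\<close>)
  moreover have "dir_deriv (\<omega> t) (dir_deriv (\<omega> t) f) (\<zeta> t)
      = (\<Sum>b\<in>Basis. (\<omega> t \<bullet> b) * dir_deriv (\<omega> t) (dir_deriv b f) (\<zeta> t))"
    using linear_eq_sum_Basis[OF linear_dir_deriv_inner[OF S], of "\<omega> t" "\<omega> t"] by simp
  ultimately show ?thesis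
    using expand[OF S(3), of \<alpha>] by (simp add: sum.distrib)
qed

text \<open>A continuous curve inherits differentiability from its image:
  \<open>F (z s) - F (z t)\<close> differs from \<open>F' (z s - z t)\<close> by o(|z s - z t|), and
  the left inverse \<open>G\<close> of \<open>F'\<close> undoes the linear part. This serves for
  curves obtained from a homeomorphism whose inverse is only known to be continuous.\<close>

lemma has_vector_derivative_inverse_image:
  fixes z :: "real \<Rightarrow> 'a::euclidean_space" and F :: "'a \<Rightarrow> 'b::euclidean_space"
  assumes cont: "continuous (at t within T) z"
    and F: "(F has_derivative F') (at (z t))"
    and Fz: "((\<lambda>s. F (z s)) has_vector_derivative b) (at t within T)"
    and G: "linear G" "\<And>v. G (F' v) = v"
  shows "(z has_vector_derivative G b) (at t within T)"
proof -
  obtain K where K: "K > 0" "\<And>x. norm (G x) \<le> norm x * K"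
    using bounded_linear.pos_bounded[of G] G(1) linear_conv_bounded_linear by blast
  have near: "\<forall>\<^sub>F s in at t within T.
      norm (G (F (z s) - F (z t)) - (z s - z t)) \<le> e * norm (z s - z t)" if "e > 0" for e
  proof -
    have "e / K > 0" using that K by simp
    then obtain d where d: "d > 0" "\<And>y. norm (y - z t) < d \<Longrightarrow>
        norm (F y - F (z t) - F' (y - z t)) \<le> e / K * norm (y - z t)"
      using F unfolding has_derivative_at_alt by blast
    have "\<forall>\<^sub>F s in at t within T. dist (z s) (z t) < d"
      using cont d(1) unfolding continuous_within by (rule tendstoD)
    then show ?thesis
    proof eventually_elim
      case (elim s)
      have "G (F (z s) - F (z t)) - (z s - z t) = G (F (z s) - F (z t) - F' (z s - z t))"
        using linear_diff[OF G(1)] G(2) by metis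
      also have "norm \<dots> \<le> norm (F (z s) - F (z t) - F' (z s - z t)) * K" by (rule K)
      also have "\<dots> \<le> e / K * norm (z s - z t) * K"
        using d(2)[of "z s"] elim K by (intro mult_right_mono) (auto simp: dist_norm)
      finally show ?case using K by simp
    qed
  qed
  have GF: "((\<lambda>s. G (F (z s))) has_vector_derivative G b) (at t within T)"
    using bounded_linear.has_vector_derivative[OF _ Fz] G(1) linear_conv_bounded_linear by blast
  have GF': "\<forall>\<^sub>F s in at t within T. norm (G (F (z s)) - G (F (z t)) - (s - t) *\<^sub>R G b) \<le> e * \<bar>s - t\<bar>"
    if "e > 0" for e
  proof -
    have "\<exists>d>0. \<forall>s\<in>T. norm (s - t) < d \<longrightarrow>
        norm (G (F (z s)) - G (F (z t)) - (s - t) *\<^sub>R G b) \<le> e * norm (s - t)"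
      using GF that unfolding has_vector_derivative_def has_derivative_within_alt by simp
    then show ?thesis unfolding eventually_at by (auto simp: dist_norm)
  qed
  \<comment> \<open>With relative error 1/2 the remainder is absorbed, so \<open>z\<close> satisfies
    a Lipschitz bound at \<open>t\<close>; only then may o(|z s - z t|) be read as o(|s -
    t|).\<close>
  have lip: "\<forall>\<^sub>F s in at t within T. norm (z s - z t) \<le> 2 * (norm (G b) + 1) * \<bar>s - t\<bar>"
    using near[OF half_gt_zero, OF zero_less_one] GF'[OF zero_less_one]
  proof eventually_elim
    case (elim s)
    have "norm (z s - z t) \<le> norm (G (F (z s) - F (z t))) + norm (G (F (z s) - F (z t)) - (z s - z t))"
      by (metis norm_triangle_sub norm_minus_commute)
    then have 1: "norm (z s - z t) \<le> 2 * norm (G (F (z s) - F (z t)))" using elim(1) by simp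
    have "norm (G (F (z s) - F (z t))) \<le> norm ((s - t) *\<^sub>R G b)
        + norm (G (F (z s)) - G (F (z t)) - (s - t) *\<^sub>R G b)"
      using linear_diff[OF G(1)] by (metis norm_triangle_sub)
    also have "\<dots> \<le> \<bar>s - t\<bar> * norm (G b) + \<bar>s - t\<bar>" using elim(2) by simp
    finally show ?case using 1 by (simp add: algebra_simps)
  qed
  show ?thesis
    unfolding has_vector_derivative_def has_derivative_within_alt
  proof (intro conjI allI impI)
    show "bounded_linear (\<lambda>x. x *\<^sub>R G b)" by (rule bounded_linear_scaleR_left)
    define L where "L = 2 * (norm (G b) + 1)"
    have "L > 0" by (simp add: L_def add_nonneg_pos)
    fix e :: real assume "e > 0"
    then have e: "e / 2 / L > 0" "e / 2 > 0" using \<open>L > 0\<close> by simp_all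
    have "\<forall>\<^sub>F s in at t within T. norm (z s - z t - (s - t) *\<^sub>R G b) \<le> e * norm (s - t)"
      using near[OF e(1)] GF'[OF e(2)] lip
    proof eventually_elim
      case (elim s)
      have "z s - z t - (s - t) *\<^sub>R G b = (G (F (z s)) - G (F (z t)) - (s - t) *\<^sub>R G b)
          - (G (F (z s) - F (z t)) - (z s - z t))"
        using linear_diff[OF G(1)] by simp
      then have "norm (z s - z t - (s - t) *\<^sub>R G b) \<le> norm (G (F (z s)) - G (F (z t)) - (s - t) *\<^sub>R G b)
          + norm (G (F (z s) - F (z t)) - (z s - z t))"
        by (metis norm_triangle_ineq4)
      also have "\<dots> \<le> e / 2 * \<bar>s - t\<bar> + e / 2 / L * (L * \<bar>s - t\<bar>)"
        using elim \<open>e > 0\<close> \<open>L > 0\<close>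
        by (intro add_mono order_trans[OF elim(1)] mult_left_mono) (auto simp: L_def)
      also have "\<dots> = e * norm (s - t)" using \<open>L > 0\<close> by (simp add: field_simps)
      finally show ?case .
    qed
    then obtain d where d: "d > 0" "\<And>s. s \<in> T \<Longrightarrow> s \<noteq> t \<Longrightarrow> dist s t < d \<Longrightarrow>
        norm (z s - z t - (s - t) *\<^sub>R G b) \<le> e * norm (s - t)"
      unfolding eventually_at by blast
    show "\<exists>d>0. \<forall>y\<in>T. norm (y - t) < d \<longrightarrow> norm (z y - z t - (y - t) *\<^sub>R G b) \<le> e * norm (y - t)"
    proof (intro exI[of _ d] conjI ballI impI)
      fix y assume "y \<in> T" "norm (y - t) < d"
      then show "norm (z y - z t - (y - t) *\<^sub>R G b) \<le> e * norm (y - t)"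
        using d(2)[of y] by (cases "y = t") (auto simp: dist_norm)
    qed (fact d(1))
  qed
qed

section \<open>Matrices and multilinear forms\<close>

lemma matrix_inv_mult_vector:
  fixes A :: "real^'n^'n"
  assumes "invertible A"
  shows "A *v (matrix_inv A *v b) = b"
proof -
  have "A ** matrix_inv A = mat 1"
    using someI_ex[of "\<lambda>A'. A ** A' = mat 1 \<and> A' ** A = mat 1"] assms
    by (simp add: invertible_def matrix_inv_def)
  then show ?thesis by (simp add: matrix_vector_mul_assoc)
qed

lemma invertible_matrix_vector_cancel:
  fixes A :: "real^'n^'n"
  assumes "invertible A" "A *v x = A *v y"
  shows "x = y"
proof -
  obtain A' where "A' ** A = mat 1" using assms invertible_def by blast
  then show ?thesis using assms(2) by (metis matrix_vector_mul_assoc matrix_vector_mul_lid)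
qed

lemma differentiable_prod_real:
  fixes f :: "'i \<Rightarrow> 'a::real_normed_vector \<Rightarrow> real"
  assumes "\<And>i. i \<in> I \<Longrightarrow> f i differentiable (at z)"
  shows "(\<lambda>y. \<Prod>i\<in>I. f i y) differentiable (at z)"
proof -
  have "\<forall>i\<in>I. \<exists>D. (f i has_derivative D) (at z)"
    using assms by (auto simp: differentiable_def)
  then obtain D where "\<And>i. i \<in> I \<Longrightarrow> (f i has_derivative D i) (at z)" by metis
  then have "((\<lambda>y. \<Prod>i\<in>I. f i y) has_derivative
      (\<lambda>v. \<Sum>i\<in>I. D i v * (\<Prod>j\<in>I - {i}. f j z))) (at z)"
    by (rule has_derivative_prod)
  then show ?thesis by (auto simp: differentiable_def)
qed

lemma differentiable_det:
  fixes A :: "'a::real_normed_vector \<Rightarrow> real^'n^'n"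
  assumes "\<And>i j. (\<lambda>y. A y $ i $ j) differentiable (at z)"
  shows "(\<lambda>y. det (A y)) differentiable (at z)"
proof -
  have "(\<lambda>y. \<Prod>i\<in>UNIV. A y $ i $ p i) differentiable (at z)" for p
    by (rule differentiable_prod_real) (rule assms)
  then show ?thesis
    unfolding det_def by (auto intro!: differentiable_sum differentiable_mult finite_permutations)
qed

lemma differentiable_vec:
  fixes f :: "'a::real_normed_vector \<Rightarrow> real^'n"
  assumes "\<And>i. (\<lambda>y. f y $ i) differentiable (at z)"
  shows "f differentiable (at z)"
  unfolding differentiable_componentwise_within[of f]
  using assms by (auto simp: Basis_vec_def inner_axis)

text \<open>Cramer's rule writes each component of the solution as a quotient of determinants, which
  are polynomials in the entries.\<close>

lemma differentiable_matrix_inv_mult: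
  fixes A :: "'a::real_normed_vector \<Rightarrow> real^'n^'n" and b :: "'a \<Rightarrow> real^'n"
  assumes S: "open S" "z \<in> S" "\<And>y. y \<in> S \<Longrightarrow> invertible (A y)"
    and A: "\<And>i j. (\<lambda>y. A y $ i $ j) differentiable (at z)"
    and b: "\<And>i. (\<lambda>y. b y $ i) differentiable (at z)"
  shows "(\<lambda>y. matrix_inv (A y) *v b y) differentiable (at z)"
proof -
  let ?B = "\<lambda>k y. (\<chi> i j. if j = k then b y $ i else A y $ i $ j) :: real^'n^'n"
  have nz: "det (A y) \<noteq> 0" if "y \<in> S" for y
    using S(3)[OF that] invertible_det_nz by blast
  have "(\<lambda>y. (\<chi> k. det (?B k y) / det (A y)) $ k) differentiable (at z)" for k
  proof -
    have "(\<lambda>y. ?B k y $ i $ j) differentiable (at z)" for i j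
      by (cases "j = k") (auto simp: A b)
    then show ?thesis
      using nz[OF S(2)] by (auto intro!: differentiable_divide differentiable_det A)
  qed
  then have "(\<lambda>y. \<chi> k. det (?B k y) / det (A y)) differentiable (at z)"
    by (rule differentiable_vec)
  moreover have "(\<chi> k. det (?B k y) / det (A y)) = matrix_inv (A y) *v b y" if "y \<in> S" for y
    by (rule cramer[OF nz[OF that], THEN iffD1, OF matrix_inv_mult_vector[OF S(3)[OF that]], symmetric])
  ultimately show ?thesis
    by (rule differentiable_cong[OF S(1,2), THEN iffD1, rotated])
qed

section \<open>Linear and bilinear maps expanded in a basis\<close>

lemma linear_eq_sum_axis:
  fixes f :: "real^'n \<Rightarrow> 'b::real_vector"
  assumes "linear f"
  shows "f p = (\<Sum>i\<in>UNIV. p $ i *\<^sub>R f (axis i 1))"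
proof -
  have "f p = f (\<Sum>i\<in>UNIV. (p $ i) *\<^sub>R axis i 1)"
    using basis_expansion[of p] by (simp add: scalar_mult_eq_scaleR)
  then show ?thesis by (simp only: linear_sum[OF assms] linear_scale[OF assms])
qed

lemma linear_dir_deriv_param:
  assumes "open S" "z \<in> S" "\<And>y. y \<in> S \<Longrightarrow> linear (\<lambda>u. F u y)"
    "\<And>u. F u differentiable (at z)"
  shows "linear (\<lambda>u. dir_deriv v (F u) z)"
proof (rule linearI)
  fix a b c
  have "dir_deriv v (F (a + b)) z = dir_deriv v (\<lambda>y. F a y + F b y) z"
    by (rule dir_deriv_cong[OF assms(1,2)]) (simp add: linear_add[OF assms(3)])
  then show "dir_deriv v (F (a + b)) z = dir_deriv v (F a) z + dir_deriv v (F b) z"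
    using dir_deriv_add assms(4) by metis
  have "dir_deriv v (F (c *\<^sub>R a)) z = dir_deriv v (\<lambda>y. c *\<^sub>R F a y) z"
    by (rule dir_deriv_cong[OF assms(1,2)]) (simp add: linear_scale[OF assms(3)])
  also have "\<dots> = c *\<^sub>R dir_deriv v (F a) z"
    by (rule dir_deriv_eq) (intro has_derivative_scaleR_right has_derivative_dir_deriv assms)
  finally show "dir_deriv v (F (c *\<^sub>R a)) z = c *\<^sub>R dir_deriv v (F a) z" .
qed

text \<open>Product rule for a linear form whose coefficients and argument both vary. Applied to the
  identities that define the Christoffel symbols, it trades derivatives of the symbols for
  derivatives of the cost.\<close>

lemma dir_deriv_linear_apply:
  fixes b :: "'a::real_normed_vector \<Rightarrow> 'b::euclidean_space" and F :: "'b \<Rightarrow> 'a \<Rightarrow> real"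
  assumes S: "open S" "z \<in> S" and F: "\<And>y. y \<in> S \<Longrightarrow> linear (\<lambda>u. F u y)"
    "\<And>u. F u differentiable (at z)" and b: "b differentiable (at z)"
  shows "dir_deriv v (\<lambda>y. F (b y) y) z = dir_deriv v (F (b z)) z + F (dir_deriv v b z) z"
proof -
  have "((\<lambda>y. \<Sum>i\<in>Basis. (b y \<bullet> i) * F i y) has_derivative (\<lambda>v. \<Sum>i\<in>Basis.
      (b z \<bullet> i) * dir_deriv v (F i) z + (dir_deriv v b z \<bullet> i) * F i z)) (at z)"
    by (intro has_derivative_sum has_derivative_mult has_derivative_inner_left
        has_derivative_dir_deriv F b)
  then have "dir_deriv v (\<lambda>y. \<Sum>i\<in>Basis. (b y \<bullet> i) * F i y) z = (\<Sum>i\<in>Basis.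
      (b z \<bullet> i) * dir_deriv v (F i) z + (dir_deriv v b z \<bullet> i) * F i z)"
    by (rule dir_deriv_eq)
  moreover have "dir_deriv v (\<lambda>y. F (b y) y) z = dir_deriv v (\<lambda>y. \<Sum>i\<in>Basis. (b y \<bullet> i) * F i y) z"
    by (rule dir_deriv_cong[OF S]) (use linear_eq_sum_Basis[OF F(1)] in simp)
  moreover have "dir_deriv v (F (b z)) z = (\<Sum>i\<in>Basis. (b z \<bullet> i) * dir_deriv v (F i) z)"
    using linear_eq_sum_Basis[OF linear_dir_deriv_param[OF S F], of v "b z"] by simp
  moreover have "F (dir_deriv v b z) z = (\<Sum>i\<in>Basis. (dir_deriv v b z \<bullet> i) * F i z)"
    using linear_eq_sum_Basis[OF F(1)[OF S(2)], of "dir_deriv v b z"] by simp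
  ultimately show ?thesis by (simp add: sum.distrib)
qed

text \<open>Each of the two tensor products in \<open>wedge\<close> reproduces \<open>B\<close> by
  bilinearity. Used for both bivectors of \<open>curvature_operator\<close>, this leaves four
  curvature terms.\<close>

lemma sum_wedge:
  assumes "\<And>b. linear (\<lambda>a. B a b)" "\<And>a. linear (B a)"
  shows "(\<Sum>a\<in>Basis. \<Sum>b\<in>Basis. B a b * wedge u v a b) = B u v - B v (u :: 'a::euclidean_space)"
proof -
  have bil: "(\<Sum>a\<in>Basis. \<Sum>b\<in>Basis. B a b * ((x \<bullet> a) * (y \<bullet> b))) = (B x y :: real)" for x y
  proof -
    have "B x y = (\<Sum>a\<in>Basis. (x \<bullet> a) * B a y)"
      using linear_eq_sum_Basis[OF assms(1), of x y] by simp
    also have "\<dots> = (\<Sum>a\<in>Basis. (x \<bullet> a) * (\<Sum>b\<in>Basis. (y \<bullet> b) * B a b))"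
      using linear_eq_sum_Basis[OF assms(2), of _ y] by simp
    finally show ?thesis by (simp add: sum_distrib_left mult_ac)
  qed
  have "(\<Sum>a\<in>Basis. \<Sum>b\<in>Basis. B a b * wedge u v a b)
      = (\<Sum>a\<in>Basis. \<Sum>b\<in>Basis. B a b * ((u \<bullet> a) * (v \<bullet> b)))
        - (\<Sum>a\<in>Basis. \<Sum>b\<in>Basis. B a b * ((v \<bullet> a) * (u \<bullet> b)))"
    by (simp add: wedge_def right_diff_distrib sum_subtractf)
  then show ?thesis by (simp only: bil)
qed

lemma linear_left: "linear f \<Longrightarrow> linear (\<lambda>p. f (p, 0))"
  and linear_right: "linear f \<Longrightarrow> linear (\<lambda>q. f (0, q))"
  using linear_compose[of "\<lambda>p. (p, 0)" f] linear_compose[of "\<lambda>q. (0, q)" f]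
  by (simp_all add: linear_iff o_def)

section \<open>Christoffel symbols and cross-curvature of a cost in coordinates\<close>

text \<open>In indices \<open>c^{a b} c_{i j a} p^i p'^j\<close>, with \<open>a\<close> in the
  second factor. The transpose appears because the unknown vector is contracted with the row index
  of \<open>mixed_hessian\<close>.\<close>

definition left_christoffel :: "((real^'n::finite) \<times> (real^'n) \<Rightarrow> real) \<Rightarrow> (real^'n) \<times> (real^'n) \<Rightarrow> real^'n \<Rightarrow> real^'n \<Rightarrow> real^'n" where
  "left_christoffel C z p p' = matrix_inv (transpose (mixed_hessian C z)) *v
     (\<chi> j. dir_deriv (p, 0) (dir_deriv (p', 0) (dir_deriv (0, axis j 1) C)) z)"

text \<open>In indices \<open>c^{a b} c_{b k l} q^k q'^l\<close>, the factor that occurs in the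
  formula for the cross-curvature.\<close>

definition right_christoffel :: "((real^'n::finite) \<times> (real^'n) \<Rightarrow> real) \<Rightarrow> (real^'n) \<times> (real^'n) \<Rightarrow> real^'n \<Rightarrow> real^'n \<Rightarrow> real^'n" where
  "right_christoffel C z q q' = matrix_inv (mixed_hessian C z) *v
     (\<chi> i. dir_deriv (axis i 1, 0) (dir_deriv (0, q) (dir_deriv (0, q') C)) z)"

text \<open>Half the negative of the cross-curvature.\<close>

definition fourth_order_form :: "((real^'n::finite) \<times> (real^'n) \<Rightarrow> real) \<Rightarrow> (real^'n) \<times> (real^'n) \<Rightarrow> real^'n \<Rightarrow> real^'n \<Rightarrow> real" where
  "fourth_order_form C z p q = dir_deriv (p, 0) (dir_deriv (p, 0) (dir_deriv (0, q) (dir_deriv (0, q) C))) z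
     - dir_deriv (left_christoffel C z p p, 0) (dir_deriv (0, q) (dir_deriv (0, q) C)) z"

text \<open>The second derivative of the cost along a curve in the second factor with velocity \<open>q\<close> and
  acceleration \<open>\<alpha>\<close>.\<close>

definition cost_second_deriv :: "((real^'n::finite) \<times> (real^'n) \<Rightarrow> real) \<Rightarrow> real^'n \<Rightarrow> real^'n \<Rightarrow> (real^'n) \<times> (real^'n) \<Rightarrow> real" where
  "cost_second_deriv C q \<alpha> y = dir_deriv (0, q) (dir_deriv (0, q) C) y + dir_deriv (0, \<alpha>) C y"

text \<open>A cost in one pair of charts. Four derivatives make the third ones, and with them the
  Christoffel symbols, differentiable, and let the fourth ones be permuted in the curvature.\<close>

locale nondegenerate_coord_cost =
  fixes C :: "(real^'n::finite) \<times> (real^'n) \<Rightarrow> real" and S :: "((real^'n) \<times> (real^'n)) set"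
  assumes open_S: "open S"
    and C4: "Ck_on 4 C S"
    and invertible_mixed_hessian: "\<And>z. z \<in> S \<Longrightarrow> invertible (mixed_hessian C z)"
begin

lemma Ck_on_derivs:
  "Ck_on 3 (dir_deriv u C) S" "Ck_on 2 (dir_deriv u (dir_deriv v C)) S"
  "Ck_on 1 (dir_deriv u (dir_deriv v (dir_deriv w C))) S"
proof -
  show 3: "Ck_on 3 (dir_deriv u C) S" for u by (rule Ck_on_dir_deriv[OF C4]) simp
  show 2: "Ck_on 2 (dir_deriv u (dir_deriv v C)) S" for u v by (rule Ck_on_dir_deriv[OF 3]) simp
  show "Ck_on 1 (dir_deriv u (dir_deriv v (dir_deriv w C))) S" by (rule Ck_on_dir_deriv[OF 2]) simp
qed

lemma Ck2_derivs: "Ck_on 2 C S" "Ck_on 2 (dir_deriv u C) S"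
  using Ck_on_mono[OF C4, of 2] Ck_on_mono[OF Ck_on_derivs(1), of 2] by simp_all

lemma differentiable_derivs:
  assumes "z \<in> S"
  shows "C differentiable (at z)" "dir_deriv u C differentiable (at z)"
    "dir_deriv u (dir_deriv v C) differentiable (at z)"
    "dir_deriv u (dir_deriv v (dir_deriv w C)) differentiable (at z)"
  using Ck_on_differentiable[OF C4 _ assms] Ck_on_differentiable[OF Ck_on_derivs(1) _ assms]
    Ck_on_differentiable[OF Ck_on_derivs(2) _ assms] Ck_on_differentiable[OF Ck_on_derivs(3) _ assms]
  by simp_all

lemma commute2: "z \<in> S \<Longrightarrow> dir_deriv u (dir_deriv v C) z = dir_deriv v (dir_deriv u C) z"
  by (rule dir_deriv_commute[OF open_S Ck2_derivs(1)])

lemma commute3_outer: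
  "z \<in> S \<Longrightarrow> dir_deriv u (dir_deriv v (dir_deriv w C)) z = dir_deriv v (dir_deriv u (dir_deriv w C)) z"
  by (rule dir_deriv_commute[OF open_S Ck2_derivs(2)])

lemma commute3_inner:
  "z \<in> S \<Longrightarrow> dir_deriv u (dir_deriv v (dir_deriv w C)) z = dir_deriv u (dir_deriv w (dir_deriv v C)) z"
  by (rule dir_deriv_cong[OF open_S]) (simp_all add: commute2)

lemma linear_derivs:
  assumes "z \<in> S"
  shows "linear (\<lambda>u. dir_deriv u C z)"
    "linear (\<lambda>u. dir_deriv u (dir_deriv v C) z)"
    "linear (\<lambda>v. dir_deriv u (dir_deriv v C) z)"
    "linear (\<lambda>u. dir_deriv u (dir_deriv v (dir_deriv w C)) z)"
    "linear (\<lambda>v. dir_deriv u (dir_deriv v (dir_deriv w C)) z)"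
    "linear (\<lambda>w. dir_deriv u (dir_deriv v (dir_deriv w C)) z)"
proof -
  show 1: "linear (\<lambda>v. dir_deriv u (dir_deriv v (dir_deriv w C)) z)" for w
    by (rule linear_dir_deriv_inner[OF open_S Ck2_derivs(2) assms])
  show "linear (\<lambda>w. dir_deriv u (dir_deriv v (dir_deriv w C)) z)"
    using 1[of v] commute3_inner[OF assms] by simp
qed (intro linear_dir_deriv linear_dir_deriv_inner[OF open_S Ck2_derivs(1) assms]
      differentiable_derivs assms)+

text \<open>Passes from matrix entries to a bilinear form in arbitrary directions, so that later
  computations can do without index sums.\<close>

lemma mixed_hessian_form:
  assumes "z \<in> S"
  shows "p \<bullet> (mixed_hessian C z *v q) = dir_deriv (p, 0) (dir_deriv (0, q) C) z"
proof -
  have "dir_deriv (p, 0) (dir_deriv (0, q) C) z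
      = (\<Sum>i\<in>UNIV. p $ i * dir_deriv (axis i 1, 0) (dir_deriv (0, q) C) z)"
    using linear_eq_sum_axis[OF linear_left[OF linear_derivs(2)[OF assms]], where p = p] by simp
  also have "\<dots> = (\<Sum>i\<in>UNIV. p $ i * (\<Sum>j\<in>UNIV. q $ j * dir_deriv (axis i 1, 0) (dir_deriv (0, axis j 1) C) z))"
    using linear_eq_sum_axis[OF linear_right[OF linear_derivs(3)[OF assms]], where p = q] by simp
  finally show ?thesis
    by (simp add: mixed_hessian_def matrix_vector_mult_def inner_vec_def mult.commute)
qed

lemma mixed_form_cancel_left:
  assumes "z \<in> S"
    "\<And>j. dir_deriv (a, 0) (dir_deriv (0, axis j 1) C) z = dir_deriv (a', 0) (dir_deriv (0, axis j 1) C) z"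
  shows "a = a'"
proof -
  have "(transpose (mixed_hessian C z) *v b) $ j = dir_deriv (b, 0) (dir_deriv (0, axis j 1) C) z" for b j
    by (metis mixed_hessian_form[OF assms(1)] transpose_matrix_vector dot_lmul_matrix inner_axis inner_real_def mult.right_neutral)
  then have "transpose (mixed_hessian C z) *v a = transpose (mixed_hessian C z) *v a'"
    by (simp add: vec_eq_iff assms(2))
  then show ?thesis
    using invertible_matrix_vector_cancel[OF transpose_invertible[OF invertible_mixed_hessian[OF assms(1)]]]
    by blast
qed

lemma mixed_form_cancel_right:
  assumes "z \<in> S"
    "\<And>i. dir_deriv (axis i 1, 0) (dir_deriv (0, b) C) z = dir_deriv (axis i 1, 0) (dir_deriv (0, b') C) z"
  shows "b = b'"
proof -
  have "(mixed_hessian C z *v b) $ i = dir_deriv (axis i 1, 0) (dir_deriv (0, b) C) z" for b i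
    by (simp flip: mixed_hessian_form[OF assms(1)] add: inner_axis')
  then have "mixed_hessian C z *v b = mixed_hessian C z *v b'"
    by (simp add: vec_eq_iff assms(2))
  then show ?thesis
    using invertible_matrix_vector_cancel[OF invertible_mixed_hessian[OF assms(1)]] by blast
qed

lemma left_christoffel:
  assumes "z \<in> S"
  shows "dir_deriv (left_christoffel C z p p', 0) (dir_deriv (0, q) C) z
    = dir_deriv (p, 0) (dir_deriv (p', 0) (dir_deriv (0, q) C)) z"
proof -
  have "dir_deriv (left_christoffel C z p p', 0) (dir_deriv (0, q) C) z
      = (transpose (mixed_hessian C z) *v left_christoffel C z p p') \<bullet> q"
    by (simp add: transpose_matrix_vector dot_lmul_matrix mixed_hessian_form[OF assms])
  also have "\<dots> = (\<Sum>j\<in>UNIV. q $ j * dir_deriv (p, 0) (dir_deriv (p', 0) (dir_deriv (0, axis j 1) C)) z)"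
    unfolding left_christoffel_def
      matrix_inv_mult_vector[OF transpose_invertible[OF invertible_mixed_hessian[OF assms]]]
    by (simp add: inner_vec_def mult.commute)
  also have "\<dots> = dir_deriv (p, 0) (dir_deriv (p', 0) (dir_deriv (0, q) C)) z"
    using linear_eq_sum_axis[OF linear_right[OF linear_derivs(6)[OF assms]], where p = q] by simp
  finally show ?thesis .
qed

lemma right_christoffel:
  assumes "z \<in> S"
  shows "dir_deriv (p, 0) (dir_deriv (0, right_christoffel C z q q') C) z
    = dir_deriv (p, 0) (dir_deriv (0, q) (dir_deriv (0, q') C)) z"
proof -
  have "dir_deriv (p, 0) (dir_deriv (0, right_christoffel C z q q') C) z
      = p \<bullet> (mixed_hessian C z *v right_christoffel C z q q')"
    by (simp add: mixed_hessian_form[OF assms])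
  also have "\<dots> = (\<Sum>j\<in>UNIV. p $ j * dir_deriv (axis j 1, 0) (dir_deriv (0, q) (dir_deriv (0, q') C)) z)"
    unfolding right_christoffel_def
      matrix_inv_mult_vector[OF invertible_mixed_hessian[OF assms]]
    by (simp add: inner_vec_def)
  also have "\<dots> = dir_deriv (p, 0) (dir_deriv (0, q) (dir_deriv (0, q') C)) z"
    using linear_eq_sum_axis[OF linear_left[OF linear_derivs(4)[OF assms]], where p = p] by simp
  finally show ?thesis .
qed

lemma linear_left_christoffel:
  assumes "z \<in> S"
  shows "linear (\<lambda>p. left_christoffel C z p p')" "linear (left_christoffel C z p)"
  unfolding left_christoffel_def
  using linear_left[OF linear_derivs(4)[OF assms]] linear_left[OF linear_derivs(5)[OF assms]]
  by (intro linear_compose[OF _ matrix_vector_mul_linear, unfolded o_def];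
      simp add: linear_iff vec_eq_iff)+

lemma linear_right_christoffel:
  assumes "z \<in> S"
  shows "linear (\<lambda>q. right_christoffel C z q q')" "linear (right_christoffel C z q)"
  unfolding right_christoffel_def
  using linear_right[OF linear_derivs(5)[OF assms]] linear_right[OF linear_derivs(6)[OF assms]]
  by (intro linear_compose[OF _ matrix_vector_mul_linear, unfolded o_def];
      simp add: linear_iff vec_eq_iff)+

lemma differentiable_left_christoffel:
  assumes "z \<in> S"
  shows "(\<lambda>y. left_christoffel C y p p') differentiable (at z)"
  unfolding left_christoffel_def
  by (rule differentiable_matrix_inv_mult[OF open_S assms transpose_invertible[OF invertible_mixed_hessian]])
     (simp_all add: transpose_def mixed_hessian_def differentiable_derivs[OF assms])

lemma differentiable_right_christoffel:
  assumes "z \<in> S"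
  shows "(\<lambda>y. right_christoffel C y q q') differentiable (at z)"
  unfolding right_christoffel_def
  by (rule differentiable_matrix_inv_mult[OF open_S assms invertible_mixed_hessian])
     (simp_all add: mixed_hessian_def differentiable_derivs[OF assms])

section \<open>Levi-Civita connection and curvature of the cost metric\<close>

lemma dir_deriv_split:
  assumes "f differentiable (at z)"
  shows "dir_deriv u f z = dir_deriv (fst u, 0) f z + dir_deriv (0, snd u) f z"
  using linear_add[OF linear_dir_deriv[OF assms], of "(fst u, 0)" "(0, snd u)"] by simp

lemma cost_metric_eq:
  assumes "z \<in> S"
  shows "cost_metric C z u v = - (dir_deriv (fst u, 0) (dir_deriv (0, snd v) C) z
     + dir_deriv (fst v, 0) (dir_deriv (0, snd u) C) z) / 2"
  unfolding cost_metric_def by (simp add: mixed_hessian_form[OF assms])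

lemma dir_deriv_cost_metric:
  assumes "z \<in> S"
  shows "dir_deriv w (\<lambda>y. cost_metric C y u v) z
    = - (dir_deriv w (dir_deriv (fst u, 0) (dir_deriv (0, snd v) C)) z
      + dir_deriv w (dir_deriv (fst v, 0) (dir_deriv (0, snd u) C)) z) / 2"
proof -
  have "dir_deriv w (\<lambda>y. cost_metric C y u v) z
      = dir_deriv w (\<lambda>y. - (dir_deriv (fst u, 0) (dir_deriv (0, snd v) C) y
         + dir_deriv (fst v, 0) (dir_deriv (0, snd u) C) y) / 2) z"
    by (rule dir_deriv_cong[OF open_S assms]) (simp add: cost_metric_eq)
  also have "\<dots> = - (dir_deriv w (dir_deriv (fst u, 0) (dir_deriv (0, snd v) C)) z
      + dir_deriv w (dir_deriv (fst v, 0) (dir_deriv (0, snd u) C)) z) / 2"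
    by (rule dir_deriv_eq, rule has_derivative_eq_rhs)
       (rule derivative_eq_intros has_derivative_dir_deriv differentiable_derivs assms refl | simp)+
  finally show ?thesis .
qed

text \<open>In the Koszul formula all terms cancel except those with two arguments in the same factor as
  one another and the test vector in the other factor.\<close>

lemma christoffel_eq:
  assumes "z \<in> S"
  shows "christoffel (cost_metric C) z u v
    = (left_christoffel C z (fst u) (fst v), right_christoffel C z (snd u) (snd v))"
proof -
  let ?T = "\<lambda>u v w. dir_deriv u (dir_deriv v (dir_deriv w C)) z"
  obtain u1 u2 v1 v2 where uv: "u = (u1, u2)" "v = (v1, v2)" by force
  have koszul: "(dir_deriv u (\<lambda>y. cost_metric C y v w) z + dir_deriv v (\<lambda>y. cost_metric C y u w) z
      - dir_deriv w (\<lambda>y. cost_metric C y u v) z) / 2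
      = - (?T (u1, 0) (v1, 0) (0, w2) + ?T (w1, 0) (0, u2) (0, v2)) / 2" if w: "w = (w1, w2)" for w w1 w2
  proof -
    have split: "?T (a, b) c d = ?T (a, 0) c d + ?T (0, b) c d" for a b c d
      using dir_deriv_split[OF differentiable_derivs(3)[OF assms], of "(a, b)"] by simp
    have 1: "?T (v1, 0) (u1, 0) (0, w2) = ?T (u1, 0) (v1, 0) (0, w2)"
      by (rule commute3_outer[OF assms])
    have rev: "?T a b c = ?T c b a" for a b c
      by (subst commute3_outer[OF assms], subst commute3_inner[OF assms], subst commute3_outer[OF assms]) simp
    have 2: "?T (0, w2) (u1, 0) (0, v2) = ?T (0, v2) (u1, 0) (0, w2)"
      "?T (0, w2) (v1, 0) (0, u2) = ?T (0, u2) (v1, 0) (0, w2)"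
      by (rule rev)+
    have 3: "?T (u1, 0) (w1, 0) (0, v2) = ?T (w1, 0) (u1, 0) (0, v2)"
      "?T (v1, 0) (w1, 0) (0, u2) = ?T (w1, 0) (v1, 0) (0, u2)"
      by (rule commute3_outer[OF assms])+
    have 4: "?T (0, u2) (w1, 0) (0, v2) = ?T (w1, 0) (0, u2) (0, v2)"
      "?T (0, v2) (w1, 0) (0, u2) = ?T (w1, 0) (0, u2) (0, v2)"
      by (rule commute3_outer[OF assms], subst commute3_outer[OF assms], rule commute3_inner[OF assms])
    show ?thesis
      unfolding dir_deriv_cost_metric[OF assms] uv w
      by (simp add: split[of u1 u2] split[of v1 v2] split[of w1 w2] 1 2 3 4 field_simps)
  qed
  have g: "cost_metric C z a w = - (dir_deriv (a1, 0) (dir_deriv (0, w2) C) z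
      + dir_deriv (w1, 0) (dir_deriv (0, a2) C) z) / 2" if "a = (a1, a2)" "w = (w1, w2)" for a a1 a2 w w1 w2
    using cost_metric_eq[OF assms] that by simp
  show ?thesis
    unfolding christoffel_def
  proof (rule the_equality)
    show "\<forall>w. cost_metric C z (left_christoffel C z (fst u) (fst v), right_christoffel C z (snd u) (snd v)) w =
      (dir_deriv u (\<lambda>y. cost_metric C y v w) z + dir_deriv v (\<lambda>y. cost_metric C y u w) z
      - dir_deriv w (\<lambda>y. cost_metric C y u v) z) / 2"
    proof
      fix w :: "(real^'n) \<times> (real^'n)"
      obtain w1 w2 where w: "w = (w1, w2)" by force
      show "cost_metric C z (left_christoffel C z (fst u) (fst v), right_christoffel C z (snd u) (snd v)) w =
      (dir_deriv u (\<lambda>y. cost_metric C y v w) z + dir_deriv v (\<lambda>y. cost_metric C y u w) z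
      - dir_deriv w (\<lambda>y. cost_metric C y u v) z) / 2"
        unfolding koszul[OF w] g[OF refl w] left_christoffel[OF assms] right_christoffel[OF assms]
        by (simp add: uv)
    qed
  next
    fix a
    assume a: "\<forall>w. cost_metric C z a w =
      (dir_deriv u (\<lambda>y. cost_metric C y v w) z + dir_deriv v (\<lambda>y. cost_metric C y u w) z
      - dir_deriv w (\<lambda>y. cost_metric C y u v) z) / 2"
    obtain a1 a2 where a12: "a = (a1, a2)" by force
    have eq: "dir_deriv (a1, 0) (dir_deriv (0, w2) C) z + dir_deriv (w1, 0) (dir_deriv (0, a2) C) z
        = ?T (u1, 0) (v1, 0) (0, w2) + ?T (w1, 0) (0, u2) (0, v2)" for w1 w2
      using a[rule_format, of "(w1, w2)"] unfolding koszul[OF refl] g[OF a12 refl] by simp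
    have z0: "dir_deriv (0, 0) f z = 0" if "f differentiable (at z)" for f :: "_ \<Rightarrow> real"
      using linear_0[OF linear_dir_deriv[OF that]] by (simp add: zero_prod_def)
    have z1: "?T (u1, 0) (v1, 0) (0, 0) = 0" "dir_deriv (a1, 0) (dir_deriv (0, 0) C) z = 0"
      using linear_0[OF linear_derivs(6)[OF assms]] linear_0[OF linear_derivs(3)[OF assms]]
      by (simp_all add: zero_prod_def)
    \<comment> \<open>For uniqueness, test vectors \<open>(0, w2)\<close> see only \<open>a1\<close>
      and test vectors \<open>(w1, 0)\<close> see only \<open>a2\<close>; nondegeneracy of the mixed
      Hessian then determines each.\<close>
    have "a1 = left_christoffel C z u1 v1"
      by (rule mixed_form_cancel_left[OF assms])
         (use eq[where ?w1.0 = 0] in \<open>simp add: left_christoffel[OF assms] z0 differentiable_derivs assms\<close>)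
    moreover have "a2 = right_christoffel C z u2 v2"
      by (rule mixed_form_cancel_right[OF assms])
         (use eq[where ?w2.0 = 0] in \<open>simp add: right_christoffel[OF assms] z1\<close>)
    ultimately show "a = (left_christoffel C z (fst u) (fst v), right_christoffel C z (snd u) (snd v))"
      by (simp add: a12 uv)
  qed
qed

text \<open>Multilinearity lets the basis sums in the curvature operator collapse to values at
  \<open>u\<close> and \<open>v\<close>. The derivatives of the Christoffel symbols are linear in
  the arguments because the symbols are so at all nearby points.\<close>

lemma linear_riemann:
  assumes "z \<in> S"
  shows "linear (\<lambda>u. riemann (cost_metric C) z u v w)"
    "linear (\<lambda>v. riemann (cost_metric C) z u v w)"
    "linear (\<lambda>w. riemann (cost_metric C) z u v w)"
proof -
  let ?\<Gamma> = "christoffel (cost_metric C)"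
  have lin: "linear (\<lambda>u. ?\<Gamma> y u v)" "linear (\<lambda>v. ?\<Gamma> y u v)" if "y \<in> S" for y u v
    unfolding christoffel_eq[OF that]
    using linear_left_christoffel[OF that] linear_right_christoffel[OF that]
    by (simp_all add: linear_iff)
  have diff: "(\<lambda>y. ?\<Gamma> y u v) differentiable (at z)" for u v
    using differentiable_left_christoffel[OF assms] differentiable_right_christoffel[OF assms]
      differentiable_cong[OF open_S assms, of "\<lambda>y. ?\<Gamma> y u v"] christoffel_eq
    by (simp add: differentiable_Pair)
  have D: "linear (\<lambda>u. dir_deriv u (\<lambda>y. ?\<Gamma> y v w) z)"
    "linear (\<lambda>u. dir_deriv v (\<lambda>y. ?\<Gamma> y u w) z)" "linear (\<lambda>u. dir_deriv v (\<lambda>y. ?\<Gamma> y w u) z)" for v w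
    by (intro linear_dir_deriv linear_dir_deriv_param[OF open_S assms] lin diff; assumption)+
  have comp: "linear (\<lambda>a. ?\<Gamma> z u (?\<Gamma> z v a))" "linear (\<lambda>a. ?\<Gamma> z u (?\<Gamma> z a v))" for u v
    using linear_compose[OF lin(2)[OF assms] lin(2)[OF assms]]
      linear_compose[OF lin(1)[OF assms] lin(2)[OF assms]] by (simp_all add: o_def)
  show "linear (\<lambda>u. riemann (cost_metric C) z u v w)" "linear (\<lambda>v. riemann (cost_metric C) z u v w)"
    "linear (\<lambda>w. riemann (cost_metric C) z u v w)"
    unfolding riemann_def
    by (intro linear_compose_add linear_compose_sub D lin[OF assms] comp)+
qed

text \<open>Mixed Christoffel symbols vanish, so for \<open>u\<close> in the first and
  \<open>v\<close> in the second factor R(u,v)v and R(u,v)u each reduce to one derivative of a pure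
  symbol, taken in the direction of the other factor.\<close>

lemma cross_curvature_eq:
  assumes z: "z \<in> S"
  shows "cross_curvature C z p q = - 2 * fourth_order_form C z p q"
proof -
  let ?g = "cost_metric C" and ?\<Gamma> = "christoffel (cost_metric C)"
  let ?R = "riemann ?g z" and ?u = "(p, 0) :: (real^'n) \<times> (real^'n)" and ?v = "(0, q) :: (real^'n) \<times> (real^'n)"
  let ?X = "fourth_order_form C z p q"
  have zero: "left_christoffel C y p' 0 = 0" "left_christoffel C y 0 p' = 0"
    "right_christoffel C y p' 0 = 0" "right_christoffel C y 0 p' = 0" if "y \<in> S" for y p'
    using linear_0[OF linear_left_christoffel(1)[OF that]] linear_0[OF linear_left_christoffel(2)[OF that]]
      linear_0[OF linear_right_christoffel(1)[OF that]] linear_0[OF linear_right_christoffel(2)[OF that]]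
    by simp_all
  have Dzero: "dir_deriv w (\<lambda>y. ?\<Gamma> y a b) z = 0" if "\<And>y. y \<in> S \<Longrightarrow> ?\<Gamma> y a b = 0" for w a b
  proof -
    have "dir_deriv w (\<lambda>y. ?\<Gamma> y a b) z = dir_deriv w (\<lambda>y. 0) z"
      by (rule dir_deriv_cong[OF open_S z]) (rule that)
    also have "\<dots> = 0" by (rule dir_deriv_eq) (rule has_derivative_const)
    finally show ?thesis .
  qed
  have \<Gamma>uv: "?\<Gamma> y ?u ?v = 0" "?\<Gamma> y ?v ?u = 0" if "y \<in> S" for y
    by (simp_all add: christoffel_eq that zero zero_prod_def)
  have \<Gamma>vv: "?\<Gamma> y ?v ?v = (0, right_christoffel C y q q)" if "y \<in> S" for y
    by (simp add: christoffel_eq that zero)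
  have \<Gamma>uu: "?\<Gamma> y ?u ?u = (left_christoffel C y p p, 0)" if "y \<in> S" for y
    by (simp add: christoffel_eq that zero)
  have pair0: "christoffel ?g z w 0 = 0" for w
    by (simp add: christoffel_eq[OF z] zero[OF z] zero_prod_def)
  define \<beta> where "\<beta> = dir_deriv ?u (\<lambda>y. right_christoffel C y q q) z"
  define \<alpha> where "\<alpha> = dir_deriv ?v (\<lambda>y. left_christoffel C y p p) z"
  have "dir_deriv ?u (\<lambda>y. ?\<Gamma> y ?v ?v) z = dir_deriv ?u (\<lambda>y. (0, right_christoffel C y q q)) z"
    by (rule dir_deriv_cong[OF open_S z \<Gamma>vv])
  also have "\<dots> = (0, \<beta>)"
    unfolding \<beta>_def by (rule dir_deriv_eq)
      (intro has_derivative_Pair has_derivative_const has_derivative_dir_deriv differentiable_right_christoffel z)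
  finally have Rv: "?R ?u ?v ?v = (0, \<beta>)"
    unfolding riemann_def using zero[OF z]
    by (simp add: Dzero \<Gamma>uv \<Gamma>vv z pair0) (simp add: christoffel_eq[OF z] zero[OF z] zero_prod_def)
  have "dir_deriv ?v (\<lambda>y. ?\<Gamma> y ?u ?u) z = dir_deriv ?v (\<lambda>y. (left_christoffel C y p p, 0)) z"
    by (rule dir_deriv_cong[OF open_S z \<Gamma>uu])
  also have "\<dots> = (\<alpha>, 0)"
    unfolding \<alpha>_def by (rule dir_deriv_eq)
      (intro has_derivative_Pair has_derivative_const has_derivative_dir_deriv differentiable_left_christoffel z)
  finally have Ru: "?R ?u ?v ?u = (- \<alpha>, 0)"
    unfolding riemann_def using zero[OF z]
    by (simp add: Dzero \<Gamma>uv \<Gamma>uu z pair0) (simp add: christoffel_eq[OF z] zero[OF z] zero_prod_def)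
  \<comment> \<open>Differentiating the identity \<open>right_christoffel\<close> along
    \<open>p\<close> isolates the term with \<beta>.\<close>
  have X1: "dir_deriv ?u (dir_deriv (0, \<beta>) C) z = ?X"
  proof -
    have "dir_deriv ?u (\<lambda>y. dir_deriv ?u (dir_deriv (0, right_christoffel C y q q) C) y) z
        = dir_deriv ?u (dir_deriv ?u (dir_deriv (0, right_christoffel C z q q) C)) z
          + dir_deriv ?u (dir_deriv (0, \<beta>) C) z"
      unfolding \<beta>_def
      by (rule dir_deriv_linear_apply[OF open_S z linear_right[OF linear_derivs(3)]])
         (auto intro!: differentiable_derivs differentiable_right_christoffel z)
    moreover have "dir_deriv ?u (\<lambda>y. dir_deriv ?u (dir_deriv (0, right_christoffel C y q q) C) y) z
        = dir_deriv ?u (dir_deriv ?u (dir_deriv ?v (dir_deriv ?v C))) z"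
      by (rule dir_deriv_cong[OF open_S z]) (rule right_christoffel)
    \<comment> \<open>The left identity replaces two derivatives along \<open>p\<close> by one along
      the left symbol; the right identity then replaces the right symbol by two derivatives along
      \<open>q\<close>.\<close>
    moreover have "dir_deriv ?u (dir_deriv ?u (dir_deriv (0, right_christoffel C z q q) C)) z
        = dir_deriv (left_christoffel C z p p, 0) (dir_deriv ?v (dir_deriv ?v C)) z"
      using left_christoffel[OF z] right_christoffel[OF z] by metis
    ultimately show ?thesis by (simp add: fourth_order_form_def)
  qed
  \<comment> \<open>The value at R(u,v)u is computed independently, by the mirror argument with
    \<alpha>, instead of being deduced from the skew symmetry of the curvature in its last two
    arguments. Permuting the fourth derivatives shows that the same form results.\<close>
  have X2: "dir_deriv (\<alpha>, 0) (dir_deriv ?v C) z = ?X"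
  proof -
    have "dir_deriv ?v (\<lambda>y. dir_deriv (left_christoffel C y p p, 0) (dir_deriv ?v C) y) z
        = dir_deriv ?v (dir_deriv (left_christoffel C z p p, 0) (dir_deriv ?v C)) z
          + dir_deriv (\<alpha>, 0) (dir_deriv ?v C) z"
      unfolding \<alpha>_def
      by (rule dir_deriv_linear_apply[OF open_S z linear_left[OF linear_derivs(2)]])
         (auto intro!: differentiable_derivs differentiable_left_christoffel z)
    moreover have "dir_deriv ?v (\<lambda>y. dir_deriv (left_christoffel C y p p, 0) (dir_deriv ?v C) y) z
        = dir_deriv ?v (dir_deriv ?u (dir_deriv ?u (dir_deriv ?v C))) z"
      by (rule dir_deriv_cong[OF open_S z]) (rule left_christoffel)
    moreover have "dir_deriv ?v (dir_deriv ?u (dir_deriv ?u (dir_deriv ?v C))) z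
        = dir_deriv ?u (dir_deriv ?v (dir_deriv ?u (dir_deriv ?v C))) z"
      by (rule dir_deriv_commute[OF open_S Ck_on_derivs(2) z])
    moreover have "dir_deriv ?u (dir_deriv ?v (dir_deriv ?u (dir_deriv ?v C))) z
        = dir_deriv ?u (dir_deriv ?u (dir_deriv ?v (dir_deriv ?v C))) z"
      by (rule dir_deriv_cong[OF open_S z]) (rule commute3_outer)
    moreover have "dir_deriv ?v (dir_deriv (left_christoffel C z p p, 0) (dir_deriv ?v C)) z
        = dir_deriv (left_christoffel C z p p, 0) (dir_deriv ?v (dir_deriv ?v C)) z"
      by (rule commute3_outer[OF z])
    ultimately show ?thesis by (simp add: fourth_order_form_def)
  qed
  have g: "?g z (0, \<beta>) ?u = - ?X / 2" "?g z (- \<alpha>, 0) ?v = ?X / 2"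
  proof -
    have z0: "dir_deriv (0, 0) (dir_deriv w C) z = 0" for w
      using linear_0[OF linear_derivs(2)[OF z]] by (simp add: zero_prod_def)
    show "?g z (0, \<beta>) ?u = - ?X / 2" using X1 by (simp add: cost_metric_eq[OF z] z0)
    have "dir_deriv (- \<alpha>, 0) (dir_deriv ?v C) z = - ?X"
      using linear_neg[OF linear_derivs(2)[OF z], of "(\<alpha>, 0)" ?v] X2 by simp
    then show "?g z (- \<alpha>, 0) ?v = ?X / 2" by (simp add: cost_metric_eq[OF z] z0)
  qed
  have lg: "linear (\<lambda>w. ?g z w a)" "linear (\<lambda>w. ?g z a w)" for a
    unfolding cost_metric_def
    by (auto simp: linear_iff inner_simps matrix_vector_right_distrib
        matrix_vector_mult_scaleR field_simps)
  have lQ: "linear (\<lambda>a. ?g z (?R a b d) c)" "linear (\<lambda>b. ?g z (?R a b d) c)"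
    "linear (\<lambda>d. ?g z (?R a b d) c)" for a b c d
    using linear_compose[OF linear_riemann(1)[OF z] lg(1)] linear_compose[OF linear_riemann(2)[OF z] lg(1)]
      linear_compose[OF linear_riemann(3)[OF z] lg(1)] by (simp_all add: o_def)
  have anti: "?g z (?R ?v ?u d) c = - ?g z (?R ?u ?v d) c" for c d
  proof -
    have "?R ?v ?u d = - ?R ?u ?v d" unfolding riemann_def by simp
    then show ?thesis using linear_neg[OF lg(1)] by simp
  qed
  define w where "w = wedge ?u ?v"
  have inner: "(\<Sum>c\<in>Basis. \<Sum>d\<in>Basis. ?g z (?R a b d) c * w c d)
      = ?g z (?R a b ?v) ?u - ?g z (?R a b ?u) ?v" for a b
    unfolding w_def
    by (rule sum_wedge[where B = "\<lambda>c d. ?g z (?R a b d) c"]) (rule lg lQ)+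
  have "curvature_operator ?g z w w
      = (\<Sum>a\<in>Basis. \<Sum>b\<in>Basis. (\<Sum>c\<in>Basis. \<Sum>d\<in>Basis. ?g z (?R a b d) c * w c d) * w a b)"
    unfolding curvature_operator_def by (simp add: sum_distrib_left sum_distrib_right mult_ac)
  also have "\<dots> = (\<Sum>a\<in>Basis. \<Sum>b\<in>Basis. (?g z (?R a b ?v) ?u - ?g z (?R a b ?u) ?v) * w a b)"
    by (simp only: inner)
  also have "\<dots> = (?g z (?R ?u ?v ?v) ?u - ?g z (?R ?u ?v ?u) ?v) - (?g z (?R ?v ?u ?v) ?u - ?g z (?R ?v ?u ?u) ?v)"
    unfolding w_def
    by (rule sum_wedge[where B = "\<lambda>a b. ?g z (?R a b ?v) ?u - ?g z (?R a b ?u) ?v"])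
       (intro linear_compose_sub lQ)+
  \<comment> \<open>Exchanging the first two arguments of the curvature doubles the inner difference
    \<open>- ?X / 2 - ?X / 2\<close>.\<close>
  also have "\<dots> = - 2 * ?X" by (simp add: anti Ru Rv g)
  finally show ?thesis by (simp add: cross_curvature_def w_def)
qed

section \<open>First and second derivatives of the second cost derivative\<close>

lemma Ck2_cost_second_deriv: "Ck_on 2 (cost_second_deriv C q \<alpha>) S"
  unfolding cost_second_deriv_def[abs_def] by (intro Ck_on_add open_S Ck_on_derivs Ck2_derivs)

lemma dir_deriv_cost_second_deriv:
  assumes "z \<in> S"
  shows "dir_deriv w (cost_second_deriv C q \<alpha>) z
    = dir_deriv w (dir_deriv (0, q) (dir_deriv (0, q) C)) z + dir_deriv w (dir_deriv (0, \<alpha>) C) z"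
  unfolding cost_second_deriv_def[abs_def] by (intro dir_deriv_add differentiable_derivs assms)

text \<open>The left side is the second derivative along a curve with velocity \<open>p\<close> and
  geodesic acceleration. The contribution of \<alpha> cancels by the identity
  \<open>left_christoffel\<close>, which is why the result does not depend on it.\<close>

lemma cost_second_deriv_left_geodesic:
  assumes z: "z \<in> S"
  shows "dir_deriv (p, 0) (dir_deriv (p, 0) (cost_second_deriv C q \<alpha>)) z
      + dir_deriv (- left_christoffel C z p p, 0) (cost_second_deriv C q \<alpha>) z
    = fourth_order_form C z p q"
proof -
  let ?\<phi> = "cost_second_deriv C q \<alpha>"
  note D1 = dir_deriv_cost_second_deriv
  have "dir_deriv w (dir_deriv w' ?\<phi>) z
      = dir_deriv w (\<lambda>y. dir_deriv w' (dir_deriv (0, q) (dir_deriv (0, q) C)) y + dir_deriv w' (dir_deriv (0, \<alpha>) C) y) z"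
    for w w' by (rule dir_deriv_cong[OF open_S z D1])
  also have "\<dots> w w' = dir_deriv w (dir_deriv w' (dir_deriv (0, q) (dir_deriv (0, q) C))) z
      + dir_deriv w (dir_deriv w' (dir_deriv (0, \<alpha>) C)) z" for w w'
    by (intro dir_deriv_add differentiable_derivs z
        Ck_on_differentiable[OF Ck_on_dir_deriv[OF Ck_on_derivs(2), of 1] _ z]) simp_all
  finally have D2: "dir_deriv w (dir_deriv w' ?\<phi>) z = dir_deriv w (dir_deriv w' (dir_deriv (0, q) (dir_deriv (0, q) C))) z
      + dir_deriv w (dir_deriv w' (dir_deriv (0, \<alpha>) C)) z" for w w' .
  have neg: "dir_deriv (- a, 0) f z = - dir_deriv (a, 0) f z" if "f differentiable (at z)" for a and f :: "_ \<Rightarrow> real"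
    using linear_neg[OF linear_dir_deriv[OF that], of "(a, 0)"] by simp
  show ?thesis
    by (simp add: D1[OF z] D2 neg differentiable_derivs[OF z] left_christoffel[OF z] fourth_order_form_def)
qed

lemma dir_deriv_cost_second_deriv_eq_0:
  assumes "z \<in> S"
  shows "dir_deriv (p, 0) (cost_second_deriv C q (- right_christoffel C z q q)) z = 0"
proof -
  have "dir_deriv (p, 0) (dir_deriv (0, - b) C) z = - dir_deriv (p, 0) (dir_deriv (0, b) C) z" for b
    using linear_neg[OF linear_derivs(3)[OF assms], of "(p, 0)" "(0, b)"] by simp
  then show ?thesis
    by (simp add: dir_deriv_cost_second_deriv[OF assms] right_christoffel[OF assms])
qed

text \<open>Geodesics on [0, 1] are available only for small multiples of a given velocity;
  quadratic homogeneity carries the sign back to the velocity itself.\<close>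

lemma fourth_order_form_scaleR:
  assumes z: "z \<in> S"
  shows "fourth_order_form C z p (r *\<^sub>R q) = r\<^sup>2 * fourth_order_form C z p q"
proof -
  let ?f = "dir_deriv (0, q) (dir_deriv (0, q) C)" and ?g = "dir_deriv (0, r *\<^sub>R q) (dir_deriv (0, r *\<^sub>R q) C)"
  have cmult: "dir_deriv w (\<lambda>y. k * h y) y = k * dir_deriv w h y" if "h differentiable (at y)" for w k y and h :: "_ \<Rightarrow> real"
    by (rule dir_deriv_eq) (intro has_derivative_mult_right has_derivative_dir_deriv that)
  have 0: "?g y = r\<^sup>2 * ?f y" if "y \<in> S" for y
    using linear_scale[OF linear_right[OF linear_derivs(2)[OF that]]]
      linear_scale[OF linear_right[OF linear_derivs(3)[OF that]]] by (simp add: power2_eq_square)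
  have 1: "dir_deriv w ?g y = r\<^sup>2 * dir_deriv w ?f y" if "y \<in> S" for w y
    using dir_deriv_cong[OF open_S that 0] cmult[OF differentiable_derivs(3)[OF that]] by simp
  have 2: "dir_deriv w (dir_deriv w' ?g) z = r\<^sup>2 * dir_deriv w (dir_deriv w' ?f) z" for w w'
    using dir_deriv_cong[OF open_S z 1] cmult[OF differentiable_derivs(4)[OF z]] by simp
  show ?thesis by (simp add: fourth_order_form_def 1[OF z] 2 algebra_simps)
qed

end

section \<open>Second derivatives on the unit interval and implicit curves\<close>

text \<open>Being local in \<open>t\<close>, this can be verified in one chart at a time.\<close>

definition has_second_derivative_01 :: "(real \<Rightarrow> real) \<Rightarrow> real \<Rightarrow> real \<Rightarrow> real \<Rightarrow> bool" where
  "has_second_derivative_01 f t a b \<longleftrightarrow> (\<exists>w. w t = a \<and>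
     (f has_real_derivative a) (at t within {0..1}) \<and>
     (\<forall>\<^sub>F s in at t within {0..1}. (f has_real_derivative w s) (at s within {0..1})) \<and>
     (w has_real_derivative b) (at t within {0..1}))"

lemma DERIV_unique_01:
  fixes f :: "real \<Rightarrow> real"
  assumes "t \<in> {0..1}" "(f has_real_derivative a) (at t within {0..1})"
    "(f has_real_derivative b) (at t within {0..1})"
  shows "a = b"
  using assms vector_derivative_unique_within_closed_interval[of 0 1 t f a b]
  by (simp add: has_real_derivative_iff_has_vector_derivative)

lemma has_second_derivative_01_diff:
  assumes "has_second_derivative_01 f t a b" "has_second_derivative_01 g t a' b'"
  shows "has_second_derivative_01 (\<lambda>s. f s - g s) t (a - a') (b - b')"
proof -
  obtain w w' where w: "w t = a" "(f has_real_derivative a) (at t within {0..1})"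
      "\<forall>\<^sub>F s in at t within {0..1}. (f has_real_derivative w s) (at s within {0..1})"
      "(w has_real_derivative b) (at t within {0..1})"
    and w': "w' t = a'" "(g has_real_derivative a') (at t within {0..1})"
      "\<forall>\<^sub>F s in at t within {0..1}. (g has_real_derivative w' s) (at s within {0..1})"
      "(w' has_real_derivative b') (at t within {0..1})"
    using assms unfolding has_second_derivative_01_def by blast
  have "\<forall>\<^sub>F s in at t within {0..1}.
      ((\<lambda>s. f s - g s) has_real_derivative w s - w' s) (at s within {0..1})"
    using w(3) w'(3) by eventually_elim (rule DERIV_diff)
  then show ?thesis
    unfolding has_second_derivative_01_def using w w' by (intro exI[of _ "\<lambda>s. w s - w' s"]) (auto intro: DERIV_diff)
qed

text \<open>The local witness \<open>w\<close> depends on \<open>t\<close>, but near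
  \<open>t\<close> it coincides with any derivative on [0, 1] by uniqueness. This is how data from
  different charts are glued.\<close>

lemma has_second_derivative_01_derivative:
  assumes t: "t \<in> {0..1}" and f: "has_second_derivative_01 f t a b"
    and f': "\<And>s. s \<in> {0..1} \<Longrightarrow> (f has_real_derivative f' s) (at s within {0..1})"
  shows "(f' has_real_derivative b) (at t within {0..1})"
proof -
  obtain w where w: "w t = a" "(f has_real_derivative a) (at t within {0..1})"
      "\<forall>\<^sub>F s in at t within {0..1}. (f has_real_derivative w s) (at s within {0..1})"
      "(w has_real_derivative b) (at t within {0..1})"
    using f unfolding has_second_derivative_01_def by blast
  have "\<forall>\<^sub>F s in at t within {0..1}. s \<in> {0..1}" by (simp add: eventually_at_filter)
  with w(3) have "\<forall>\<^sub>F s in at t within {0..1}. w s = f' s"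
    by eventually_elim (use DERIV_unique_01 f' in blast)
  moreover have "w t = f' t" using DERIV_unique_01[OF t w(2) f'[OF t]] w(1) by simp
  ultimately show ?thesis
    using w(4) has_derivative_transform_eventually[of w _ t "{0..1}" f'] t
    unfolding has_field_derivative_def by blast
qed

lemma has_second_derivative_01_unique:
  assumes "t \<in> {0..1}" "has_second_derivative_01 f t a b"
    "\<And>s. s \<in> {0..1} \<Longrightarrow> (f has_real_derivative f' s) (at s within {0..1})"
    "(f' has_real_derivative f'') (at t within {0..1})"
  shows "f'' = b"
  using has_second_derivative_01_derivative[OF assms(1-3)] assms(1,4) DERIV_unique_01 by blast

lemma has_second_derivative_01D:
  assumes "\<And>t. t \<in> {0..1} \<Longrightarrow> has_second_derivative_01 f t (a t) (b t)" "t \<in> {0..1}"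
  shows "(f has_real_derivative a t) (at t within {0..1})"
    "(a has_real_derivative b t) (at t within {0..1})"
proof -
  have *: "(f has_real_derivative a s) (at s within {0..1})" if "s \<in> {0..1}" for s
    using assms(1)[OF that] unfolding has_second_derivative_01_def by blast
  show "(f has_real_derivative a t) (at t within {0..1})" using * assms by blast
  show "(a has_real_derivative b t) (at t within {0..1})"
    using has_second_derivative_01_derivative[OF assms(2) assms(1)[OF assms(2)] *] by blast
qed

text \<open>Only agreement of \<open>g\<close> with \<open>f\<close> along \<zeta> near
  \<open>t\<close> is required, because \<zeta> will be the coordinate expression of a curve that
  may leave the chart.\<close>

lemma has_second_derivative_01_chain:
  fixes f :: "'a::euclidean_space \<Rightarrow> real"
  assumes S: "open S" "Ck_on 2 f S" "\<zeta> t \<in> S" and t: "t \<in> {0..1}"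
    and \<zeta>: "(\<zeta> has_vector_derivative \<omega> t) (at t within {0..1})"
    and \<zeta>': "\<forall>\<^sub>F s in at t within {0..1}. (\<zeta> has_vector_derivative \<omega> s) (at s within {0..1})"
    and \<omega>: "(\<omega> has_vector_derivative \<alpha>) (at t within {0..1})"
    and g: "g t = f (\<zeta> t)" "\<exists>d>0. \<forall>s\<in>{0..1}. \<bar>s - t\<bar> < d \<longrightarrow> g s = f (\<zeta> s)"
  shows "has_second_derivative_01 g t (dir_deriv (\<omega> t) f (\<zeta> t))
    (dir_deriv (\<omega> t) (dir_deriv (\<omega> t) f) (\<zeta> t) + dir_deriv \<alpha> f (\<zeta> t))"
proof -
  obtain d where d: "d > 0" "\<And>s. s \<in> {0..1} \<Longrightarrow> \<bar>s - t\<bar> < d \<Longrightarrow> g s = f (\<zeta> s)"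
    using g(2) by blast
  have df: "f differentiable (at z)" if "z \<in> S" for z
    using Ck_on_differentiable[OF S(2) _ that] by simp
  have gd: "(g has_real_derivative dir_deriv (\<omega> s) f (\<zeta> s)) (at s within {0..1})"
    if s: "s \<in> {0..1}" "\<bar>s - t\<bar> < d" "\<zeta> s \<in> S" "(\<zeta> has_vector_derivative \<omega> s) (at s within {0..1})" for s
  proof -
    have "((\<lambda>s. f (\<zeta> s)) has_vector_derivative dir_deriv (\<omega> s) f (\<zeta> s)) (at s within {0..1})"
      by (rule has_vector_derivative_dir_deriv[OF df[OF s(3)] s(4)])
    then have "(g has_vector_derivative dir_deriv (\<omega> s) f (\<zeta> s)) (at s within {0..1})"
    proof (rule has_vector_derivative_transform_within)
      show "0 < d - \<bar>s - t\<bar>" using s by simp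
      show "f (\<zeta> r) = g r" if "r \<in> {0..1}" "dist r s < d - \<bar>s - t\<bar>" for r
        using d(2)[of r] that by (simp add: dist_real_def)
    qed (rule s)
    then show ?thesis by (simp add: has_real_derivative_iff_has_vector_derivative)
  qed
  have ev1: "\<forall>\<^sub>F s in at t within {0..1}. s \<in> {0..1} \<and> \<bar>s - t\<bar> < d"
    unfolding eventually_at using d(1) by (intro exI[of _ d]) (simp add: dist_real_def)
  have ev2: "\<forall>\<^sub>F s in at t within {0..1}. \<zeta> s \<in> S"
    by (rule has_vector_derivative_imp_eventually_in[OF \<zeta> S(1,3)])
  show ?thesis
    unfolding has_second_derivative_01_def
  proof (intro exI[of _ "\<lambda>s. dir_deriv (\<omega> s) f (\<zeta> s)"] conjI)
    show "(g has_real_derivative dir_deriv (\<omega> t) f (\<zeta> t)) (at t within {0..1})"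
      by (rule gd) (use t d S \<zeta> in auto)
    show "\<forall>\<^sub>F s in at t within {0..1}. (g has_real_derivative dir_deriv (\<omega> s) f (\<zeta> s)) (at s within {0..1})"
      using ev1 ev2 \<zeta>' by eventually_elim (use gd in blast)
    show "((\<lambda>s. dir_deriv (\<omega> s) f (\<zeta> s)) has_real_derivative
        dir_deriv (\<omega> t) (dir_deriv (\<omega> t) f) (\<zeta> t) + dir_deriv \<alpha> f (\<zeta> t)) (at t within {0..1})"
      using has_vector_derivative_dir_deriv2[OF S t \<zeta> \<omega>]
      by (simp add: has_real_derivative_iff_has_vector_derivative)
  qed simp
qed

section \<open>Convexity, concavity and maxima in one variable\<close>

lemma mvt_01:
  fixes f :: "real \<Rightarrow> real"
  assumes "0 \<le> x" "x < y" "y \<le> 1"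
    and "\<And>t. t \<in> {0..1} \<Longrightarrow> (f has_real_derivative f' t) (at t within {0..1})"
  obtains z where "x < z" "z < y" "f y - f x = f' z * (y - x)"
proof -
  have "(f has_derivative (\<lambda>h. f' t * h)) (at t within {x..y})" if "x \<le> t" "t \<le> y" for t
    using assms that has_derivative_subset[of f "\<lambda>h. f' t * h" t "{0..1}" "{x..y}"]
    by (auto simp: has_field_derivative_def)
  then obtain z where "z \<in> {x<..<y}" "f y - f x = f' z * (y - x)"
    using mvt_simple[OF assms(2), of f "\<lambda>t h. f' t * h"] by blast
  then show ?thesis by (intro that[of z]) auto
qed

lemma mono_derivative_01:
  fixes f :: "real \<Rightarrow> real"
  assumes "\<And>t. t \<in> {0..1} \<Longrightarrow> (f has_real_derivative f' t) (at t within {0..1})"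
    "\<And>t. t \<in> {0..1} \<Longrightarrow> 0 \<le> f' t" "0 \<le> x" "x \<le> y" "y \<le> 1"
  shows "f x \<le> f y"
proof (cases "x = y")
  case False
  then obtain z where "x < z" "z < y" "f y - f x = f' z * (y - x)"
    using mvt_01[of x y f f'] assms by auto
  moreover have "0 \<le> f' z * (y - x)" using calculation assms by (intro mult_nonneg_nonneg) auto
  ultimately show ?thesis by simp
qed simp

lemma twice_diff_convexI:
  assumes f: "\<And>t. t \<in> {0..1} \<Longrightarrow> (f has_real_derivative f' t) (at t within {0..1})"
    and f': "\<And>t. t \<in> {0..1} \<Longrightarrow> (f' has_real_derivative f'' t) (at t within {0..1})"
    and nonneg: "\<And>t. t \<in> {0..1} \<Longrightarrow> 0 \<le> f'' t"
  shows "twice_diff_convex f"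
proof -
  have mono: "f' x \<le> f' y" if "0 \<le> x" "x \<le> y" "y \<le> 1" for x y
    by (rule mono_derivative_01[OF f' nonneg that])
  have "convex_on {0..1} f"
  proof (rule pos_convex_function[where f' = f'])
    fix x y :: real assume xy: "x \<in> {0..1}" "y \<in> {0..1}"
    consider "x = y" | "x < y" | "y < x" by linarith
    then show "f' x * (y - x) \<le> f y - f x"
    proof cases
      case 2
      then obtain z where z: "x < z" "z < y" "f y - f x = f' z * (y - x)"
        using mvt_01[of x y f f'] f xy by auto
      then show ?thesis using mono[of x z] xy by (simp add: mult_right_mono)
    next
      case 3
      then obtain z where z: "y < z" "z < x" "f x - f y = f' z * (x - y)"
        using mvt_01[of y x f f'] f xy by auto
      then have "f' z * (x - y) \<le> f' x * (x - y)" using mono[of z x] xy by (intro mult_right_mono) auto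
      then show ?thesis using z by (simp add: algebra_simps)
    qed simp
  qed simp
  then show ?thesis unfolding twice_diff_convex_def using f f' nonneg by blast
qed

lemma concave_critical_01:
  fixes f :: "real \<Rightarrow> real"
  assumes f: "\<And>t. t \<in> {0..1} \<Longrightarrow> has_second_derivative_01 f t (f' t) (f'' t)"
    and "\<And>t. t \<in> {0..1} \<Longrightarrow> f'' t \<le> 0" "f' 0 = 0"
  shows "f 1 \<le> f 0"
proof -
  have df: "(f has_real_derivative f' t) (at t within {0..1})"
    "(f' has_real_derivative f'' t) (at t within {0..1})" if "t \<in> {0..1}" for t
    using has_second_derivative_01D[of f f' f''] f that by blast+
  have "f' t \<le> 0" if "t \<in> {0..1}" for t
    using mono_derivative_01[of "\<lambda>t. - f' t" "\<lambda>t. - f'' t" 0 t] df(2) assms(2,3) that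
    by (auto intro!: derivative_intros)
  then show ?thesis
    using mono_derivative_01[of "\<lambda>t. - f t" "\<lambda>t. - f' t" 0 1] df(1)
    by (auto intro!: derivative_intros)
qed

text \<open>If \<open>b\<close> were positive, \<open>h'\<close> would be positive just to the right
  of 0 and \<open>h\<close> would exceed \<open>h 0\<close> there; comparison on one side is
  enough.\<close>

lemma second_derivative_nonpos_at_maximum:
  fixes h :: "real \<Rightarrow> real"
  assumes d: "0 < d" and h: "\<And>s. \<bar>s\<bar> < d \<Longrightarrow> (h has_real_derivative h' s) (at s)"
    and h': "(h' has_real_derivative b) (at 0)" "h' 0 = 0"
    and max: "\<And>s. 0 < s \<Longrightarrow> s < d \<Longrightarrow> h s \<le> h 0"
  shows "b \<le> 0"
proof (rule ccontr)
  assume "\<not> b \<le> 0"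
  then obtain e where e: "e > 0" "\<And>s. 0 < s \<Longrightarrow> s < e \<Longrightarrow> 0 < h' s"
    using DERIV_pos_inc_right[OF h'(1)] h'(2) by auto
  define s where "s = min d e / 2"
  have s: "0 < s" "s < d" "s < e" using d e by (auto simp: s_def)
  obtain r where r: "0 < r" "r < s" "h s - h 0 = (s - 0) * h' r"
    using MVT2[OF s(1), of h h'] h s by force
  then have "h s - h 0 > 0" using e(2)[of r] s by simp
  then show False using max[OF s(1,2)] by simp
qed

section \<open>Slices of functions of two variables and implicit curves\<close>

lemma dir_deriv_slice:
  assumes "f differentiable (at (y, z))"
  shows "dir_deriv u (\<lambda>y. f (y, z)) y = dir_deriv (u, 0) f (y, z)"
    "dir_deriv v (\<lambda>z. f (y, z)) z = dir_deriv (0, v) f (y, z)"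
    "(\<lambda>y. f (y, z)) differentiable (at y)" "(\<lambda>z. f (y, z)) differentiable (at z)"
proof -
  have 1: "((\<lambda>y. f (y, z)) has_derivative (\<lambda>u. dir_deriv (u, 0) f (y, z))) (at y)"
    by (rule has_derivative_compose[where f = "\<lambda>y. (y, z)" and g = f, OF _ has_derivative_dir_deriv[OF assms]])
       (auto intro!: derivative_eq_intros)
  have 2: "((\<lambda>z. f (y, z)) has_derivative (\<lambda>v. dir_deriv (0, v) f (y, z))) (at z)"
    by (rule has_derivative_compose[where f = "\<lambda>z. (y, z)" and g = f, OF _ has_derivative_dir_deriv[OF assms]])
       (auto intro!: derivative_eq_intros)
  show "dir_deriv u (\<lambda>y. f (y, z)) y = dir_deriv (u, 0) f (y, z)"
    "dir_deriv v (\<lambda>z. f (y, z)) z = dir_deriv (0, v) f (y, z)"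
    using dir_deriv_eq[OF 1] dir_deriv_eq[OF 2] by auto
  show "(\<lambda>y. f (y, z)) differentiable (at y)" "(\<lambda>z. f (y, z)) differentiable (at z)"
    using 1 2 by (auto simp: differentiable_def)
qed

lemma open_slice:
  fixes S :: "('a::topological_space \<times> 'b::topological_space) set"
  assumes "open S"
  shows "open {y. (y, z) \<in> S}" "open {z. (y, z) \<in> S}"
proof -
  have "continuous_on UNIV (\<lambda>y. (y, z))" "continuous_on UNIV (\<lambda>z. (y, z))"
    by (intro continuous_intros)+
  then show "open {y. (y, z) \<in> S}" "open {z. (y, z) \<in> S}"
    using open_vimage[OF assms] by (auto simp: vimage_def)
qed

lemma Ck_on_slice:
  assumes "open S" "Ck_on k f S"
  shows "Ck_on k (\<lambda>y. f (y, z)) {y. (y, z) \<in> S}" "Ck_on k (\<lambda>z. f (y, z)) {z. (y, z) \<in> S}"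
  using assms(2)
proof (induction k arbitrary: f)
  case 0
  {
    case 1
    then have "continuous_on S f" by simp
    then show ?case by (auto intro!: continuous_intros elim!: continuous_on_compose2)
  next
    case 2
    then have "continuous_on S f" by simp
    then show ?case by (auto intro!: continuous_intros elim!: continuous_on_compose2)
  }
next
  case (Suc k)
  {
    case 1
    then have "Ck_on k (dir_deriv u (\<lambda>y. f (y, z))) {y. (y, z) \<in> S}
        \<longleftrightarrow> Ck_on k (\<lambda>y. dir_deriv (u, 0) f (y, z)) {y. (y, z) \<in> S}" for u
      by (intro Ck_on_cong open_slice assms) (simp add: dir_deriv_slice)
    with 1 show ?case using Suc.IH(1) by (simp add: dir_deriv_slice)
  next
    case 2
    then have "Ck_on k (dir_deriv u (\<lambda>z. f (y, z))) {z. (y, z) \<in> S}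
        \<longleftrightarrow> Ck_on k (\<lambda>z. dir_deriv (0, u) f (y, z)) {z. (y, z) \<in> S}" for u
      by (intro Ck_on_cong open_slice assms) (simp add: dir_deriv_slice)
    with 2 show ?case using Suc.IH(2) by (simp add: dir_deriv_slice)
  }
qed

text \<open>Differentiating the affine relations once shows that the velocity is
  \<open>K (z t)\<close> for a differentiable vector field \<open>K\<close>, hence that it is
  differentiable as well; differentiating twice gives the equation for the acceleration. The set
  \<open>I\<close> is relatively open in [0, 1]: it will consist of the times spent in a
  chart.\<close>

lemma implicit_curve:
  fixes f :: "'n::finite \<Rightarrow> real^'n \<Rightarrow> real"
  assumes U: "open U" "\<And>i. Ck_on 2 (f i) U"
    and inv: "\<And>y. y \<in> U \<Longrightarrow> invertible (\<chi> i j. dir_deriv (axis j 1) (f i) y)"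
    and I: "I \<subseteq> {0..1}" "\<And>t. t \<in> I \<Longrightarrow> \<forall>\<^sub>F s in at t within {0..1}. s \<in> I"
    and z: "\<And>t. t \<in> I \<Longrightarrow> continuous (at t within {0..1}) z" "\<And>t. t \<in> I \<Longrightarrow> z t \<in> U"
    and affine: "\<And>t i. t \<in> I \<Longrightarrow> f i (z t) = a i + t * b i"
  obtains w \<alpha> where "\<And>t. t \<in> I \<Longrightarrow> (z has_vector_derivative w t) (at t within {0..1})"
    "\<And>t. t \<in> I \<Longrightarrow> (w has_vector_derivative \<alpha> t) (at t within {0..1})"
    "\<And>t i. t \<in> I \<Longrightarrow> dir_deriv (w t) (dir_deriv (w t) (f i)) (z t) + dir_deriv (\<alpha> t) (f i) (z t) = 0"
proof -
  define M where "M y = (\<chi> i j. dir_deriv (axis j 1) (f i) y)" for y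
  define F where "F y = (\<chi> i. f i y)" for y
  define b' where "b' = (\<chi> i. b i)"
  \<comment> \<open>The solution of \<open>M y *v v = b'\<close>: the only possible velocity at
    position \<open>y\<close>.\<close>
  define K where "K y = matrix_inv (M y) *v b'" for y
  have df: "f i differentiable (at y)" if "y \<in> U" for y i
    using Ck_on_differentiable[OF U(2) _ that] by simp
  have d2f: "dir_deriv v (f i) differentiable (at y)" if "y \<in> U" for v y i
    using Ck_on_differentiable[OF Ck_on_dir_deriv[OF U(2), of 1] _ that] by simp
  have M: "(M y *v v) $ i = dir_deriv v (f i) y" if "y \<in> U" for y v i
    using linear_eq_sum_axis[OF linear_dir_deriv[OF df[OF that]], of v i]
    by (simp add: M_def matrix_vector_mult_def mult.commute)
  have dF: "(F has_derivative (\<lambda>v. M y *v v)) (at y)" if "y \<in> U" for y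
    using has_derivative_dir_deriv[OF df[OF that]]
    by (subst has_derivative_componentwise_within)
       (auto simp: Basis_vec_def inner_axis F_def M[OF that])
  have invM: "invertible (M y)" if "y \<in> U" for y using inv[OF that] by (simp add: M_def)
  have zd: "(z has_vector_derivative K (z t)) (at t within {0..1})" if t: "t \<in> I" for t
    unfolding K_def
  proof (rule has_vector_derivative_inverse_image[where b = b' and G = "(*v) (matrix_inv (M (z t)))",
        OF z(1)[OF t] dF[OF z(2)[OF t]]])
    have "((\<lambda>s. (\<chi> i. a i) + s *\<^sub>R b') has_vector_derivative b') (at t within {0..1})"
      by (auto intro!: derivative_eq_intros)
    then show "((\<lambda>s. F (z s)) has_vector_derivative b') (at t within {0..1})"
      unfolding has_vector_derivative_def
      by (rule has_derivative_transform_eventually)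
         (use eventually_mono[OF I(2)[OF t]] t I(1) affine in \<open>auto simp: F_def b'_def vec_eq_iff\<close>)
    show "linear ((*v) (matrix_inv (M (z t))))" by (rule matrix_vector_mul_linear)
    show "matrix_inv (M (z t)) *v (M (z t) *v v) = v" for v
      using matrix_inv_mult_vector[OF invM[OF z(2)[OF t]]]
        invertible_matrix_vector_cancel[OF invM[OF z(2)[OF t]]] by blast
  qed
  have dK: "K differentiable (at y)" if "y \<in> U" for y
    unfolding K_def[abs_def]
    by (rule differentiable_matrix_inv_mult[OF U(1) that invM]) (simp_all add: M_def d2f that)
  define w where "w t = K (z t)" for t
  define \<alpha> where "\<alpha> t = dir_deriv (w t) K (z t)" for t
  have wd: "(w has_vector_derivative \<alpha> t) (at t within {0..1})" if t: "t \<in> I" for t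
    unfolding w_def[abs_def] \<alpha>_def
    by (rule has_vector_derivative_dir_deriv[OF dK[OF z(2)[OF t]] zd[OF t]])
  have Mw: "dir_deriv (w t) (f i) (z t) = b i" if t: "t \<in> I" for t i
    using M[OF z(2)[OF t], of "w t" i] matrix_inv_mult_vector[OF invM[OF z(2)[OF t]], of b']
    by (simp add: w_def K_def b'_def)
  have ode: "dir_deriv (w t) (dir_deriv (w t) (f i)) (z t) + dir_deriv (\<alpha> t) (f i) (z t) = 0"
    if t: "t \<in> I" for t i
  proof -
    have t01: "t \<in> {0..1}" using t I(1) by auto
    have "((\<lambda>s. dir_deriv (w s) (f i) (z s)) has_vector_derivative
        dir_deriv (w t) (dir_deriv (w t) (f i)) (z t) + dir_deriv (\<alpha> t) (f i) (z t)) (at t within {0..1})"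
      by (rule has_vector_derivative_dir_deriv2[where \<omega> = w and \<zeta> = z, OF U(1) U(2) z(2)[OF t] t01 _ wd[OF t]])
         (use zd[OF t] in \<open>simp add: w_def\<close>)
    \<comment> \<open>By \<open>Mw\<close> this function equals the constant \<open>b i\<close>
      throughout \<open>I\<close>, a neighbourhood of \<open>t\<close> in [0, 1].\<close>
    moreover have "((\<lambda>s. dir_deriv (w s) (f i) (z s)) has_vector_derivative 0) (at t within {0..1})"
      unfolding has_vector_derivative_def
      by (rule has_derivative_transform_eventually[of "\<lambda>_. b i"])
         (use eventually_mono[OF I(2)[OF t]] t01 t Mw in auto)
    ultimately show ?thesis
      using vector_derivative_unique_within_closed_interval[of 0 1 t] t01 by fastforce
  qed
  show ?thesis by (rule that[of w \<alpha>]) (use zd wd ode in \<open>auto simp: w_def\<close>)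
qed

text \<open>In finite dimension, continuity of the derivative on each vector gives continuity as an
  operator, and injectivity at \<open>x0\<close> gives the left inverse that the inverse function
  theorem asks for.\<close>

lemma inverse_function_C1:
  fixes f :: "'a::euclidean_space \<Rightarrow> 'a"
  assumes U: "open U" "x0 \<in> U"
    and f: "\<And>x. x \<in> U \<Longrightarrow> (f has_derivative f' x) (at x)" "\<And>v. continuous_on U (\<lambda>x. f' x v)"
    and inj: "\<And>v. f' x0 v = 0 \<Longrightarrow> v = 0"
  obtains U' V g where "open U'" "U' \<subseteq> U" "x0 \<in> U'" "open V" "f x0 \<in> V" "homeomorphism U' V f g"
proof -
  define F where "F x = Blinfun (f' x)" for x
  have F: "blinfun_apply (F x) = f' x" if "x \<in> U" for x
    unfolding F_def by (rule bounded_linear_Blinfun_apply[OF has_derivative_bounded_linear[OF f(1)[OF that]]])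
  have "linear (f' x0)" using f(1)[OF U(2)] by (rule has_derivative_linear)
  moreover have "inj (f' x0)" using calculation inj by (metis linear_injective_0)
  ultimately obtain h where h: "linear h" "h \<circ> f' x0 = id"
    using linear_injective_left_inverse by blast
  have hb: "bounded_linear h" using h(1) linear_conv_bounded_linear by blast
  have left: "Blinfun h o\<^sub>L F x0 = id_blinfun"
    by (rule blinfun_eqI) (use h(2) in \<open>simp add: F[OF U(2)] bounded_linear_Blinfun_apply[OF hb] fun_eq_iff\<close>)
  have cont: "continuous_on U F"
    by (rule continuous_on_blinfun_componentwise) (use f(2) F in \<open>simp cong: continuous_on_cong\<close>)
  have der: "(f has_derivative blinfun_apply (F x)) (at x)" if "x \<in> U" for x
    using f(1)[OF that] F[OF that] by simp
  show ?thesis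
    by (rule inverse_function_theorem[OF U(1) der cont U(2) left]) (use that in blast)+
qed

lemma eventually_in_chart:
  fixes f :: "real \<Rightarrow> 'a::topological_space"
  assumes "continuous_on {0..1} f" "t \<in> {0..1}" "open D" "f t \<in> D"
  shows "\<forall>\<^sub>F s in at t within {0..1}. s \<in> {s \<in> {0..1}. f s \<in> D}"
proof -
  have "(f \<longlongrightarrow> f t) (at t within {0..1})" using assms(1,2) by (simp add: continuous_on)
  then have "\<forall>\<^sub>F s in at t within {0..1}. f s \<in> D" using assms(3,4) by (rule topological_tendstoD)
  moreover have "\<forall>\<^sub>F s in at t within {0..1}. s \<in> {0..1}" by (simp add: eventually_at_filter)
  ultimately show ?thesis by eventually_elim simp
qed

section \<open>Geodesics in a factor\<close>

context nondegenerate_coord_cost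
begin

lemma mixed_hessian_nth:
  assumes "z \<in> S"
  shows "(mixed_hessian C z *v q) $ i = dir_deriv (axis i 1, 0) (dir_deriv (0, q) C) z"
  by (simp flip: mixed_hessian_form[OF assms] add: inner_axis')

text \<open>\<open>implicit_curve\<close> is applied to the components of the covector in the first
  factor, whose Jacobian in the second variable is the mixed Hessian. Its acceleration equation,
  paired with each axis, is the equation that characterizes
  \<open>right_christoffel\<close>.\<close>

lemma right_curve_ode:
  assumes I: "I \<subseteq> {0..1}" "\<And>t. t \<in> I \<Longrightarrow> \<forall>\<^sub>F s in at t within {0..1}. s \<in> I"
    and z: "\<And>t. t \<in> I \<Longrightarrow> continuous (at t within {0..1}) z" "\<And>t. t \<in> I \<Longrightarrow> (y, z t) \<in> S"
    and affine: "\<And>t i. t \<in> I \<Longrightarrow> dir_deriv (axis i 1, 0) C (y, z t) = a i + t * b i"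
  obtains w where "\<And>t. t \<in> I \<Longrightarrow> (z has_vector_derivative w t) (at t within {0..1})"
    "\<And>t. t \<in> I \<Longrightarrow> (w has_vector_derivative - right_christoffel C (y, z t) (w t) (w t)) (at t within {0..1})"
proof -
  let ?f = "\<lambda>i v. dir_deriv (axis i 1, 0) C (y, v)" and ?U = "{v. (y, v) \<in> S}"
  have D: "dir_deriv q (?f i) v = dir_deriv (0, q) (dir_deriv (axis i 1, 0) C) (y, v)" if "(y, v) \<in> S" for q i v
    by (rule dir_deriv_slice) (rule differentiable_derivs[OF that])
  have D2: "dir_deriv q' (dir_deriv q (?f i)) v = dir_deriv (0, q') (dir_deriv (0, q) (dir_deriv (axis i 1, 0) C)) (y, v)"
    if "(y, v) \<in> S" for q q' i v
  proof -
    have "dir_deriv q' (dir_deriv q (?f i)) v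
        = dir_deriv q' (\<lambda>v. dir_deriv (0, q) (dir_deriv (axis i 1, 0) C) (y, v)) v"
      by (rule dir_deriv_cong[OF open_slice(2)[OF open_S]]) (use that D in auto)
    also have "\<dots> = dir_deriv (0, q') (dir_deriv (0, q) (dir_deriv (axis i 1, 0) C)) (y, v)"
      by (rule dir_deriv_slice) (rule differentiable_derivs[OF that])
    finally show ?thesis .
  qed
  have M: "(\<chi> i j. dir_deriv (axis j 1) (?f i) v) = mixed_hessian C (y, v)" if "(y, v) \<in> S" for v
    by (simp add: mixed_hessian_def D[OF that] commute2[OF that])
  obtain w \<alpha> where w: "\<And>t. t \<in> I \<Longrightarrow> (z has_vector_derivative w t) (at t within {0..1})"
    "\<And>t. t \<in> I \<Longrightarrow> (w has_vector_derivative \<alpha> t) (at t within {0..1})"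
    "\<And>t i. t \<in> I \<Longrightarrow> dir_deriv (w t) (dir_deriv (w t) (?f i)) (z t) + dir_deriv (\<alpha> t) (?f i) (z t) = 0"
  proof (rule implicit_curve[of ?U ?f I z a b])
    show "Ck_on 2 (?f i) ?U" for i by (rule Ck_on_slice(2)[OF open_S Ck2_derivs(2)])
    show "invertible (\<chi> i j. dir_deriv (axis j 1) (?f i) v)" if "v \<in> ?U" for v
      using invertible_mixed_hessian M that by simp
  qed (use open_slice[OF open_S] I z affine in auto)
  have "\<alpha> t = - right_christoffel C (y, z t) (w t) (w t)" if t: "t \<in> I" for t
  proof (rule mixed_form_cancel_right[OF z(2)[OF t]])
    fix i
    note zt = z(2)[OF t]
    have "dir_deriv (axis i 1, 0) (dir_deriv (0, \<alpha> t) C) (y, z t) = dir_deriv (\<alpha> t) (?f i) (z t)"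
      by (simp add: D[OF zt] commute2[OF zt])
    also have "\<dots> = - dir_deriv (w t) (dir_deriv (w t) (?f i)) (z t)" using w(3)[OF t, of i] by simp
    also have "\<dots> = - dir_deriv (axis i 1, 0) (dir_deriv (0, w t) (dir_deriv (0, w t) C)) (y, z t)"
      unfolding D2[OF zt] by (subst commute3_inner[OF zt], subst commute3_outer[OF zt]) simp
    also have "\<dots> = - dir_deriv (axis i 1, 0) (dir_deriv (0, right_christoffel C (y, z t) (w t) (w t)) C) (y, z t)"
      by (simp add: right_christoffel[OF zt])
    also have "\<dots> = dir_deriv (axis i 1, 0) (dir_deriv (0, - right_christoffel C (y, z t) (w t) (w t)) C) (y, z t)"
      using linear_neg[OF linear_right[OF linear_derivs(3)[OF zt]]] by simp
    finally show "dir_deriv (axis i 1, 0) (dir_deriv (0, \<alpha> t) C) (y, z t)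
      = dir_deriv (axis i 1, 0) (dir_deriv (0, - right_christoffel C (y, z t) (w t) (w t)) C) (y, z t)" .
  qed
  then show ?thesis using w that by metis
qed

lemma left_curve_ode:
  assumes I: "I \<subseteq> {0..1}" "\<And>t. t \<in> I \<Longrightarrow> \<forall>\<^sub>F s in at t within {0..1}. s \<in> I"
    and y: "\<And>t. t \<in> I \<Longrightarrow> continuous (at t within {0..1}) y" "\<And>t. t \<in> I \<Longrightarrow> (y t, z) \<in> S"
    and affine: "\<And>t i. t \<in> I \<Longrightarrow> dir_deriv (0, axis i 1) C (y t, z) = a i + t * b i"
  obtains w where "\<And>t. t \<in> I \<Longrightarrow> (y has_vector_derivative w t) (at t within {0..1})"
    "\<And>t. t \<in> I \<Longrightarrow> (w has_vector_derivative - left_christoffel C (y t, z) (w t) (w t)) (at t within {0..1})"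
proof -
  let ?f = "\<lambda>i u. dir_deriv (0, axis i 1) C (u, z)" and ?U = "{u. (u, z) \<in> S}"
  have D: "dir_deriv p (?f i) u = dir_deriv (p, 0) (dir_deriv (0, axis i 1) C) (u, z)" if "(u, z) \<in> S" for p i u
    by (rule dir_deriv_slice) (rule differentiable_derivs[OF that])
  have D2: "dir_deriv p' (dir_deriv p (?f i)) u = dir_deriv (p', 0) (dir_deriv (p, 0) (dir_deriv (0, axis i 1) C)) (u, z)"
    if "(u, z) \<in> S" for p p' i u
  proof -
    have "dir_deriv p' (dir_deriv p (?f i)) u
        = dir_deriv p' (\<lambda>u. dir_deriv (p, 0) (dir_deriv (0, axis i 1) C) (u, z)) u"
      by (rule dir_deriv_cong[OF open_slice(1)[OF open_S]]) (use that D in auto)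
    also have "\<dots> = dir_deriv (p', 0) (dir_deriv (p, 0) (dir_deriv (0, axis i 1) C)) (u, z)"
      by (rule dir_deriv_slice) (rule differentiable_derivs[OF that])
    finally show ?thesis .
  qed
  \<comment> \<open>Now the covector index belongs to the second factor and the differentiation to
    the first, so the Jacobian is the transpose.\<close>
  have M: "(\<chi> i j. dir_deriv (axis j 1) (?f i) u) = transpose (mixed_hessian C (u, z))" if "(u, z) \<in> S" for u
    by (simp add: mixed_hessian_def transpose_def D[OF that])
  obtain w \<alpha> where w: "\<And>t. t \<in> I \<Longrightarrow> (y has_vector_derivative w t) (at t within {0..1})"
    "\<And>t. t \<in> I \<Longrightarrow> (w has_vector_derivative \<alpha> t) (at t within {0..1})"
    "\<And>t i. t \<in> I \<Longrightarrow> dir_deriv (w t) (dir_deriv (w t) (?f i)) (y t) + dir_deriv (\<alpha> t) (?f i) (y t) = 0"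
  proof (rule implicit_curve[of ?U ?f I y a b])
    show "Ck_on 2 (?f i) ?U" for i by (rule Ck_on_slice(1)[OF open_S Ck2_derivs(2)])
    show "invertible (\<chi> i j. dir_deriv (axis j 1) (?f i) u)" if "u \<in> ?U" for u
      using transpose_invertible[OF invertible_mixed_hessian] M that by simp
  qed (use open_slice[OF open_S] I y affine in auto)
  have "\<alpha> t = - left_christoffel C (y t, z) (w t) (w t)" if t: "t \<in> I" for t
  proof (rule mixed_form_cancel_left[OF y(2)[OF t]])
    fix i
    note yt = y(2)[OF t]
    have "dir_deriv (\<alpha> t, 0) (dir_deriv (0, axis i 1) C) (y t, z) = dir_deriv (\<alpha> t) (?f i) (y t)"
      by (simp add: D[OF yt])
    also have "\<dots> = - dir_deriv (w t) (dir_deriv (w t) (?f i)) (y t)" using w(3)[OF t, of i] by simp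
    also have "\<dots> = - dir_deriv (left_christoffel C (y t, z) (w t) (w t), 0) (dir_deriv (0, axis i 1) C) (y t, z)"
      by (simp add: D2[OF yt] left_christoffel[OF yt])
    also have "\<dots> = dir_deriv (- left_christoffel C (y t, z) (w t) (w t), 0) (dir_deriv (0, axis i 1) C) (y t, z)"
      using linear_neg[OF linear_left[OF linear_derivs(2)[OF yt]]] by simp
    finally show "dir_deriv (\<alpha> t, 0) (dir_deriv (0, axis i 1) C) (y t, z)
      = dir_deriv (- left_christoffel C (y t, z) (w t) (w t), 0) (dir_deriv (0, axis i 1) C) (y t, z)" .
  qed
  then show ?thesis using w that by metis
qed

section \<open>Existence of curves with affine covector\<close>

lemma has_derivative_right_covector:
  assumes "(y, v) \<in> S"
  shows "((\<lambda>v. \<chi> i. dir_deriv (axis i 1, 0) C (y, v)) has_derivative (\<lambda>q. mixed_hessian C (y, v) *v q)) (at v)"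
proof -
  have "((\<lambda>v. dir_deriv (axis i 1, 0) C (y, v)) has_derivative (\<lambda>q. (mixed_hessian C (y, v) *v q) $ i)) (at v)" for i
    using has_derivative_dir_deriv[OF dir_deriv_slice(4)[OF differentiable_derivs(2)[OF assms]]]
      dir_deriv_slice(2)[OF differentiable_derivs(2)[OF assms]]
    by (simp add: mixed_hessian_nth[OF assms] commute2[OF assms, of "(axis i 1, 0)"])
  then show ?thesis
    by (subst has_derivative_componentwise_within) (auto simp: Basis_vec_def inner_axis)
qed

text \<open>A segment of covectors starting at that of \<open>z0\<close> is pulled back by the local
  inverse of the map from points to covectors. The derivative of this map at \<open>z0\<close> is
  the mixed Hessian, so a segment in the direction of its value at \<open>q\<close> starts with a
  multiple of \<open>q\<close>.\<close>

lemma right_curve_exists: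
  assumes yz: "(y, z0) \<in> S"
  obtains \<epsilon> z a b where "\<epsilon> > 0" "continuous_on {0..1} z" "z 0 = z0" "\<And>t. t \<in> {0..1} \<Longrightarrow> (y, z t) \<in> S"
    "\<And>t i. t \<in> {0..1} \<Longrightarrow> dir_deriv (axis i 1, 0) C (y, z t) = a i + t * b i"
    "(z has_vector_derivative \<epsilon> *\<^sub>R q) (at 0 within {0..1})"
proof -
  let ?U = "{v. (y, v) \<in> S}"
  define F where "F v = (\<chi> i. dir_deriv (axis i 1, 0) C (y, v))" for v
  let ?H = "\<lambda>v. mixed_hessian C (y, v)"
  have dF: "(F has_derivative (\<lambda>q. ?H v *v q)) (at v)" if "v \<in> ?U" for v
    unfolding F_def[abs_def] using has_derivative_right_covector that by simp
  have cont: "continuous_on ?U (\<lambda>v. ?H v *v q)" for q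
  proof -
    have "continuous_on ?U (\<lambda>v. (?H v *v q) $ i)" for i
    proof -
      have "continuous_on ?U (\<lambda>v. dir_deriv (axis i 1, 0) (dir_deriv (0, q) C) (y, v))"
        by (rule Ck_on_imp_continuous_on[OF Ck_on_slice(2)[OF open_S Ck_on_derivs(2)]])
      then show ?thesis by (rule continuous_on_eq) (simp add: mixed_hessian_nth)
    qed
    then have "continuous_on ?U (\<lambda>v. \<chi> i. (?H v *v q) $ i)" by (rule continuous_on_vec_lambda)
    then show ?thesis by simp
  qed
  have z0: "z0 \<in> ?U" using yz by simp
  have inv: "invertible (?H z0)" by (rule invertible_mixed_hessian[OF yz])
  obtain U' V g where UV: "open U'" "U' \<subseteq> ?U" "z0 \<in> U'" "open V" "F z0 \<in> V" "homeomorphism U' V F g"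
  proof (rule inverse_function_C1[OF open_slice(2)[OF open_S] z0 dF cont])
    show "q = 0" if "?H z0 *v q = 0" for q
      using invertible_matrix_vector_cancel[OF inv, of q 0] that by simp
  qed
  obtain r where r: "r > 0" "ball (F z0) r \<subseteq> V" using UV open_contains_ball by blast
  define e where "e = ?H z0 *v q"
  \<comment> \<open>The factor shortens the segment so that it stays, for all times in [0, 1], in a
    ball of covectors where the inverse is defined.\<close>
  define \<epsilon> where "\<epsilon> = r / (norm e + 1)"
  have pos: "norm e + 1 > 0" by (simp add: add_nonneg_pos)
  have \<epsilon>: "\<epsilon> > 0" using r pos by (simp add: \<epsilon>_def)
  have "\<epsilon> * norm e < \<epsilon> * (norm e + 1)" using \<epsilon> by (simp add: algebra_simps)
  then have \<epsilon>': "\<epsilon> * norm e < r" using pos by (simp add: \<epsilon>_def)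
  define L where "L t = F z0 + (t * \<epsilon>) *\<^sub>R e" for t
  define z where "z t = g (L t)" for t
  have LV: "L t \<in> V" if "t \<in> {0..1}" for t
  proof -
    have "norm ((t * \<epsilon>) *\<^sub>R e) = t * (\<epsilon> * norm e)" using that \<epsilon> by simp
    also have "\<dots> \<le> 1 * (\<epsilon> * norm e)" using that \<epsilon> by (intro mult_right_mono) auto
    also have "\<dots> < r" using \<epsilon>' by simp
    finally have "L t \<in> ball (F z0) r" by (simp add: L_def dist_norm)
    then show ?thesis using r by blast
  qed
  have zU: "z t \<in> U'" "F (z t) = L t" if "t \<in> {0..1}" for t
    using LV[OF that] UV(6) unfolding z_def homeomorphism_def by auto
  have contz: "continuous_on {0..1} z"
    unfolding z_def[abs_def]
    by (rule continuous_on_compose2[of V g]) (use UV(6) LV in \<open>auto simp: L_def homeomorphism_def intro!: continuous_intros\<close>)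
  have z0': "z 0 = z0" using UV by (simp add: z_def L_def homeomorphism_def)
  have "(z has_vector_derivative (matrix_inv (?H z0) *v (\<epsilon> *\<^sub>R e))) (at 0 within {0..1})"
  proof (rule has_vector_derivative_inverse_image[where G = "(*v) (matrix_inv (?H z0))" and F = F])
    show "continuous (at 0 within {0..1}) z" using contz by (simp add: continuous_on_eq_continuous_within)
    show "(F has_derivative (\<lambda>q. ?H z0 *v q)) (at (z 0))" using dF[OF z0] z0' by simp
    show "((\<lambda>s. F (z s)) has_vector_derivative \<epsilon> *\<^sub>R e) (at 0 within {0..1})"
    proof (rule has_vector_derivative_transform[where f = L])
      show "(L has_vector_derivative \<epsilon> *\<^sub>R e) (at 0 within {0..1})"
        unfolding L_def[abs_def] by (auto intro!: derivative_eq_intros simp: has_vector_derivative_def)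
    qed (use zU in auto)
    show "linear ((*v) (matrix_inv (?H z0)))" by (rule matrix_vector_mul_linear)
    show "matrix_inv (?H z0) *v (?H z0 *v v) = v" for v
      using matrix_inv_mult_vector[OF inv] invertible_matrix_vector_cancel[OF inv] by blast
  qed
  moreover have "matrix_inv (?H z0) *v (\<epsilon> *\<^sub>R e) = \<epsilon> *\<^sub>R q"
    using matrix_inv_mult_vector[OF inv, of e] invertible_matrix_vector_cancel[OF inv, of _ q]
    by (simp add: e_def matrix_vector_mult_scaleR)
  ultimately have vel: "(z has_vector_derivative \<epsilon> *\<^sub>R q) (at 0 within {0..1})" by simp
  have aff: "dir_deriv (axis i 1, 0) C (y, z t) = F z0 $ i + t * (\<epsilon> * e $ i)" if "t \<in> {0..1}" for t i
    using arg_cong[OF zU(2)[OF that], of "\<lambda>x. x $ i"] by (simp add: F_def L_def)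
  show ?thesis
    by (rule that[OF \<epsilon> contz z0' _ aff vel]) (use zU(1) UV(2) in auto)
qed

text \<open>The neighbourhoods must be uniform in the second component. Therefore the inverse
  function theorem is applied once to \<Psi>, which keeps that component as a parameter, and not to
  each slice separately.\<close>

lemma left_curves_exist:
  assumes yz: "(y0, z0) \<in> S"
  obtains Y Z where "open Y" "open Z" "y0 \<in> Y" "z0 \<in> Z"
    "\<And>y y' z. y \<in> Y \<Longrightarrow> y' \<in> Y \<Longrightarrow> z \<in> Z \<Longrightarrow> \<exists>u a b. continuous_on {0..1} u \<and> u 0 = y \<and> u 1 = y' \<and>
      (\<forall>t\<in>{0..1}. (u t, z) \<in> S \<and> (\<forall>i. dir_deriv (0, axis i 1) C (u t, z) = a i + t * (b i :: real)))"
proof -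
  define F where "F w = (\<chi> i. dir_deriv (0, axis i 1) C w)" for w
  define \<Psi> where "\<Psi> w = (F w, snd w)" for w
  define \<Psi>' where "\<Psi>' w v = ((\<chi> i. dir_deriv v (dir_deriv (0, axis i 1) C) w), snd v)" for w v
  have dF: "(F has_derivative (\<lambda>v. \<chi> i. dir_deriv v (dir_deriv (0, axis i 1) C) w)) (at w)" if "w \<in> S" for w
    using has_derivative_dir_deriv[OF differentiable_derivs(2)[OF that]]
    by (subst has_derivative_componentwise_within) (auto simp: Basis_vec_def inner_axis F_def)
  have d\<Psi>: "(\<Psi> has_derivative \<Psi>' w) (at w)" if "w \<in> S" for w
    unfolding \<Psi>_def[abs_def] \<Psi>'_def[abs_def]
    by (intro has_derivative_Pair dF[OF that] has_derivative_snd has_derivative_ident)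
  have cont: "continuous_on S (\<lambda>w. \<Psi>' w v)" for v
    unfolding \<Psi>'_def
    by (intro continuous_on_Pair continuous_on_vec_lambda continuous_on_const
        Ck_on_imp_continuous_on[OF Ck_on_derivs(2)])
  obtain U V g where UV: "open U" "U \<subseteq> S" "(y0, z0) \<in> U" "open V" "\<Psi> (y0, z0) \<in> V" "homeomorphism U V \<Psi> g"
  proof (rule inverse_function_C1[OF open_S yz d\<Psi> cont])
    fix v assume "\<Psi>' (y0, z0) v = 0"
    then have v: "snd v = 0" "\<And>i. dir_deriv v (dir_deriv (0, axis i 1) C) (y0, z0) = 0"
      by (auto simp: \<Psi>'_def zero_prod_def vec_eq_iff)
    have "v = (fst v, 0)" using v(1) by (simp add: prod_eq_iff)
    then have "dir_deriv (fst v, 0) (dir_deriv (0, axis i 1) C) (y0, z0) = 0" for i using v(2)[of i] by simp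
    moreover have "dir_deriv (0, 0) (dir_deriv (0, axis i 1) C) (y0, z0) = 0" for i
      using linear_0[OF linear_derivs(2)[OF yz]] by (simp add: zero_prod_def)
    ultimately have "fst v = 0" using mixed_form_cancel_left[OF yz, of "fst v" 0] by simp
    then show "v = 0" using v(1) by (simp add: prod_eq_iff)
  qed
  have "(F (y0, z0), z0) \<in> V" using UV(5) by (simp add: \<Psi>_def)
  then obtain V1 V2 where V12: "open V1" "open V2" "F (y0, z0) \<in> V1" "z0 \<in> V2" "V1 \<times> V2 \<subseteq> V"
    using open_prod_elim[OF UV(4)] by (metis mem_Sigma_iff)
  obtain r where r: "r > 0" "ball (F (y0, z0)) r \<subseteq> V1" using V12 open_contains_ball by blast
  \<comment> \<open>A ball is taken for its convexity: the segment between two of its covectors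
    remains where the inverse of \<Psi> is defined.\<close>
  let ?B = "ball (F (y0, z0)) r"
  have contF: "continuous_on S F" using dF has_derivative_continuous continuous_at_imp_continuous_on by blast
  have "open (U \<inter> F -` ?B)"
    using continuous_on_subset[OF contF UV(2)] UV(1) by (intro continuous_open_preimage) auto
  then have "open ((U \<inter> F -` ?B) \<inter> (UNIV \<times> V2))" by (rule open_Int) (intro open_Times open_UNIV V12)
  moreover have "(y0, z0) \<in> (U \<inter> F -` ?B) \<inter> (UNIV \<times> V2)" using UV V12 r by simp
  ultimately obtain Y Z where YZ: "open Y" "open Z" "y0 \<in> Y" "z0 \<in> Z" "Y \<times> Z \<subseteq> (U \<inter> F -` ?B) \<inter> (UNIV \<times> V2)"
    by (metis open_prod_elim mem_Sigma_iff)
  show ?thesis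
  proof (rule that[OF YZ(1-4)])
    fix y y' z assume y: "y \<in> Y" "y' \<in> Y" and z: "z \<in> Z"
    have mem: "(y, z) \<in> U" "(y', z) \<in> U" "F (y, z) \<in> ?B" "F (y', z) \<in> ?B" "z \<in> V2"
      using YZ(5) y z by auto
    define L where "L t = (1 - t) *\<^sub>R F (y, z) + t *\<^sub>R F (y', z)" for t
    define w where "w t = g (L t, z)" for t
    have LV: "(L t, z) \<in> V" if "t \<in> {0..1}" for t
    proof -
      have "L t \<in> ?B" unfolding L_def
        using convexD[OF convex_ball mem(3,4), of "1 - t" t] that by simp
      then show ?thesis using r V12 mem by auto
    qed
    have w: "w t \<in> U" "\<Psi> (w t) = (L t, z)" if "t \<in> {0..1}" for t
      using LV[OF that] UV(6) unfolding w_def homeomorphism_def by auto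
    have w': "w t = (fst (w t), z)" "F (fst (w t), z) = L t" if "t \<in> {0..1}" for t
      using w(2)[OF that] by (auto simp: \<Psi>_def prod_eq_iff)
    have "continuous_on {0..1} w"
      unfolding w_def[abs_def]
      by (rule continuous_on_compose2[of V g]) (use UV(6) LV in \<open>auto simp: L_def homeomorphism_def intro!: continuous_intros\<close>)
    then have "continuous_on {0..1} (\<lambda>t. fst (w t))" by (rule continuous_on_fst)
    moreover have "w 0 = (y, z)" "w 1 = (y', z)"
      using UV(6) mem by (auto simp: w_def L_def \<Psi>_def homeomorphism_def)
    moreover have "(fst (w t), z) \<in> S" if "t \<in> {0..1}" for t
      using w(1)[OF that] w'(1)[OF that] UV(2) by auto
    moreover have "dir_deriv (0, axis i 1) C (fst (w t), z) = F (y, z) $ i + t * (F (y', z) $ i - F (y, z) $ i)"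
      if "t \<in> {0..1}" for t i
      using arg_cong[OF w'(2)[OF that], of "\<lambda>x. x $ i"] by (simp add: F_def L_def algebra_simps)
    ultimately show "\<exists>u a b. continuous_on {0..1} u \<and> u 0 = y \<and> u 1 = y' \<and>
      (\<forall>t\<in>{0..1}. (u t, z) \<in> S \<and> (\<forall>i. dir_deriv (0, axis i 1) C (u t, z) = a i + t * (b i :: real)))"
      by (intro exI[of _ "\<lambda>t. fst (w t)"] exI[of _ "\<lambda>i. F (y, z) $ i"]
          exI[of _ "\<lambda>i. F (y', z) $ i - F (y, z) $ i"]) auto
  qed
qed

end

section \<open>Charts\<close>

lemma is_chart_cinv: "is_chart \<kappa> \<Longrightarrow> x \<in> cdom \<kappa> \<Longrightarrow> cinv \<kappa> (cmap \<kappa> x) = x"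
  by (simp add: is_chart_def homeomorphism_def)

lemma is_chart_cmap_cinv:
  "is_chart \<kappa> \<Longrightarrow> u \<in> cmap \<kappa> ` cdom \<kappa> \<Longrightarrow> cmap \<kappa> (cinv \<kappa> u) = u"
  "is_chart \<kappa> \<Longrightarrow> u \<in> cmap \<kappa> ` cdom \<kappa> \<Longrightarrow> cinv \<kappa> u \<in> cdom \<kappa>"
  by (auto simp: is_chart_def homeomorphism_def)

lemma is_chart_continuous:
  fixes \<kappa> :: "('m::t2_space, 'n::finite) chart"
  assumes "is_chart \<kappa>"
  shows "continuous_on (cdom \<kappa>) (cmap \<kappa>)" "continuous_on (cmap \<kappa> ` cdom \<kappa>) (cinv \<kappa>)"
    "x \<in> cdom \<kappa> \<Longrightarrow> isCont (cmap \<kappa>) x" "u \<in> cmap \<kappa> ` cdom \<kappa> \<Longrightarrow> isCont (cinv \<kappa>) u"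
    "open (cdom \<kappa>)" "open (cmap \<kappa> ` cdom \<kappa>)"
  using assms unfolding is_chart_def homeomorphism_def
  by (auto simp: continuous_on_eq_continuous_at)

lemma is_chart_open_image:
  fixes \<kappa> :: "('m::t2_space, 'n::finite) chart"
  assumes "is_chart \<kappa>" "open V"
  shows "open (cmap \<kappa> ` (cdom \<kappa> \<inter> V))"
proof -
  have "cmap \<kappa> ` (cdom \<kappa> \<inter> V) = cmap \<kappa> ` cdom \<kappa> \<inter> cinv \<kappa> -` V"
    using is_chart_cinv[OF assms(1)] by fastforce
  then show ?thesis
    using continuous_open_preimage[OF is_chart_continuous(2)[OF assms(1)]] is_chart_continuous(6)[OF assms(1)] assms(2)
    by metis
qed

text \<open>The new direction does not involve \<open>f\<close>. For the family of functions
  \<open>c (\<cdot>, xb t)\<close> the change of chart is therefore independent of \<open>t\<close>,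
  and a covector affine in \<open>t\<close> in one chart is affine in all.\<close>

lemma chart_change:
  fixes A :: "('m::t2_space, 'n::finite) chart set"
  assumes atlas: "smooth_atlas A" "\<kappa> \<in> A" "\<kappa>' \<in> A" and x: "x \<in> cdom \<kappa>" "x \<in> cdom \<kappa>'"
    and f: "(\<lambda>u. f (cinv \<kappa> u) :: real) differentiable (at (cmap \<kappa> x))"
  shows "dir_deriv p (\<lambda>u. f (cinv \<kappa>' u)) (cmap \<kappa>' x)
    = dir_deriv (dir_deriv p (cmap \<kappa> \<circ> cinv \<kappa>') (cmap \<kappa>' x)) (\<lambda>u. f (cinv \<kappa> u)) (cmap \<kappa> x)"
proof -
  have charts: "is_chart \<kappa>" "is_chart \<kappa>'" using atlas unfolding smooth_atlas_def by blast+
  let ?O = "cmap \<kappa>' ` (cdom \<kappa>' \<inter> cdom \<kappa>)" and ?\<tau> = "cmap \<kappa> \<circ> cinv \<kappa>'"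
  have O: "open ?O" "cmap \<kappa>' x \<in> ?O"
    using is_chart_open_image[OF charts(2) is_chart_continuous(5)[OF charts(1)]] x by auto
  have "smooth_on ?\<tau> ?O" using atlas by (simp add: smooth_atlas_def)
  then have "Ck_on 1 ?\<tau> ?O" by (simp only: smooth_on_def)
  then have d\<tau>: "?\<tau> differentiable (at (cmap \<kappa>' x))" using Ck_on_differentiable[OF _ zero_less_one O(2)] by blast
  have \<tau>x: "?\<tau> (cmap \<kappa>' x) = cmap \<kappa> x" using is_chart_cinv[OF charts(2) x(2)] by simp
  have "((\<lambda>u. f (cinv \<kappa> (?\<tau> u))) has_derivative
      (\<lambda>p. dir_deriv (dir_deriv p ?\<tau> (cmap \<kappa>' x)) (\<lambda>u. f (cinv \<kappa> u)) (cmap \<kappa> x))) (at (cmap \<kappa>' x))"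
    by (rule has_derivative_compose[where g = "\<lambda>u. f (cinv \<kappa> u)", OF has_derivative_dir_deriv[OF d\<tau>]])
       (use has_derivative_dir_deriv[OF f] \<tau>x in simp)
  moreover have "f (cinv \<kappa> (?\<tau> u)) = f (cinv \<kappa>' u)" if "u \<in> ?O" for u
    using that is_chart_cinv[OF charts(1)] is_chart_cinv[OF charts(2)] by auto
  ultimately have "((\<lambda>u. f (cinv \<kappa>' u)) has_derivative
      (\<lambda>p. dir_deriv (dir_deriv p ?\<tau> (cmap \<kappa>' x)) (\<lambda>u. f (cinv \<kappa> u)) (cmap \<kappa> x))) (at (cmap \<kappa>' x))"
    by (rule has_derivative_transform_within_open[OF _ O])
  then show ?thesis by (rule dir_deriv_eq)
qed

lemma h_geodesic_chart:
  assumes "h_geodesic A B N c \<gamma>" "\<kappa> \<in> A" "\<mu> \<in> B"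
  obtains w where "\<forall>t\<in>{0..1}. \<gamma> t \<in> cdom \<kappa> \<times> cdom \<mu> \<longrightarrow>
      ((\<lambda>s. pair_coords \<kappa> \<mu> (\<gamma> s)) has_vector_derivative w t) (at t within {0..1}) \<and>
      (w has_vector_derivative - christoffel (cost_metric (coord_cost c \<kappa> \<mu>))
        (pair_coords \<kappa> \<mu> (\<gamma> t)) (w t) (w t)) (at t within {0..1})"
  using assms(1)[unfolded h_geodesic_def, THEN conjunct2, THEN conjunct2, rule_format, OF assms(2,3)]
  by (elim exE)

text \<open>Curves are functions on the whole real line. A geodesic witnessing illumination has
  constant second component on [0, 1] only, and is replaced by one of explicit product form.\<close>

lemma h_geodesic_cong:
  assumes "h_geodesic A B N c \<gamma>" "\<And>t. t \<in> {0..1} \<Longrightarrow> \<gamma> t = \<gamma>' t"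
  shows "h_geodesic A B N c \<gamma>'"
  unfolding h_geodesic_def
proof (intro conjI ballI)
  show "continuous_on {0..1} \<gamma>'"
    using assms continuous_on_cong[of "{0..1}" "{0..1}" \<gamma> \<gamma>'] by (simp add: h_geodesic_def)
  show "\<gamma>' ` {0..1} \<subseteq> N" using assms by (auto simp: h_geodesic_def)
  fix \<kappa> \<mu> assume \<kappa>\<mu>: "\<kappa> \<in> A" "\<mu> \<in> B"
  obtain w where w: "\<forall>t\<in>{0..1}. \<gamma> t \<in> cdom \<kappa> \<times> cdom \<mu> \<longrightarrow>
      ((\<lambda>s. pair_coords \<kappa> \<mu> (\<gamma> s)) has_vector_derivative w t) (at t within {0..1}) \<and>
      (w has_vector_derivative - christoffel (cost_metric (coord_cost c \<kappa> \<mu>))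
        (pair_coords \<kappa> \<mu> (\<gamma> t)) (w t) (w t)) (at t within {0..1})"
    by (rule h_geodesic_chart[OF assms(1) \<kappa>\<mu>])
  show "\<exists>w. \<forall>t\<in>{0..1}. \<gamma>' t \<in> cdom \<kappa> \<times> cdom \<mu> \<longrightarrow>
      ((\<lambda>s. pair_coords \<kappa> \<mu> (\<gamma>' s)) has_vector_derivative w t) (at t within {0..1}) \<and>
      (w has_vector_derivative - christoffel (cost_metric (coord_cost c \<kappa> \<mu>))
        (pair_coords \<kappa> \<mu> (\<gamma>' t)) (w t) (w t)) (at t within {0..1})"
  proof (intro exI[of _ w] ballI impI)
    fix t :: real assume t: "t \<in> {0..1}" "\<gamma>' t \<in> cdom \<kappa> \<times> cdom \<mu>"
    have "((\<lambda>s. pair_coords \<kappa> \<mu> (\<gamma>' s)) has_vector_derivative w t) (at t within {0..1})"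
      by (rule has_vector_derivative_transform[OF t(1), where f = "\<lambda>s. pair_coords \<kappa> \<mu> (\<gamma> s)"])
         (use assms(2) w t in auto)
    then show "((\<lambda>s. pair_coords \<kappa> \<mu> (\<gamma>' s)) has_vector_derivative w t) (at t within {0..1}) \<and>
      (w has_vector_derivative - christoffel (cost_metric (coord_cost c \<kappa> \<mu>))
        (pair_coords \<kappa> \<mu> (\<gamma>' t)) (w t) (w t)) (at t within {0..1})"
      using bspec[OF w t(1)] t assms(2)[OF t(1)] by simp
  qed
qed

locale nondegenerate_manifold_cost =
  fixes A :: "('m::{t2_space, second_countable_topology}, 'n::finite) chart set"
    and B :: "('k::{t2_space, second_countable_topology}, 'n) chart set"
    and N :: "('m \<times> 'k) set"
    and c :: "'m \<times> 'k \<Rightarrow> real"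
  assumes smooth_A: "smooth_atlas A" and smooth_B: "smooth_atlas B"
    and open_N: "open N"
    and C4: "Ck_cost 4 A B N c"
    and nondegenerate: "nondegenerate_cost A B N c"
begin

lemma is_chart_A: "\<kappa> \<in> A \<Longrightarrow> is_chart \<kappa>"
  and is_chart_B: "\<mu> \<in> B \<Longrightarrow> is_chart \<mu>"
  using smooth_A smooth_B by (simp_all add: smooth_atlas_def)

lemma chart_A_exists: obtains \<kappa> where "\<kappa> \<in> A" "x \<in> cdom \<kappa>"
  using smooth_A unfolding smooth_atlas_def by blast

lemma chart_B_exists: obtains \<mu> where "\<mu> \<in> B" "xb \<in> cdom \<mu>"
  using smooth_B unfolding smooth_atlas_def by blast

definition coord_domain :: "('m, 'n) chart \<Rightarrow> ('k, 'n) chart \<Rightarrow> ((real^'n) \<times> (real^'n)) set" where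
  "coord_domain \<kappa> \<mu> = pair_coords \<kappa> \<mu> ` (N \<inter> cdom \<kappa> \<times> cdom \<mu>)"

lemma coord_domainI:
  "(x, xb) \<in> N \<Longrightarrow> x \<in> cdom \<kappa> \<Longrightarrow> xb \<in> cdom \<mu> \<Longrightarrow> (cmap \<kappa> x, cmap \<mu> xb) \<in> coord_domain \<kappa> \<mu>"
  unfolding coord_domain_def pair_coords_def by force

lemma coord_domain_iff:
  assumes "\<kappa> \<in> A" "\<mu> \<in> B"
  shows "(u, v) \<in> coord_domain \<kappa> \<mu>
    \<longleftrightarrow> u \<in> cmap \<kappa> ` cdom \<kappa> \<and> v \<in> cmap \<mu> ` cdom \<mu> \<and> (cinv \<kappa> u, cinv \<mu> v) \<in> N"
proof
  assume "(u, v) \<in> coord_domain \<kappa> \<mu>"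
  then show "u \<in> cmap \<kappa> ` cdom \<kappa> \<and> v \<in> cmap \<mu> ` cdom \<mu> \<and> (cinv \<kappa> u, cinv \<mu> v) \<in> N"
    using is_chart_cinv[OF is_chart_A[OF assms(1)]] is_chart_cinv[OF is_chart_B[OF assms(2)]]
    by (auto simp: coord_domain_def pair_coords_def)
next
  assume R: "u \<in> cmap \<kappa> ` cdom \<kappa> \<and> v \<in> cmap \<mu> ` cdom \<mu> \<and> (cinv \<kappa> u, cinv \<mu> v) \<in> N"
  then have "(cmap \<kappa> (cinv \<kappa> u), cmap \<mu> (cinv \<mu> v)) \<in> coord_domain \<kappa> \<mu>"
    using is_chart_cmap_cinv(2)[OF is_chart_A[OF assms(1)]] is_chart_cmap_cinv(2)[OF is_chart_B[OF assms(2)]]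
    by (intro coord_domainI) auto
  then show "(u, v) \<in> coord_domain \<kappa> \<mu>"
    using R is_chart_cmap_cinv(1)[OF is_chart_A[OF assms(1)]] is_chart_cmap_cinv(1)[OF is_chart_B[OF assms(2)]]
    by simp
qed

lemma open_coord_domain:
  assumes "\<kappa> \<in> A" "\<mu> \<in> B"
  shows "open (coord_domain \<kappa> \<mu>)"
proof -
  let ?D = "cmap \<kappa> ` cdom \<kappa> \<times> cmap \<mu> ` cdom \<mu>"
  note \<kappa> = is_chart_continuous[OF is_chart_A[OF assms(1)]] and \<mu> = is_chart_continuous[OF is_chart_B[OF assms(2)]]
  have "continuous_on ?D (\<lambda>w. (cinv \<kappa> (fst w), cinv \<mu> (snd w)))"
    by (intro continuous_on_Pair continuous_on_compose2[OF \<kappa>(2)] continuous_on_compose2[OF \<mu>(2)] continuous_intros) auto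
  then have "open (?D \<inter> (\<lambda>w. (cinv \<kappa> (fst w), cinv \<mu> (snd w))) -` N)"
    by (rule continuous_open_preimage) (intro open_Times \<kappa> \<mu> open_N)+
  also have "?D \<inter> (\<lambda>w. (cinv \<kappa> (fst w), cinv \<mu> (snd w))) -` N = coord_domain \<kappa> \<mu>"
    using coord_domain_iff[OF assms] by auto
  finally show ?thesis .
qed

lemma coord_cost_nondegenerate:
  assumes "\<kappa> \<in> A" "\<mu> \<in> B"
  shows "nondegenerate_coord_cost (coord_cost c \<kappa> \<mu>) (coord_domain \<kappa> \<mu>)"
proof
  show "open (coord_domain \<kappa> \<mu>)" by (rule open_coord_domain[OF assms])
  show "Ck_on 4 (coord_cost c \<kappa> \<mu>) (coord_domain \<kappa> \<mu>)"
    using C4 assms by (simp add: Ck_cost_def coord_domain_def)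
  show "invertible (mixed_hessian (coord_cost c \<kappa> \<mu>) z)" if "z \<in> coord_domain \<kappa> \<mu>" for z
    using nondegenerate assms that by (auto simp: nondegenerate_cost_def coord_domain_def)
qed

lemma coord_cost_left: "\<mu> \<in> B \<Longrightarrow> xb \<in> cdom \<mu> \<Longrightarrow> coord_cost c \<kappa> \<mu> (u, cmap \<mu> xb) = c (cinv \<kappa> u, xb)"
  using is_chart_cinv[OF is_chart_B] by (simp add: coord_cost_def)

lemma coord_cost_right: "\<kappa> \<in> A \<Longrightarrow> x \<in> cdom \<kappa> \<Longrightarrow> coord_cost c \<kappa> \<mu> (cmap \<kappa> x, v) = c (x, cinv \<mu> v)"
  using is_chart_cinv[OF is_chart_A] by (simp add: coord_cost_def)

section \<open>From affine covectors to geodesics on the manifolds\<close>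

lemma dir_deriv_coord_cost:
  assumes "\<kappa> \<in> A" "\<mu> \<in> B" "(x, xb) \<in> N" "x \<in> cdom \<kappa>" "xb \<in> cdom \<mu>"
  shows "dir_deriv (p, 0) (coord_cost c \<kappa> \<mu>) (cmap \<kappa> x, cmap \<mu> xb) = dir_deriv p (\<lambda>u. c (cinv \<kappa> u, xb)) (cmap \<kappa> x)"
    "dir_deriv (0, q) (coord_cost c \<kappa> \<mu>) (cmap \<kappa> x, cmap \<mu> xb) = dir_deriv q (\<lambda>v. c (x, cinv \<mu> v)) (cmap \<mu> xb)"
    "(\<lambda>u. c (cinv \<kappa> u, xb)) differentiable (at (cmap \<kappa> x))"
    "(\<lambda>v. c (x, cinv \<mu> v)) differentiable (at (cmap \<mu> xb))"
proof -
  interpret G: nondegenerate_coord_cost "coord_cost c \<kappa> \<mu>" "coord_domain \<kappa> \<mu>"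
    by (rule coord_cost_nondegenerate[OF assms(1,2)])
  note d = dir_deriv_slice[OF G.differentiable_derivs(1)[OF coord_domainI[OF assms(3-5)]]]
  have 1: "(\<lambda>u. coord_cost c \<kappa> \<mu> (u, cmap \<mu> xb)) = (\<lambda>u. c (cinv \<kappa> u, xb))"
    and 2: "(\<lambda>v. coord_cost c \<kappa> \<mu> (cmap \<kappa> x, v)) = (\<lambda>v. c (x, cinv \<mu> v))"
    using coord_cost_left coord_cost_right assms by auto
  show "dir_deriv (p, 0) (coord_cost c \<kappa> \<mu>) (cmap \<kappa> x, cmap \<mu> xb) = dir_deriv p (\<lambda>u. c (cinv \<kappa> u, xb)) (cmap \<kappa> x)"
    "dir_deriv (0, q) (coord_cost c \<kappa> \<mu>) (cmap \<kappa> x, cmap \<mu> xb) = dir_deriv q (\<lambda>v. c (x, cinv \<mu> v)) (cmap \<mu> xb)"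
    "(\<lambda>u. c (cinv \<kappa> u, xb)) differentiable (at (cmap \<kappa> x))"
    "(\<lambda>v. c (x, cinv \<mu> v)) differentiable (at (cmap \<mu> xb))"
    using d unfolding 1 2 by simp_all
qed

text \<open>In one chart a curve in the second factor along which the covector \<open>D c(x, \<cdot>)\<close> is affine is
  a geodesic; this covector transforms linearly, so the same holds in all charts.\<close>

lemma right_geodesicI:
  assumes \<kappa>: "\<kappa> \<in> A" "x \<in> cdom \<kappa>" and cont: "continuous_on {0..1} xb"
    and N: "\<And>t. t \<in> {0..1} \<Longrightarrow> (x, xb t) \<in> N"
    and affine: "\<And>p. \<exists>a b. \<forall>t\<in>{0..1}. dir_deriv p (\<lambda>u. c (cinv \<kappa> u, xb t)) (cmap \<kappa> x) = a + t * b"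
  shows "h_geodesic A B N c (\<lambda>t. (x, xb t))"
  unfolding h_geodesic_def
proof (intro conjI ballI)
  show "continuous_on {0..1} (\<lambda>t. (x, xb t))" by (intro continuous_intros cont)
  show "(\<lambda>t. (x, xb t)) ` {0..1} \<subseteq> N" using N by auto
  fix \<kappa>' \<mu> assume \<kappa>': "\<kappa>' \<in> A" and \<mu>: "\<mu> \<in> B"
  let ?P = "\<lambda>w. \<forall>t\<in>{0..1}. (x, xb t) \<in> cdom \<kappa>' \<times> cdom \<mu> \<longrightarrow>
     ((\<lambda>s. pair_coords \<kappa>' \<mu> (x, xb s)) has_vector_derivative w t) (at t within {0..1}) \<and>
     (w has_vector_derivative - christoffel (cost_metric (coord_cost c \<kappa>' \<mu>))
        (pair_coords \<kappa>' \<mu> (x, xb t)) (w t) (w t)) (at t within {0..1})"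
  show "\<exists>w. ?P w"
  proof (cases "x \<in> cdom \<kappa>'")
    case x: True
    interpret G: nondegenerate_coord_cost "coord_cost c \<kappa>' \<mu>" "coord_domain \<kappa>' \<mu>"
      by (rule coord_cost_nondegenerate[OF \<kappa>' \<mu>])
    \<comment> \<open>The chart sees the curve only at these times. They form a relatively open set,
      possibly disconnected, on which all coordinate statements are made.\<close>
    define I where "I = {t \<in> {0..1}. xb t \<in> cdom \<mu>}"
    have I01: "I \<subseteq> {0..1}" by (auto simp: I_def)
    define z where "z t = cmap \<mu> (xb t)" for t
    note ch\<mu> = is_chart_continuous[OF is_chart_B[OF \<mu>]]
    have S: "(cmap \<kappa>' x, z t) \<in> coord_domain \<kappa>' \<mu>" if "t \<in> I" for t
      using that N x by (auto simp: I_def z_def intro: coord_domainI)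
    have "\<exists>a b. \<forall>t\<in>I. dir_deriv (axis i 1, 0) (coord_cost c \<kappa>' \<mu>) (cmap \<kappa>' x, z t) = a + t * b" for i
    proof -
      have "dir_deriv (axis i 1, 0) (coord_cost c \<kappa>' \<mu>) (cmap \<kappa>' x, z t)
          = dir_deriv (dir_deriv (axis i 1) (cmap \<kappa> \<circ> cinv \<kappa>') (cmap \<kappa>' x)) (\<lambda>u. c (cinv \<kappa> u, xb t)) (cmap \<kappa> x)"
        if t: "t \<in> I" for t
      proof -
        have t': "(x, xb t) \<in> N" "xb t \<in> cdom \<mu>" using t N by (auto simp: I_def)
        show ?thesis
          unfolding z_def dir_deriv_coord_cost(1)[OF \<kappa>' \<mu> t'(1) x t'(2)]
          by (rule chart_change[OF smooth_A \<kappa>(1) \<kappa>' \<kappa>(2) x dir_deriv_coord_cost(3)[OF \<kappa>(1) \<mu> t'(1) \<kappa>(2) t'(2)]])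
      qed
      then show ?thesis using affine by (fastforce simp: I_def)
    qed
    then obtain a b where ab: "\<And>i t. t \<in> I \<Longrightarrow>
        dir_deriv (axis i 1, 0) (coord_cost c \<kappa>' \<mu>) (cmap \<kappa>' x, z t) = a i + t * b i"
      by metis
    have ev: "\<forall>\<^sub>F s in at t within {0..1}. s \<in> I" if "t \<in> I" for t
      using that eventually_in_chart[OF cont _ ch\<mu>(5), of t] by (simp add: I_def)
    have contz: "continuous (at t within {0..1}) z" if "t \<in> I" for t
      unfolding z_def[abs_def]
      by (rule continuous_within_compose3)
         (use that ch\<mu>(3) cont in \<open>auto simp: I_def continuous_on_eq_continuous_within\<close>)
    obtain w where w: "\<And>t. t \<in> I \<Longrightarrow> (z has_vector_derivative w t) (at t within {0..1})"
      "\<And>t. t \<in> I \<Longrightarrow> (w has_vector_derivative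
        - right_christoffel (coord_cost c \<kappa>' \<mu>) (cmap \<kappa>' x, z t) (w t) (w t)) (at t within {0..1})"
      using G.right_curve_ode[OF I01 ev contz S ab] by blast
    have "?P (\<lambda>t. (0, w t))"
    proof (intro ballI impI)
      fix t assume "t \<in> {0..1}" "(x, xb t) \<in> cdom \<kappa>' \<times> cdom \<mu>"
      then have t: "t \<in> I" by (simp add: I_def)
      have "christoffel (cost_metric (coord_cost c \<kappa>' \<mu>)) (cmap \<kappa>' x, z t) (0, w t) (0, w t)
          = (0, right_christoffel (coord_cost c \<kappa>' \<mu>) (cmap \<kappa>' x, z t) (w t) (w t))"
        using linear_0[OF G.linear_left_christoffel(1)[OF S[OF t]]] by (simp add: G.christoffel_eq[OF S[OF t]])
      then show "((\<lambda>s. pair_coords \<kappa>' \<mu> (x, xb s)) has_vector_derivative (0, w t)) (at t within {0..1}) \<and>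
        ((\<lambda>t. (0, w t)) has_vector_derivative - christoffel (cost_metric (coord_cost c \<kappa>' \<mu>))
        (pair_coords \<kappa>' \<mu> (x, xb t)) (0, w t) (0, w t)) (at t within {0..1})"
        using has_vector_derivative_Pair[OF has_vector_derivative_const w(1)[OF t], of "cmap \<kappa>' x"] has_vector_derivative_Pair[OF has_vector_derivative_const w(2)[OF t], of 0]
        by (simp add: pair_coords_def z_def)
    qed
    then show ?thesis by (rule exI[where x = "\<lambda>t. (0, w t)"])
  qed auto
qed

lemma left_geodesicI:
  assumes \<mu>: "\<mu> \<in> B" "xb \<in> cdom \<mu>" and cont: "continuous_on {0..1} x"
    and N: "\<And>t. t \<in> {0..1} \<Longrightarrow> (x t, xb) \<in> N"
    and affine: "\<And>q. \<exists>a b. \<forall>t\<in>{0..1}. dir_deriv q (\<lambda>v. c (x t, cinv \<mu> v)) (cmap \<mu> xb) = a + t * b"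
  shows "h_geodesic A B N c (\<lambda>t. (x t, xb))"
  unfolding h_geodesic_def
proof (intro conjI ballI)
  show "continuous_on {0..1} (\<lambda>t. (x t, xb))" by (intro continuous_intros cont)
  show "(\<lambda>t. (x t, xb)) ` {0..1} \<subseteq> N" using N by auto
  fix \<kappa> \<mu>' assume \<kappa>: "\<kappa> \<in> A" and \<mu>': "\<mu>' \<in> B"
  let ?P = "\<lambda>w. \<forall>t\<in>{0..1}. (x t, xb) \<in> cdom \<kappa> \<times> cdom \<mu>' \<longrightarrow>
     ((\<lambda>s. pair_coords \<kappa> \<mu>' (x s, xb)) has_vector_derivative w t) (at t within {0..1}) \<and>
     (w has_vector_derivative - christoffel (cost_metric (coord_cost c \<kappa> \<mu>'))
        (pair_coords \<kappa> \<mu>' (x t, xb)) (w t) (w t)) (at t within {0..1})"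
  show "\<exists>w. ?P w"
  proof (cases "xb \<in> cdom \<mu>'")
    case xb: True
    interpret G: nondegenerate_coord_cost "coord_cost c \<kappa> \<mu>'" "coord_domain \<kappa> \<mu>'"
      by (rule coord_cost_nondegenerate[OF \<kappa> \<mu>'])
    define I where "I = {t \<in> {0..1}. x t \<in> cdom \<kappa>}"
    have I01: "I \<subseteq> {0..1}" by (auto simp: I_def)
    define y where "y t = cmap \<kappa> (x t)" for t
    note ch\<kappa> = is_chart_continuous[OF is_chart_A[OF \<kappa>]]
    have S: "(y t, cmap \<mu>' xb) \<in> coord_domain \<kappa> \<mu>'" if "t \<in> I" for t
      using that N xb by (auto simp: I_def y_def intro: coord_domainI)
    have "\<exists>a b. \<forall>t\<in>I. dir_deriv (0, axis i 1) (coord_cost c \<kappa> \<mu>') (y t, cmap \<mu>' xb) = a + t * b" for i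
    proof -
      have "dir_deriv (0, axis i 1) (coord_cost c \<kappa> \<mu>') (y t, cmap \<mu>' xb)
          = dir_deriv (dir_deriv (axis i 1) (cmap \<mu> \<circ> cinv \<mu>') (cmap \<mu>' xb)) (\<lambda>v. c (x t, cinv \<mu> v)) (cmap \<mu> xb)"
        if t: "t \<in> I" for t
      proof -
        have t': "(x t, xb) \<in> N" "x t \<in> cdom \<kappa>" using t N by (auto simp: I_def)
        show ?thesis
          unfolding y_def dir_deriv_coord_cost(2)[OF \<kappa> \<mu>' t' xb]
          by (rule chart_change[OF smooth_B \<mu>(1) \<mu>' \<mu>(2) xb dir_deriv_coord_cost(4)[OF \<kappa> \<mu>(1) t' \<mu>(2)]])
      qed
      then show ?thesis using affine by (fastforce simp: I_def)
    qed
    then obtain a b where ab: "\<And>i t. t \<in> I \<Longrightarrow>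
        dir_deriv (0, axis i 1) (coord_cost c \<kappa> \<mu>') (y t, cmap \<mu>' xb) = a i + t * b i"
      by metis
    have ev: "\<forall>\<^sub>F s in at t within {0..1}. s \<in> I" if "t \<in> I" for t
      using that eventually_in_chart[OF cont _ ch\<kappa>(5), of t] by (simp add: I_def)
    have conty: "continuous (at t within {0..1}) y" if "t \<in> I" for t
      unfolding y_def[abs_def]
      by (rule continuous_within_compose3)
         (use that ch\<kappa>(3) cont in \<open>auto simp: I_def continuous_on_eq_continuous_within\<close>)
    obtain w where w: "\<And>t. t \<in> I \<Longrightarrow> (y has_vector_derivative w t) (at t within {0..1})"
      "\<And>t. t \<in> I \<Longrightarrow> (w has_vector_derivative
        - left_christoffel (coord_cost c \<kappa> \<mu>') (y t, cmap \<mu>' xb) (w t) (w t)) (at t within {0..1})"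
      using G.left_curve_ode[OF I01 ev conty S ab] by blast
    have "?P (\<lambda>t. (w t, 0))"
    proof (intro ballI impI)
      fix t assume "t \<in> {0..1}" "(x t, xb) \<in> cdom \<kappa> \<times> cdom \<mu>'"
      then have t: "t \<in> I" by (simp add: I_def)
      have "christoffel (cost_metric (coord_cost c \<kappa> \<mu>')) (y t, cmap \<mu>' xb) (w t, 0) (w t, 0)
          = (left_christoffel (coord_cost c \<kappa> \<mu>') (y t, cmap \<mu>' xb) (w t) (w t), 0)"
        using linear_0[OF G.linear_right_christoffel(1)[OF S[OF t]]] by (simp add: G.christoffel_eq[OF S[OF t]])
      then show "((\<lambda>s. pair_coords \<kappa> \<mu>' (x s, xb)) has_vector_derivative (w t, 0)) (at t within {0..1}) \<and>
        ((\<lambda>t. (w t, 0)) has_vector_derivative - christoffel (cost_metric (coord_cost c \<kappa> \<mu>'))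
        (pair_coords \<kappa> \<mu>' (x t, xb)) (w t, 0) (w t, 0)) (at t within {0..1})"
        using has_vector_derivative_Pair[OF w(1)[OF t] has_vector_derivative_const, of "cmap \<mu>' xb"] has_vector_derivative_Pair[OF w(2)[OF t] has_vector_derivative_const, of 0]
        by (simp add: pair_coords_def y_def)
    qed
    then show ?thesis by (rule exI[where x = "\<lambda>t. (w t, 0)"])
  qed auto
qed

lemma right_geodesic_exists:
  assumes \<kappa>: "\<kappa> \<in> A" "x \<in> cdom \<kappa>" and \<mu>: "\<mu> \<in> B" "xb \<in> cdom \<mu>" and N: "(x, xb) \<in> N"
  obtains \<epsilon> \<gamma> where "\<epsilon> > 0" "h_geodesic A B N c (\<lambda>t. (x, \<gamma> t))" "\<gamma> 0 = xb"
    "((\<lambda>t. cmap \<mu> (\<gamma> t)) has_vector_derivative \<epsilon> *\<^sub>R q) (at 0 within {0..1})"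
proof -
  interpret G: nondegenerate_coord_cost "coord_cost c \<kappa> \<mu>" "coord_domain \<kappa> \<mu>"
    by (rule coord_cost_nondegenerate[OF \<kappa>(1) \<mu>(1)])
  obtain \<epsilon> z a b where z: "\<epsilon> > 0" "continuous_on {0..1} z" "z 0 = cmap \<mu> xb"
    "\<And>t. t \<in> {0..1} \<Longrightarrow> (cmap \<kappa> x, z t) \<in> coord_domain \<kappa> \<mu>"
    "\<And>t i. t \<in> {0..1} \<Longrightarrow> dir_deriv (axis i 1, 0) (coord_cost c \<kappa> \<mu>) (cmap \<kappa> x, z t) = a i + t * b i"
    "(z has_vector_derivative \<epsilon> *\<^sub>R q) (at 0 within {0..1})"
    using G.right_curve_exists[OF coord_domainI[OF N \<kappa>(2) \<mu>(2)], where q = q] by blast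
  note ch\<mu> = is_chart_cmap_cinv[OF is_chart_B[OF \<mu>(1)]]
  have zt: "z t \<in> cmap \<mu> ` cdom \<mu>" "(x, cinv \<mu> (z t)) \<in> N" if "t \<in> {0..1}" for t
    using z(4)[OF that] coord_domain_iff[OF \<kappa>(1) \<mu>(1)] is_chart_cinv[OF is_chart_A[OF \<kappa>(1)] \<kappa>(2)] by auto
  have "h_geodesic A B N c (\<lambda>t. (x, cinv \<mu> (z t)))"
  proof (rule right_geodesicI[OF \<kappa>])
    show "continuous_on {0..1} (\<lambda>t. cinv \<mu> (z t))"
      by (rule continuous_on_compose2[OF is_chart_continuous(2)[OF is_chart_B[OF \<mu>(1)]] z(2)]) (use zt in auto)
    show "(x, cinv \<mu> (z t)) \<in> N" if "t \<in> {0..1}" for t by (rule zt(2)[OF that])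
    fix p
    have "dir_deriv p (\<lambda>u. c (cinv \<kappa> u, cinv \<mu> (z t))) (cmap \<kappa> x)
        = (\<Sum>i\<in>UNIV. p $ i * a i) + t * (\<Sum>i\<in>UNIV. p $ i * b i)" if t: "t \<in> {0..1}" for t
    proof -
      have "dir_deriv p (\<lambda>u. c (cinv \<kappa> u, cinv \<mu> (z t))) (cmap \<kappa> x)
          = dir_deriv (p, 0) (coord_cost c \<kappa> \<mu>) (cmap \<kappa> x, z t)"
        using dir_deriv_coord_cost(1)[OF \<kappa>(1) \<mu>(1) zt(2)[OF t] \<kappa>(2) ch\<mu>(2)[OF zt(1)[OF t]]]
          ch\<mu>(1)[OF zt(1)[OF t]] by simp
      also have "\<dots> = (\<Sum>i\<in>UNIV. p $ i * dir_deriv (axis i 1, 0) (coord_cost c \<kappa> \<mu>) (cmap \<kappa> x, z t))"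
        using linear_eq_sum_axis[OF linear_left[OF G.linear_derivs(1)[OF z(4)[OF t]]], where p = p] by simp
      also have "\<dots> = (\<Sum>i\<in>UNIV. p $ i * a i) + t * (\<Sum>i\<in>UNIV. p $ i * b i)"
        by (simp add: z(5)[OF t] algebra_simps sum.distrib sum_distrib_left)
      finally show ?thesis .
    qed
    then show "\<exists>a b. \<forall>t\<in>{0..1}. dir_deriv p (\<lambda>u. c (cinv \<kappa> u, cinv \<mu> (z t))) (cmap \<kappa> x) = a + t * b"
      by blast
  qed
  moreover have "((\<lambda>t. cmap \<mu> (cinv \<mu> (z t))) has_vector_derivative \<epsilon> *\<^sub>R q) (at 0 within {0..1})"
    by (rule has_vector_derivative_transform[OF _ _ z(6)]) (use ch\<mu>(1) zt(1) in auto)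
  ultimately show ?thesis
    using that[of \<epsilon> "\<lambda>t. cinv \<mu> (z t)"] z(1,3) is_chart_cinv[OF is_chart_B[OF \<mu>(1)] \<mu>(2)] by simp
qed

section \<open>Neighbourhoods of illuminated points\<close>

text \<open>Uniformity in the second component is what the compactness argument along a curve
  requires. The connecting curves come from \<open>left_curves_exist\<close> and are geodesics in
  every chart by \<open>left_geodesicI\<close>.\<close>

lemma illuminated_neighbourhoods:
  assumes N: "(x, xb) \<in> N"
  obtains W Z where "open W" "open Z" "x \<in> W" "xb \<in> Z"
    "\<And>y yb. y \<in> W \<Longrightarrow> yb \<in> Z \<Longrightarrow> y \<in> illuminated A B N c x yb"
proof -
  obtain \<kappa> where \<kappa>: "\<kappa> \<in> A" "x \<in> cdom \<kappa>" by (rule chart_A_exists)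
  obtain \<mu> where \<mu>: "\<mu> \<in> B" "xb \<in> cdom \<mu>" by (rule chart_B_exists)
  interpret G: nondegenerate_coord_cost "coord_cost c \<kappa> \<mu>" "coord_domain \<kappa> \<mu>"
    by (rule coord_cost_nondegenerate[OF \<kappa>(1) \<mu>(1)])
  obtain Y Z where YZ: "open Y" "open Z" "cmap \<kappa> x \<in> Y" "cmap \<mu> xb \<in> Z"
    "\<And>y y' z. y \<in> Y \<Longrightarrow> y' \<in> Y \<Longrightarrow> z \<in> Z \<Longrightarrow> \<exists>u a b. continuous_on {0..1} u \<and> u 0 = y \<and> u 1 = y' \<and>
      (\<forall>t\<in>{0..1}. (u t, z) \<in> coord_domain \<kappa> \<mu> \<and>
        (\<forall>i. dir_deriv (0, axis i 1) (coord_cost c \<kappa> \<mu>) (u t, z) = a i + t * (b i :: real)))"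
    using G.left_curves_exist[OF coord_domainI[OF N \<kappa>(2) \<mu>(2)]] by blast
  note ch\<kappa> = is_chart_cmap_cinv[OF is_chart_A[OF \<kappa>(1)]]
  show ?thesis
  proof (rule that)
    show "open (cdom \<kappa> \<inter> cmap \<kappa> -` Y)"
      by (rule continuous_open_preimage[OF is_chart_continuous(1,5)[OF is_chart_A[OF \<kappa>(1)]] YZ(1)])
    show "open (cdom \<mu> \<inter> cmap \<mu> -` Z)"
      by (rule continuous_open_preimage[OF is_chart_continuous(1,5)[OF is_chart_B[OF \<mu>(1)]] YZ(2)])
    show "x \<in> cdom \<kappa> \<inter> cmap \<kappa> -` Y" "xb \<in> cdom \<mu> \<inter> cmap \<mu> -` Z" using \<kappa> \<mu> YZ by auto
    fix y yb assume y: "y \<in> cdom \<kappa> \<inter> cmap \<kappa> -` Y" and yb: "yb \<in> cdom \<mu> \<inter> cmap \<mu> -` Z"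
    obtain u a b where u: "continuous_on {0..1} u" "u 0 = cmap \<kappa> x" "u 1 = cmap \<kappa> y"
      "\<And>t. t \<in> {0..1} \<Longrightarrow> (u t, cmap \<mu> yb) \<in> coord_domain \<kappa> \<mu>"
      "\<And>t i. t \<in> {0..1} \<Longrightarrow> dir_deriv (0, axis i 1) (coord_cost c \<kappa> \<mu>) (u t, cmap \<mu> yb) = a i + t * (b i :: real)"
      using YZ(5)[OF YZ(3), of "cmap \<kappa> y" "cmap \<mu> yb"] y yb by auto
    have ut: "u t \<in> cmap \<kappa> ` cdom \<kappa>" "(cinv \<kappa> (u t), yb) \<in> N" if "t \<in> {0..1}" for t
      using u(4)[OF that] coord_domain_iff[OF \<kappa>(1) \<mu>(1)] is_chart_cinv[OF is_chart_B[OF \<mu>(1)], of yb] yb by auto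
    have geo: "h_geodesic A B N c (\<lambda>t. (cinv \<kappa> (u t), yb))"
    proof (rule left_geodesicI[OF \<mu>(1)])
      show "yb \<in> cdom \<mu>" using yb by simp
      show "continuous_on {0..1} (\<lambda>t. cinv \<kappa> (u t))"
        by (rule continuous_on_compose2[OF is_chart_continuous(2)[OF is_chart_A[OF \<kappa>(1)]] u(1)]) (use ut in auto)
      show "(cinv \<kappa> (u t), yb) \<in> N" if "t \<in> {0..1}" for t by (rule ut(2)[OF that])
      fix q
      have "dir_deriv q (\<lambda>v. c (cinv \<kappa> (u t), cinv \<mu> v)) (cmap \<mu> yb)
          = (\<Sum>i\<in>UNIV. q $ i * a i) + t * (\<Sum>i\<in>UNIV. q $ i * b i)" if t: "t \<in> {0..1}" for t
      proof -
        have "dir_deriv q (\<lambda>v. c (cinv \<kappa> (u t), cinv \<mu> v)) (cmap \<mu> yb)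
            = dir_deriv (0, q) (coord_cost c \<kappa> \<mu>) (u t, cmap \<mu> yb)"
          using dir_deriv_coord_cost(2)[OF \<kappa>(1) \<mu>(1) ut(2)[OF t] ch\<kappa>(2)[OF ut(1)[OF t]]] yb
            ch\<kappa>(1)[OF ut(1)[OF t]] by simp
        also have "\<dots> = (\<Sum>i\<in>UNIV. q $ i * dir_deriv (0, axis i 1) (coord_cost c \<kappa> \<mu>) (u t, cmap \<mu> yb))"
          using linear_eq_sum_axis[OF linear_right[OF G.linear_derivs(1)[OF u(4)[OF t]]], where p = q] by simp
        also have "\<dots> = (\<Sum>i\<in>UNIV. q $ i * a i) + t * (\<Sum>i\<in>UNIV. q $ i * b i)"
          by (simp add: u(5)[OF t] algebra_simps sum.distrib sum_distrib_left)
        finally show ?thesis .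
      qed
      then show "\<exists>a b. \<forall>t\<in>{0..1}. dir_deriv q (\<lambda>v. c (cinv \<kappa> (u t), cinv \<mu> v)) (cmap \<mu> yb) = a + t * b"
        by blast
    qed
    have ends: "cinv \<kappa> (u 0) = x" "cinv \<kappa> (u 1) = y"
      using u(2,3) is_chart_cinv[OF is_chart_A[OF \<kappa>(1)]] \<kappa>(2) y by auto
    then have "(y, yb) \<in> N" using ut(2)[of 1] by simp
    then show "y \<in> illuminated A B N c x yb"
      unfolding illuminated_def visible_left_def
      using geo ends ut(2) by (auto intro!: exI[of _ "\<lambda>t. (cinv \<kappa> (u t), yb)"])
  qed
qed

text \<open>The tube lemma: finitely many of the sets \<open>Z\<close> cover the compact image of
  the curve, and the corresponding sets \<open>W\<close> are intersected.\<close>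

lemma illuminated_neighbourhood_curve:
  fixes xb :: "real \<Rightarrow> 'k"
  assumes cont: "continuous_on {0..1} xb" and N: "\<And>t. t \<in> {0..1} \<Longrightarrow> (x, xb t) \<in> N"
  obtains W where "open W" "x \<in> W" "W \<subseteq> (\<Inter>t\<in>{0..1}. illuminated A B N c x (xb t))"
proof -
  have "\<exists>W Z. open W \<and> open Z \<and> x \<in> W \<and> yb \<in> Z \<and> (\<forall>y\<in>W. \<forall>yb\<in>Z. y \<in> illuminated A B N c x yb)"
    if "yb \<in> xb ` {0..1}" for yb
  proof -
    have "(x, yb) \<in> N" using that N by auto
    then show ?thesis using illuminated_neighbourhoods by metis
  qed
  then obtain W Z where WZ: "\<And>yb. yb \<in> xb ` {0..1} \<Longrightarrow> open (W yb) \<and> open (Z yb) \<and> x \<in> W yb \<and> yb \<in> Z yb \<and>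
      (\<forall>y\<in>W yb. \<forall>yb\<in>Z yb. y \<in> illuminated A B N c x yb)"
    by metis
  have "compact (xb ` {0..1})" by (rule compact_continuous_image[OF cont compact_Icc])
  then obtain F where F: "F \<subseteq> xb ` {0..1}" "finite F" "xb ` {0..1} \<subseteq> (\<Union>yb\<in>F. Z yb)"
    by (rule compactE_image[of _ "xb ` {0..1}" Z]) (use WZ in auto)
  show ?thesis
  proof (rule that)
    show "open (\<Inter>yb\<in>F. W yb)" by (rule open_INT[OF F(2)]) (use WZ F(1) in blast)
    show "x \<in> (\<Inter>yb\<in>F. W yb)" using WZ F(1) by blast
    show "(\<Inter>yb\<in>F. W yb) \<subseteq> (\<Inter>t\<in>{0..1}. illuminated A B N c x (xb t))"
    proof (intro subsetI INT_I)
      fix y t assume y: "y \<in> (\<Inter>yb\<in>F. W yb)" and t: "t \<in> {0..1::real}"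
      then obtain yb where "yb \<in> F" "xb t \<in> Z yb" using F(3) by blast
      then show "y \<in> illuminated A B N c x (xb t)" using WZ[of yb] F(1) y by blast
    qed
  qed
qed

end

section \<open>The second variation of the cost\<close>

context nondegenerate_manifold_cost
begin

text \<open>This agrees with \<open>cost_second_deriv\<close> in every chart of the first factor.\<close>

definition second_variation :: "('k, 'n) chart \<Rightarrow> real^'n \<Rightarrow> real^'n \<Rightarrow> real^'n \<Rightarrow> 'm \<Rightarrow> real" where
  "second_variation \<mu> q \<alpha> v y =
     dir_deriv q (dir_deriv q (\<lambda>v. c (y, cinv \<mu> v))) v + dir_deriv \<alpha> (\<lambda>v. c (y, cinv \<mu> v)) v"

lemma second_variation_coord:
  assumes "\<kappa> \<in> A" "\<mu> \<in> B" "(y, yb) \<in> N" "y \<in> cdom \<kappa>" "yb \<in> cdom \<mu>"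
  shows "second_variation \<mu> q \<alpha> (cmap \<mu> yb) y
    = cost_second_deriv (coord_cost c \<kappa> \<mu>) q \<alpha> (cmap \<kappa> y, cmap \<mu> yb)"
proof -
  interpret G: nondegenerate_coord_cost "coord_cost c \<kappa> \<mu>" "coord_domain \<kappa> \<mu>"
    by (rule coord_cost_nondegenerate[OF assms(1,2)])
  let ?C = "coord_cost c \<kappa> \<mu>" and ?U = "{v. (cmap \<kappa> y, v) \<in> coord_domain \<kappa> \<mu>}"
  note S = coord_domainI[OF assms(3-5)]
  have eq: "(\<lambda>v. c (y, cinv \<mu> v)) = (\<lambda>v. ?C (cmap \<kappa> y, v))"
    using coord_cost_right[OF assms(1,4)] by simp
  have 1: "dir_deriv w (\<lambda>v. ?C (cmap \<kappa> y, v)) v = dir_deriv (0, w) ?C (cmap \<kappa> y, v)" if "v \<in> ?U" for v w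
    by (rule dir_deriv_slice) (use that G.differentiable_derivs(1) in simp)
  have "dir_deriv q (dir_deriv q (\<lambda>v. ?C (cmap \<kappa> y, v))) (cmap \<mu> yb)
      = dir_deriv q (\<lambda>v. dir_deriv (0, q) ?C (cmap \<kappa> y, v)) (cmap \<mu> yb)"
    by (rule dir_deriv_cong[OF open_slice(2)[OF G.open_S]]) (use S 1 in auto)
  also have "\<dots> = dir_deriv (0, q) (dir_deriv (0, q) ?C) (cmap \<kappa> y, cmap \<mu> yb)"
    by (rule dir_deriv_slice) (rule G.differentiable_derivs(2)[OF S])
  finally show ?thesis
    unfolding second_variation_def cost_second_deriv_def eq using 1 S by simp
qed

text \<open>The geodesic equation is read in a chart around \<open>x\<close>, while \<open>y\<close>
  may need another chart of the first factor. The motion takes place in the second factor, whose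
  chart \<mu> is common to both, so one velocity and one acceleration serve for all
  \<open>y\<close>.\<close>

lemma has_second_derivative_right_geodesic:
  assumes geo: "h_geodesic A B N c (\<lambda>t. (x, xb t))" and t: "t \<in> {0..1}"
    and \<kappa>: "\<kappa> \<in> A" "x \<in> cdom \<kappa>" and \<mu>: "\<mu> \<in> B" "xb t \<in> cdom \<mu>"
  obtains q where "((\<lambda>s. cmap \<mu> (xb s)) has_vector_derivative q) (at t within {0..1})"
    "\<And>y. (y, xb t) \<in> N \<Longrightarrow> \<exists>a. has_second_derivative_01 (\<lambda>s. c (y, xb s)) t a
      (second_variation \<mu> q (- right_christoffel (coord_cost c \<kappa> \<mu>) (cmap \<kappa> x, cmap \<mu> (xb t)) q q)
        (cmap \<mu> (xb t)) y)"
proof -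
  have cont: "continuous_on {0..1} xb" and N: "\<And>t. t \<in> {0..1} \<Longrightarrow> (x, xb t) \<in> N"
    using geo continuous_on_snd[of "{0..1}" "\<lambda>t. (x, xb t)"] by (auto simp: h_geodesic_def)
  obtain w where w0: "\<forall>t\<in>{0..1}. (x, xb t) \<in> cdom \<kappa> \<times> cdom \<mu> \<longrightarrow>
      ((\<lambda>s. pair_coords \<kappa> \<mu> (x, xb s)) has_vector_derivative w t) (at t within {0..1}) \<and>
      (w has_vector_derivative - christoffel (cost_metric (coord_cost c \<kappa> \<mu>))
        (pair_coords \<kappa> \<mu> (x, xb t)) (w t) (w t)) (at t within {0..1})"
    by (rule h_geodesic_chart[OF geo \<kappa>(1) \<mu>(1)])
  have w: "((\<lambda>s. (cmap \<kappa> x, cmap \<mu> (xb s))) has_vector_derivative w s) (at s within {0..1})"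
    "(w has_vector_derivative - christoffel (cost_metric (coord_cost c \<kappa> \<mu>))
        (cmap \<kappa> x, cmap \<mu> (xb s)) (w s) (w s)) (at s within {0..1})"
    if "s \<in> {0..1}" "xb s \<in> cdom \<mu>" for s
    using bspec[OF w0 that(1)] that(2) \<kappa>(2) by (simp_all add: pair_coords_def)
  interpret G: nondegenerate_coord_cost "coord_cost c \<kappa> \<mu>" "coord_domain \<kappa> \<mu>"
    by (rule coord_cost_nondegenerate[OF \<kappa>(1) \<mu>(1)])
  define z where "z s = cmap \<mu> (xb s)" for s
  define q where "q s = snd (w s)" for s
  define \<alpha> where "\<alpha> = - right_christoffel (coord_cost c \<kappa> \<mu>) (cmap \<kappa> x, z t) (q t) (q t)"
  have zd: "(z has_vector_derivative q s) (at s within {0..1})" if "s \<in> {0..1}" "xb s \<in> cdom \<mu>" for s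
    using bounded_linear.has_vector_derivative[OF bounded_linear_snd w(1)[OF that]]
    by (simp add: z_def[abs_def] q_def)
  have qd: "(q has_vector_derivative \<alpha>) (at t within {0..1})"
    using bounded_linear.has_vector_derivative[OF bounded_linear_snd w(2)[OF t \<mu>(2)]]
      G.christoffel_eq[OF coord_domainI[OF N[OF t] \<kappa>(2) \<mu>(2)]]
    by (simp add: q_def[abs_def] \<alpha>_def z_def)
  have ev: "\<forall>\<^sub>F s in at t within {0..1}. s \<in> {s \<in> {0..1}. xb s \<in> cdom \<mu>}"
    by (rule eventually_in_chart[OF cont t is_chart_continuous(5)[OF is_chart_B[OF \<mu>(1)]] \<mu>(2)])
  show ?thesis
  proof (rule that[of "q t"])
    show "((\<lambda>s. cmap \<mu> (xb s)) has_vector_derivative q t) (at t within {0..1})"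
      using zd[OF t \<mu>(2)] by (simp add: z_def[abs_def])
    fix y assume y: "(y, xb t) \<in> N"
    obtain \<kappa>' where \<kappa>': "\<kappa>' \<in> A" "y \<in> cdom \<kappa>'" by (rule chart_A_exists)
    interpret G': nondegenerate_coord_cost "coord_cost c \<kappa>' \<mu>" "coord_domain \<kappa>' \<mu>"
      by (rule coord_cost_nondegenerate[OF \<kappa>'(1) \<mu>(1)])
    obtain d where d: "d > 0" "\<And>s. s \<in> {0..1} \<Longrightarrow> dist s t < d \<Longrightarrow> s \<noteq> t \<Longrightarrow> xb s \<in> cdom \<mu>"
      using ev unfolding eventually_at by auto
    have "has_second_derivative_01 (\<lambda>s. c (y, xb s)) t
        (dir_deriv (0, q t) (coord_cost c \<kappa>' \<mu>) (cmap \<kappa>' y, z t))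
        (dir_deriv (0, q t) (dir_deriv (0, q t) (coord_cost c \<kappa>' \<mu>)) (cmap \<kappa>' y, z t)
          + dir_deriv (0, \<alpha>) (coord_cost c \<kappa>' \<mu>) (cmap \<kappa>' y, z t))"
    proof (rule has_second_derivative_01_chain[where \<zeta> = "\<lambda>s. (cmap \<kappa>' y, z s)" and \<omega> = "\<lambda>s. (0, q s)",
        OF G'.open_S G'.Ck2_derivs(1)])
      show "(cmap \<kappa>' y, z t) \<in> coord_domain \<kappa>' \<mu>" unfolding z_def by (rule coord_domainI[OF y \<kappa>'(2) \<mu>(2)])
      show "((\<lambda>s. (cmap \<kappa>' y, z s)) has_vector_derivative (0, q t)) (at t within {0..1})"
        by (intro has_vector_derivative_Pair has_vector_derivative_const zd t \<mu>)
      show "\<forall>\<^sub>F s in at t within {0..1}. ((\<lambda>s. (cmap \<kappa>' y, z s)) has_vector_derivative (0, q s)) (at s within {0..1})"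
        using ev by eventually_elim (intro has_vector_derivative_Pair has_vector_derivative_const zd; simp)
      show "((\<lambda>s. (0 :: real^'n, q s)) has_vector_derivative (0, \<alpha>)) (at t within {0..1})"
        by (intro has_vector_derivative_Pair has_vector_derivative_const qd)
      have val: "c (y, xb s) = coord_cost c \<kappa>' \<mu> (cmap \<kappa>' y, z s)" if "xb s \<in> cdom \<mu>" for s
        using coord_cost_left[OF \<mu>(1) that] is_chart_cinv[OF is_chart_A[OF \<kappa>'(1)] \<kappa>'(2)] by (simp add: z_def)
      show "c (y, xb t) = coord_cost c \<kappa>' \<mu> (cmap \<kappa>' y, z t)" by (rule val[OF \<mu>(2)])
      show "\<exists>d>0. \<forall>s\<in>{0..1}. \<bar>s - t\<bar> < d \<longrightarrow> c (y, xb s) = coord_cost c \<kappa>' \<mu> (cmap \<kappa>' y, z s)"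
      proof (intro exI[of _ d] conjI ballI impI d(1))
        fix s assume s: "s \<in> {0..1}" "\<bar>s - t\<bar> < d"
        have "xb s \<in> cdom \<mu>" using d(2)[OF s(1)] s(2) \<mu>(2) by (cases "s = t") (auto simp: dist_real_def)
        then show "c (y, xb s) = coord_cost c \<kappa>' \<mu> (cmap \<kappa>' y, z s)" by (rule val)
      qed
    qed (rule t)
    then show "\<exists>a. has_second_derivative_01 (\<lambda>s. c (y, xb s)) t a
      (second_variation \<mu> (q t) (- right_christoffel (coord_cost c \<kappa> \<mu>) (cmap \<kappa> x, cmap \<mu> (xb t)) (q t) (q t))
        (cmap \<mu> (xb t)) y)"
      unfolding second_variation_coord[OF \<kappa>'(1) \<mu>(1) y \<kappa>'(2) \<mu>(2)] cost_second_deriv_def \<alpha>_def z_def by blast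
  qed
qed

text \<open>Here \<open>q\<close> and \<alpha> are constants and only the first component moves; the
  geodesic equation supplies the acceleration that turns the Hessian of the second variation into
  the fourth order form.\<close>

lemma has_second_derivative_left_geodesic:
  assumes geo: "h_geodesic A B N c (\<lambda>s. (y s, xb))" and s: "s \<in> {0..1}"
    and \<kappa>: "\<kappa> \<in> A" "y s \<in> cdom \<kappa>" and \<mu>: "\<mu> \<in> B" "xb \<in> cdom \<mu>"
  obtains p where "has_second_derivative_01 (\<lambda>s. second_variation \<mu> q \<alpha> (cmap \<mu> xb) (y s)) s
      (dir_deriv (p, 0) (cost_second_deriv (coord_cost c \<kappa> \<mu>) q \<alpha>) (cmap \<kappa> (y s), cmap \<mu> xb))
      (fourth_order_form (coord_cost c \<kappa> \<mu>) (cmap \<kappa> (y s), cmap \<mu> xb) p q)"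
proof -
  have cont: "continuous_on {0..1} y" and N: "\<And>s. s \<in> {0..1} \<Longrightarrow> (y s, xb) \<in> N"
    using geo continuous_on_fst[of "{0..1}" "\<lambda>s. (y s, xb)"] by (auto simp: h_geodesic_def)
  define z where "z = cmap \<mu> xb"
  obtain w where w0: "\<forall>t\<in>{0..1}. (y t, xb) \<in> cdom \<kappa> \<times> cdom \<mu> \<longrightarrow>
      ((\<lambda>s. pair_coords \<kappa> \<mu> (y s, xb)) has_vector_derivative w t) (at t within {0..1}) \<and>
      (w has_vector_derivative - christoffel (cost_metric (coord_cost c \<kappa> \<mu>))
        (pair_coords \<kappa> \<mu> (y t, xb)) (w t) (w t)) (at t within {0..1})"
    by (rule h_geodesic_chart[OF geo \<kappa>(1) \<mu>(1)])
  have w: "((\<lambda>s. (cmap \<kappa> (y s), z)) has_vector_derivative w r) (at r within {0..1})"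
    "(w has_vector_derivative - christoffel (cost_metric (coord_cost c \<kappa> \<mu>))
        (cmap \<kappa> (y r), z) (w r) (w r)) (at r within {0..1})"
    if "r \<in> {0..1}" "y r \<in> cdom \<kappa>" for r
    using bspec[OF w0 that(1)] that(2) \<mu>(2) by (simp_all add: pair_coords_def z_def)
  interpret G: nondegenerate_coord_cost "coord_cost c \<kappa> \<mu>" "coord_domain \<kappa> \<mu>"
    by (rule coord_cost_nondegenerate[OF \<kappa>(1) \<mu>(1)])
  let ?f = "cost_second_deriv (coord_cost c \<kappa> \<mu>) q \<alpha>"
  have S: "(cmap \<kappa> (y s), z) \<in> coord_domain \<kappa> \<mu>"
    unfolding z_def by (rule coord_domainI[OF N[OF s] \<kappa>(2) \<mu>(2)])
  have ev: "\<forall>\<^sub>F r in at s within {0..1}. r \<in> {r \<in> {0..1}. y r \<in> cdom \<kappa>}"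
    by (rule eventually_in_chart[OF cont s is_chart_continuous(5)[OF is_chart_A[OF \<kappa>(1)]] \<kappa>(2)])
  obtain d where d: "d > 0" "\<And>r. r \<in> {0..1} \<Longrightarrow> dist r s < d \<Longrightarrow> r \<noteq> s \<Longrightarrow> y r \<in> cdom \<kappa>"
    using ev unfolding eventually_at by auto
  define p where "p = fst (w s)"
  \<comment> \<open>The velocity provided by \<open>h_geodesic\<close> is an arbitrary vector of the
    product; its second component vanishes because the curve does not move there and derivatives
    within [0, 1] are unique.\<close>
  have "((\<lambda>r. z) has_vector_derivative snd (w s)) (at s within {0..1})"
    using bounded_linear.has_vector_derivative[OF bounded_linear_snd w(1)[OF s \<kappa>(2)]] by simp
  then have "snd (w s) = 0"
    using vector_derivative_unique_within_closed_interval[of 0 1 s "\<lambda>r. z" "snd (w s)" 0] s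
      has_vector_derivative_const by auto
  then have ws: "w s = (p, 0)" by (simp add: p_def prod_eq_iff)
  have \<Gamma>: "christoffel (cost_metric (coord_cost c \<kappa> \<mu>)) (cmap \<kappa> (y s), z) (p, 0) (p, 0)
      = (left_christoffel (coord_cost c \<kappa> \<mu>) (cmap \<kappa> (y s), z) p p, 0)"
    using linear_0[OF G.linear_right_christoffel(1)[OF S]] by (simp add: G.christoffel_eq[OF S])
  have val: "second_variation \<mu> q \<alpha> z (y r) = ?f (cmap \<kappa> (y r), z)" if "r \<in> {0..1}" "y r \<in> cdom \<kappa>" for r
    unfolding z_def by (rule second_variation_coord[OF \<kappa>(1) \<mu>(1) N[OF that(1)] that(2) \<mu>(2)])
  have "has_second_derivative_01 (\<lambda>s. second_variation \<mu> q \<alpha> z (y s)) s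
      (dir_deriv (w s) ?f (cmap \<kappa> (y s), z))
      (dir_deriv (w s) (dir_deriv (w s) ?f) (cmap \<kappa> (y s), z)
        + dir_deriv (- christoffel (cost_metric (coord_cost c \<kappa> \<mu>)) (cmap \<kappa> (y s), z) (w s) (w s)) ?f (cmap \<kappa> (y s), z))"
  proof (rule has_second_derivative_01_chain[where \<zeta> = "\<lambda>s. (cmap \<kappa> (y s), z)" and \<omega> = w and t = s and f = ?f
        and g = "\<lambda>s. second_variation \<mu> q \<alpha> z (y s)",
      OF G.open_S G.Ck2_cost_second_deriv S s w(1)[OF s \<kappa>(2)] _ w(2)[OF s \<kappa>(2)] val[OF s \<kappa>(2)]])
    show "\<forall>\<^sub>F r in at s within {0..1}. ((\<lambda>s. (cmap \<kappa> (y s), z)) has_vector_derivative w r) (at r within {0..1})"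
      using ev by eventually_elim (use w(1) in blast)
    show "\<exists>d>0. \<forall>r\<in>{0..1}. \<bar>r - s\<bar> < d \<longrightarrow> second_variation \<mu> q \<alpha> z (y r) = ?f (cmap \<kappa> (y r), z)"
    proof (intro exI[of _ d] conjI ballI impI d(1))
      fix r assume r: "r \<in> {0..1}" "\<bar>r - s\<bar> < d"
      have "y r \<in> cdom \<kappa>" using d(2)[OF r(1)] r(2) \<kappa>(2) by (cases "r = s") (auto simp: dist_real_def)
      then show "second_variation \<mu> q \<alpha> z (y r) = ?f (cmap \<kappa> (y r), z)" by (rule val[OF r(1)])
    qed
  qed
  then show ?thesis
    using that[of p] G.cost_second_deriv_left_geodesic[OF S, of p q \<alpha>] unfolding ws \<Gamma> by (simp add: z_def)
qed

section \<open>Sign of the cross-curvature and convexity\<close>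

lemma nonneg_cross_curved_iff:
  "nonneg_cross_curved A B N c \<longleftrightarrow> (\<forall>\<kappa>\<in>A. \<forall>\<mu>\<in>B. \<forall>z\<in>coord_domain \<kappa> \<mu>. \<forall>p q.
     fourth_order_form (coord_cost c \<kappa> \<mu>) z p q \<le> 0)"
proof -
  have "cross_curvature (coord_cost c \<kappa> \<mu>) z p q \<ge> 0 \<longleftrightarrow> fourth_order_form (coord_cost c \<kappa> \<mu>) z p q \<le> 0"
    if "\<kappa> \<in> A" "\<mu> \<in> B" "z \<in> coord_domain \<kappa> \<mu>" for \<kappa> \<mu> z p q
    using nondegenerate_coord_cost.cross_curvature_eq[OF coord_cost_nondegenerate[OF that(1,2)] that(3)] by simp
  then show ?thesis
    unfolding nonneg_cross_curved_def by (auto simp: coord_domain_def)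
qed

text \<open>Along a geodesic from \<open>x\<close> to \<open>y\<close> with second component fixed, the second variation is
  concave by the curvature assumption and has a critical point at \<open>x\<close>.\<close>

lemma second_variation_le:
  assumes nn: "nonneg_cross_curved A B N c" and y: "y \<in> illuminated A B N c x xb"
    and \<kappa>: "\<kappa> \<in> A" "x \<in> cdom \<kappa>" and \<mu>: "\<mu> \<in> B" "xb \<in> cdom \<mu>"
    and \<alpha>: "\<alpha> = - right_christoffel (coord_cost c \<kappa> \<mu>) (cmap \<kappa> x, cmap \<mu> xb) q q"
  shows "second_variation \<mu> q \<alpha> (cmap \<mu> xb) y \<le> second_variation \<mu> q \<alpha> (cmap \<mu> xb) x"
proof -
  obtain \<gamma> where \<gamma>: "h_geodesic A B N c \<gamma>" "\<gamma> 0 = (x, xb)" "\<gamma> 1 = (y, xb)"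
    "\<gamma> ` {0..1} \<subseteq> visible_left N xb \<times> {xb}"
    using y by (auto simp: illuminated_def)
  define u where "u s = fst (\<gamma> s)" for s
  have eq: "\<gamma> s = (u s, xb)" if "s \<in> {0..1}" for s
    using \<gamma>(4) that by (force simp: u_def prod_eq_iff)
  have geo: "h_geodesic A B N c (\<lambda>s. (u s, xb))" by (rule h_geodesic_cong[OF \<gamma>(1) eq])
  have N: "(u s, xb) \<in> N" if "s \<in> {0..1}" for s
    using geo that by (auto simp: h_geodesic_def)
  have u01: "u 0 = x" "u 1 = y" using \<gamma> by (simp_all add: u_def)
  let ?\<Phi> = "\<lambda>s. second_variation \<mu> q \<alpha> (cmap \<mu> xb) (u s)"
  have "\<exists>a b. has_second_derivative_01 ?\<Phi> s a b \<and> b \<le> 0 \<and> (s = 0 \<longrightarrow> a = 0)" if s: "s \<in> {0..1}" for s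
  proof -
    \<comment> \<open>At time 0 the chart must be \<kappa> itself, because \<alpha> is given by the
      Christoffel symbol in that chart and the critical point condition is verified there.\<close>
    obtain \<kappa>' where \<kappa>': "\<kappa>' \<in> A" "u s \<in> cdom \<kappa>'" "s = 0 \<Longrightarrow> \<kappa>' = \<kappa>"
      using \<kappa> u01(1) chart_A_exists by metis
    note S = coord_domainI[OF N[OF s] \<kappa>'(2) \<mu>(2)]
    interpret G: nondegenerate_coord_cost "coord_cost c \<kappa>' \<mu>" "coord_domain \<kappa>' \<mu>"
      by (rule coord_cost_nondegenerate[OF \<kappa>'(1) \<mu>(1)])
    obtain p where p: "has_second_derivative_01 ?\<Phi> s
        (dir_deriv (p, 0) (cost_second_deriv (coord_cost c \<kappa>' \<mu>) q \<alpha>) (cmap \<kappa>' (u s), cmap \<mu> xb))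
        (fourth_order_form (coord_cost c \<kappa>' \<mu>) (cmap \<kappa>' (u s), cmap \<mu> xb) p q)"
      by (rule has_second_derivative_left_geodesic[OF geo s \<kappa>'(1,2) \<mu>])
    have "fourth_order_form (coord_cost c \<kappa>' \<mu>) (cmap \<kappa>' (u s), cmap \<mu> xb) p q \<le> 0"
      using nn[unfolded nonneg_cross_curved_iff] \<kappa>'(1) \<mu>(1) S by blast
    moreover have "dir_deriv (p, 0) (cost_second_deriv (coord_cost c \<kappa>' \<mu>) q \<alpha>) (cmap \<kappa>' (u s), cmap \<mu> xb) = 0"
      if "s = 0"
      using G.dir_deriv_cost_second_deriv_eq_0[OF S, of p q] \<kappa>'(3)[OF that] that u01(1) by (simp add: \<alpha>)
    ultimately show ?thesis using p by blast
  qed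
  then obtain a b where ab: "\<And>s. s \<in> {0..1} \<Longrightarrow> has_second_derivative_01 ?\<Phi> s (a s) (b s)"
    "\<And>s. s \<in> {0..1} \<Longrightarrow> b s \<le> 0" "a 0 = 0"
    by (metis atLeastAtMost_iff order_refl zero_le_one)
  show ?thesis using concave_critical_01[of ?\<Phi> a b, OF ab] u01 by simp
qed

lemma illuminated_imp_twice_diff_convex:
  assumes nn: "nonneg_cross_curved A B N c" and geo: "h_geodesic A B N c (\<lambda>t. (x, xb t))"
    and y: "y \<in> (\<Inter>t\<in>{0..1}. illuminated A B N c x (xb t))"
  shows "twice_diff_convex (\<lambda>t. - c (y, xb t) + c (x, xb t))"
proof -
  let ?f = "\<lambda>t. c (x, xb t) - c (y, xb t)"
  have "\<exists>a b. has_second_derivative_01 ?f t a b \<and> 0 \<le> b" if t: "t \<in> {0..1}" for t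
  proof -
    obtain \<kappa> where \<kappa>: "\<kappa> \<in> A" "x \<in> cdom \<kappa>" by (rule chart_A_exists)
    obtain \<mu> where \<mu>: "\<mu> \<in> B" "xb t \<in> cdom \<mu>" by (rule chart_B_exists)
    have ill: "y \<in> illuminated A B N c x (xb t)" using y t by blast
    have N: "(x, xb t) \<in> N" "(y, xb t) \<in> N"
      using geo t ill by (auto simp: h_geodesic_def illuminated_def visible_left_def)
    \<comment> \<open>The same \<open>q\<close> works for \<open>x\<close> and for \<open>y\<close>;
      hence the second derivative of \<open>?f\<close> at \<open>t\<close> is a difference of two
      values of one second variation, which \<open>second_variation_le\<close> makes
      nonnegative.\<close>
    obtain q where q: "\<And>y. (y, xb t) \<in> N \<Longrightarrow> \<exists>a. has_second_derivative_01 (\<lambda>s. c (y, xb s)) t a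
      (second_variation \<mu> q (- right_christoffel (coord_cost c \<kappa> \<mu>) (cmap \<kappa> x, cmap \<mu> (xb t)) q q)
        (cmap \<mu> (xb t)) y)"
      using has_second_derivative_right_geodesic[OF geo t \<kappa> \<mu>] by blast
    show ?thesis
      using q[OF N(1)] q[OF N(2)] has_second_derivative_01_diff
        second_variation_le[OF nn ill \<kappa> \<mu> refl, of q] by fastforce
  qed
  then obtain a b where ab: "\<And>t. t \<in> {0..1} \<Longrightarrow> has_second_derivative_01 ?f t (a t) (b t)"
    "\<And>t. t \<in> {0..1} \<Longrightarrow> 0 \<le> b t"
    by metis
  have "twice_diff_convex ?f"
    using has_second_derivative_01D[of ?f a b] ab by (intro twice_diff_convexI[of ?f a b]) blast+
  then show ?thesis by (simp add: algebra_simps)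
qed

text \<open>Convexity is exploited at time 0 alone, the time at which the velocity of the geodesic
  can be prescribed.\<close>

lemma fourth_order_form_nonpos:
  assumes convex: "\<And>x xb. h_geodesic A B N c (\<lambda>t. (x, xb t)) \<Longrightarrow>
      \<exists>W. open W \<and> x \<in> W \<and> W \<subseteq> (\<Inter>t\<in>{0..1}. illuminated A B N c x (xb t)) \<and>
        (\<forall>y\<in>W. twice_diff_convex (\<lambda>t. - c (y, xb t) + c (x, xb t)))"
    and \<kappa>: "\<kappa> \<in> A" "x \<in> cdom \<kappa>" and \<mu>: "\<mu> \<in> B" "xb \<in> cdom \<mu>" and N: "(x, xb) \<in> N"
  shows "fourth_order_form (coord_cost c \<kappa> \<mu>) (cmap \<kappa> x, cmap \<mu> xb) p q \<le> 0"
proof -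
  interpret G: nondegenerate_coord_cost "coord_cost c \<kappa> \<mu>" "coord_domain \<kappa> \<mu>"
    by (rule coord_cost_nondegenerate[OF \<kappa>(1) \<mu>(1)])
  let ?z = "(cmap \<kappa> x, cmap \<mu> xb)"
  have S: "?z \<in> coord_domain \<kappa> \<mu>" by (rule coord_domainI[OF N \<kappa>(2) \<mu>(2)])
  obtain \<epsilon> \<gamma> where \<gamma>: "\<epsilon> > 0" "h_geodesic A B N c (\<lambda>t. (x, \<gamma> t))" "\<gamma> 0 = xb"
    "((\<lambda>t. cmap \<mu> (\<gamma> t)) has_vector_derivative \<epsilon> *\<^sub>R q) (at 0 within {0..1})"
    by (rule right_geodesic_exists[OF \<kappa> \<mu> N])
  obtain W where W: "open W" "x \<in> W" "W \<subseteq> (\<Inter>t\<in>{0..1}. illuminated A B N c x (\<gamma> t))"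
    "\<And>y. y \<in> W \<Longrightarrow> twice_diff_convex (\<lambda>t. - c (y, \<gamma> t) + c (x, \<gamma> t))"
    using convex[OF \<gamma>(2)] by blast
  have zero: "(0::real) \<in> {0..1}" by simp
  obtain q' where q': "((\<lambda>s. cmap \<mu> (\<gamma> s)) has_vector_derivative q') (at 0 within {0..1})"
    "\<And>y. (y, xb) \<in> N \<Longrightarrow> \<exists>a. has_second_derivative_01 (\<lambda>s. c (y, \<gamma> s)) 0 a
      (second_variation \<mu> q' (- right_christoffel (coord_cost c \<kappa> \<mu>) ?z q' q') (cmap \<mu> xb) y)"
    using has_second_derivative_right_geodesic[OF \<gamma>(2) zero \<kappa> \<mu>(1)] \<mu>(2) unfolding \<gamma>(3) by blast
  have q'_eq: "q' = \<epsilon> *\<^sub>R q"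
    using vector_derivative_unique_within_closed_interval[of 0 1 0 _ q' "\<epsilon> *\<^sub>R q"] q'(1) \<gamma>(4) by auto
  define \<alpha> where "\<alpha> = - right_christoffel (coord_cost c \<kappa> \<mu>) ?z q' q'"
  let ?\<phi> = "second_variation \<mu> q' \<alpha> (cmap \<mu> xb)" and ?f = "cost_second_deriv (coord_cost c \<kappa> \<mu>) q' \<alpha>"
  have le: "?\<phi> y \<le> ?\<phi> x" if y: "y \<in> W" for y
  proof -
    have "(y, xb) \<in> N" using W(3) y \<gamma>(3) zero by (fastforce simp: illuminated_def visible_left_def)
    then obtain a a' where "has_second_derivative_01 (\<lambda>s. c (y, \<gamma> s)) 0 a (?\<phi> y)"
      "has_second_derivative_01 (\<lambda>s. c (x, \<gamma> s)) 0 a' (?\<phi> x)"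
      using q'(2) N unfolding \<alpha>_def by blast
    then have second: "has_second_derivative_01 (\<lambda>s. - c (y, \<gamma> s) + c (x, \<gamma> s)) 0 (a' - a) (?\<phi> x - ?\<phi> y)"
      using has_second_derivative_01_diff by fastforce
    obtain f' f'' where f: "\<forall>t\<in>{0..1}. ((\<lambda>t. - c (y, \<gamma> t) + c (x, \<gamma> t)) has_real_derivative f' t) (at t within {0..1}) \<and>
        (f' has_real_derivative f'' t) (at t within {0..1}) \<and> f'' t \<ge> 0"
      using W(4)[OF y] unfolding twice_diff_convex_def by blast
    \<comment> \<open>The derivatives at 0 are one-sided; uniqueness within [0, 1] identifies the
      second derivative supplied by convexity with the one computed from the geodesic.\<close>
    have "f'' 0 = ?\<phi> x - ?\<phi> y"
      by (rule has_second_derivative_01_unique[OF zero second]) (use f zero in blast)+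
    moreover have "f'' 0 \<ge> 0" using f zero by blast
    ultimately show ?thesis by simp
  qed
  \<comment> \<open>A straight coordinate line replaces a geodesic here: at a critical point the
    second derivative along a curve depends on its velocity only.\<close>
  define \<zeta> where "\<zeta> s = (cmap \<kappa> x + s *\<^sub>R p, cmap \<mu> xb)" for s :: real
  have \<zeta>d: "(\<zeta> has_vector_derivative (p, 0)) (at s)" for s
    unfolding \<zeta>_def[abs_def] has_vector_derivative_def by (auto intro!: derivative_eq_intros)
  have "\<forall>\<^sub>F s in at 0. \<zeta> s \<in> coord_domain \<kappa> \<mu>"
    by (rule has_vector_derivative_imp_eventually_in[OF \<zeta>d G.open_S]) (simp add: \<zeta>_def S)
  moreover have "\<forall>\<^sub>F s in at 0. cinv \<kappa> (fst (\<zeta> s)) \<in> W"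
  proof -
    have "isCont (\<lambda>s. cinv \<kappa> (fst (\<zeta> s))) 0"
    proof (rule isCont_o2[where f = "\<lambda>s. fst (\<zeta> s)" and g = "cinv \<kappa>"])
      show "isCont (\<lambda>s. fst (\<zeta> s)) 0" by (auto simp: \<zeta>_def intro!: continuous_intros)
      show "isCont (cinv \<kappa>) (fst (\<zeta> 0))"
        using is_chart_continuous(4)[OF is_chart_A[OF \<kappa>(1)]] \<kappa>(2) by (simp add: \<zeta>_def)
    qed
    then have "((\<lambda>s. cinv \<kappa> (fst (\<zeta> s))) \<longlongrightarrow> x) (at 0)"
      using is_chart_cinv[OF is_chart_A[OF \<kappa>(1)] \<kappa>(2)] by (simp add: isCont_def \<zeta>_def)
    then show ?thesis using W(1,2) by (rule topological_tendstoD)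
  qed
  ultimately have "\<forall>\<^sub>F s in at 0. \<zeta> s \<in> coord_domain \<kappa> \<mu> \<and> cinv \<kappa> (fst (\<zeta> s)) \<in> W"
    by (rule eventually_conj)
  then obtain d where d: "d > 0" "\<And>s. s \<noteq> 0 \<Longrightarrow> \<bar>s\<bar> < d \<Longrightarrow> \<zeta> s \<in> coord_domain \<kappa> \<mu> \<and> cinv \<kappa> (fst (\<zeta> s)) \<in> W"
    unfolding eventually_at by (auto simp: dist_real_def)
  have \<zeta>S: "\<zeta> s \<in> coord_domain \<kappa> \<mu>" if "\<bar>s\<bar> < d" for s
    using d(2)[OF _ that] S by (cases "s = 0") (auto simp: \<zeta>_def)
  have D: "((\<lambda>s. g (\<zeta> s)) has_real_derivative dir_deriv (p, 0) g (\<zeta> s)) (at s)"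
    if "g differentiable (at (\<zeta> s))" for g s
    using has_vector_derivative_dir_deriv[where T = UNIV and \<zeta> = \<zeta>, OF that] \<zeta>d
    by (simp add: has_real_derivative_iff_has_vector_derivative)
  have \<zeta>0: "\<zeta> 0 = ?z" by (simp add: \<zeta>_def)
  have df: "?f differentiable (at w)" "dir_deriv (p, 0) ?f differentiable (at w)" if "w \<in> coord_domain \<kappa> \<mu>" for w
    using Ck_on_differentiable[OF G.Ck2_cost_second_deriv _ that]
      Ck_on_differentiable[OF Ck_on_dir_deriv[OF G.Ck2_cost_second_deriv, of 1] _ that] by auto
  have crit: "dir_deriv (u, 0) ?f ?z = 0" for u
    unfolding \<alpha>_def by (rule G.dir_deriv_cost_second_deriv_eq_0[OF S])
  have "dir_deriv (p, 0) (dir_deriv (p, 0) ?f) ?z \<le> 0"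
  proof (rule second_derivative_nonpos_at_maximum[where h = "\<lambda>s. ?f (\<zeta> s)" and h' = "\<lambda>s. dir_deriv (p, 0) ?f (\<zeta> s)"])
    show "0 < d" by (rule d(1))
    show "((\<lambda>s. ?f (\<zeta> s)) has_real_derivative dir_deriv (p, 0) ?f (\<zeta> s)) (at s)" if "\<bar>s\<bar> < d" for s
      by (rule D[OF df(1)[OF \<zeta>S[OF that]]])
    show "((\<lambda>s. dir_deriv (p, 0) ?f (\<zeta> s)) has_real_derivative dir_deriv (p, 0) (dir_deriv (p, 0) ?f) ?z) (at 0)"
      using D[OF df(2), of 0] S \<zeta>0 by simp
    show "dir_deriv (p, 0) ?f (\<zeta> 0) = 0" unfolding \<zeta>0 by (rule crit)
    fix s :: real assume s: "0 < s" "s < d"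
    let ?y = "cinv \<kappa> (fst (\<zeta> s))"
    have "\<zeta> s \<in> coord_domain \<kappa> \<mu>" using \<zeta>S[of s] s by simp
    then have y: "fst (\<zeta> s) \<in> cmap \<kappa> ` cdom \<kappa>" "(?y, xb) \<in> N"
      using coord_domain_iff[OF \<kappa>(1) \<mu>(1), of "fst (\<zeta> s)" "cmap \<mu> xb"] is_chart_cinv[OF is_chart_B[OF \<mu>(1)] \<mu>(2)]
      by (auto simp: \<zeta>_def)
    note ch = is_chart_cmap_cinv[OF is_chart_A[OF \<kappa>(1)] y(1)]
    have "?f (\<zeta> s) = ?\<phi> ?y"
      using second_variation_coord[OF \<kappa>(1) \<mu>(1) y(2) ch(2) \<mu>(2)] ch(1) by (simp add: \<zeta>_def)
    also have "\<dots> \<le> ?\<phi> x" using le d(2)[of s] s by simp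
    also have "\<dots> = ?f (\<zeta> 0)"
      using second_variation_coord[OF \<kappa>(1) \<mu>(1) N \<kappa>(2) \<mu>(2)] by (simp add: \<zeta>0)
    finally show "?f (\<zeta> s) \<le> ?f (\<zeta> 0)" .
  qed
  \<comment> \<open>The Christoffel correction in \<open>cost_second_deriv_left_geodesic\<close> is
    a first derivative at the critical point and vanishes.\<close>
  then have "fourth_order_form (coord_cost c \<kappa> \<mu>) ?z p q' \<le> 0"
    using G.cost_second_deriv_left_geodesic[OF S, of p q' \<alpha>] crit by simp
  then show ?thesis
    using \<gamma>(1) by (simp add: q'_eq G.fourth_order_form_scaleR[OF S] mult_le_0_iff)
qed

end

theorem theorem2p10:
  fixes A :: "('m::{t2_space, second_countable_topology}, 'n::finite) chart set"
    and B :: "('k::{t2_space, second_countable_topology}, 'n) chart set"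
    and N :: "('m \<times> 'k) set"
    and c :: "'m \<times> 'k \<Rightarrow> real"
  assumes "smooth_atlas A" and "smooth_atlas B"
    and "open N"
    and "Ck_cost 4 A B N c"
    and "bi_twisted A B N c"
    and "nondegenerate_cost A B N c"
  shows "nonneg_cross_curved A B N c \<longleftrightarrow>
    (\<forall>x xb. h_geodesic A B N c (\<lambda>t. (x, xb t)) \<longrightarrow>
      (\<exists>W. open W \<and> x \<in> W \<and> W \<subseteq> (\<Inter>t\<in>{0..1}. illuminated A B N c x (xb t)) \<and>
        (\<forall>U. open U \<and> x \<in> U \<and> U \<subseteq> W \<longrightarrow>
          (\<forall>y\<in>U. twice_diff_convex (\<lambda>t. - c (y, xb t) + c (x, xb t))))))"
    (is "?L \<longleftrightarrow> ?R")
proof -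
  interpret nondegenerate_manifold_cost A B N c
    by standard (use assms in auto)
  show ?thesis
  proof
    assume L: ?L
    show ?R
    proof (intro allI impI)
      fix x xb assume geo: "h_geodesic A B N c (\<lambda>t. (x, xb t))"
      have "continuous_on {0..1} xb" "\<And>t. t \<in> {0..1} \<Longrightarrow> (x, xb t) \<in> N"
        using geo continuous_on_snd[of "{0..1}" "\<lambda>t. (x, xb t)"] by (auto simp: h_geodesic_def)
      \<comment> \<open>That the commonly illuminated set contains a neighbourhood of
        \<open>x\<close> is part of the claim; convexity then holds at each of its points, whatever
        the smaller neighbourhood.\<close>
      then obtain W where W: "open W" "x \<in> W" "W \<subseteq> (\<Inter>t\<in>{0..1}. illuminated A B N c x (xb t))"
        by (rule illuminated_neighbourhood_curve)
      then show "\<exists>W. open W \<and> x \<in> W \<and> W \<subseteq> (\<Inter>t\<in>{0..1}. illuminated A B N c x (xb t)) \<and>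
        (\<forall>U. open U \<and> x \<in> U \<and> U \<subseteq> W \<longrightarrow>
          (\<forall>y\<in>U. twice_diff_convex (\<lambda>t. - c (y, xb t) + c (x, xb t))))"
        using illuminated_imp_twice_diff_convex[OF L geo] by (intro exI[of _ W]) blast
    qed
  next
    assume R: ?R
    have convex: "\<exists>W. open W \<and> x \<in> W \<and> W \<subseteq> (\<Inter>t\<in>{0..1}. illuminated A B N c x (xb t)) \<and>
        (\<forall>y\<in>W. twice_diff_convex (\<lambda>t. - c (y, xb t) + c (x, xb t)))"
      if geo: "h_geodesic A B N c (\<lambda>t. (x, xb t))" for x xb
    proof -
      obtain W where W: "open W" "x \<in> W" "W \<subseteq> (\<Inter>t\<in>{0..1}. illuminated A B N c x (xb t))"
        "\<forall>U. open U \<and> x \<in> U \<and> U \<subseteq> W \<longrightarrow>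
          (\<forall>y\<in>U. twice_diff_convex (\<lambda>t. - c (y, xb t) + c (x, xb t)))"
        using R[THEN spec, THEN spec, THEN mp, OF geo] by (elim exE conjE)
      \<comment> \<open>The set \<open>W\<close> is itself one of the admissible neighbourhoods
        \<open>U\<close>.\<close>
      have "\<forall>y\<in>W. twice_diff_convex (\<lambda>t. - c (y, xb t) + c (x, xb t))"
        by (rule spec[OF W(4), THEN mp]) (use W in auto)
      then show ?thesis by (intro exI[of _ W] conjI W(1-3))
    qed
    show ?L
      unfolding nonneg_cross_curved_iff
      using fourth_order_form_nonpos[OF convex]
      by (auto simp: coord_domain_def pair_coords_def)
  qed
qed

end
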